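(* Let $(M,\zeta)$ be a closed normalization of a null hypersurface $M$ in a simply connected Lorentzian manifold $(\overline{M},\overline{g})$. Assume that $M$ is $\widetilde{g}$-complete and that the null second fundamental form $B$ restricts to a definite form on the screen distribution $\mathscr{S}(\zeta)$. Then $(M,\widetilde{g})$ contains no closed geodesics.
   Context: A null hypersurface $M$ in a Lorentzian manifold $(\overline{M},\overline{g})$ is a smooth codimension-one submanifold such that the restriction of $\overline{g}$ to each $T_pM$ is degenerate. A rigging for $M$ is a vector field $\zeta$ on an open set containing $M$ with $\zeta_p\notin T_pM$ for each $p\in M$; $(M,\zeta)$ is called a normalization, and it is closed if the $1$-form $\alpha=\overline{g}(\zeta,\cdot)$ is closed. With $i:M\hookrightarrow\overline{M}$ the inclusion and $\omega=i^{\star}\alpha$, the rigged metric is the Riemannian metric $\widetilde{g}=i^{\star}(\overline{g}+\alpha\otimes\alpha)$ on $M$; $M$ is $\widetilde{g}$-complete if $(M,\widetilde{g})$ is complete. The rigged vector field $\xi$ is the vector field $\widetilde{g}$-equivalent to $\omega$ (the unique lightlike vector field tangent to $M$ with $\overline{g}(\zeta,\xi)=1$). The screen distribution is $\mathscr{S}(\zeta)=TM\cap\zeta^{\perp}=\ker\omega$. The null second fundamental form is the symmetric tensor $B(X,Y)=\overline{g}(\overline{\nabla}_XY,\xi)$ for $X,Y$ tangent to $M$, with $\overline{\nabla}$ the Levi-Civita connection of $\overline{g}$. Closed geodesics are understood to be non-constant.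
   Formalization: Simple connectedness is assumed of the open set containing M on which the rigging ζ is defined (possibly all of the Lorentzian manifold), not of the ambient manifold; if ζ lives only on a non-simply-connected neighbourhood of M, the claim can fail. *)

theory Defs
  imports "HOL-Analysis.Analysis"
begin

section \<open>Smooth maps and manifolds\<close>

fun Ck_on :: "nat \<Rightarrow> 'a::real_normed_vector set \<Rightarrow> ('a \<Rightarrow> 'b::real_normed_vector) \<Rightarrow> bool" where
  "Ck_on 0 S f \<longleftrightarrow> continuous_on S f"
| "Ck_on (Suc k) S f \<longleftrightarrow>
     (\<forall>x\<in>S. f differentiable (at x)) \<and> (\<forall>v. Ck_on k S (\<lambda>x. frechet_derivative f (at x) v))"

text \<open>Only meant for open \<open>S\<close>.\<close>
definition smooth_on :: "'a::real_normed_vector set \<Rightarrow> ('a \<Rightarrow> 'b::real_normed_vector) \<Rightarrow> bool" where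
  "smooth_on S f \<longleftrightarrow> (\<forall>k. Ck_on k S f)"

text \<open>A chart is a pair of a domain and a coordinate map; values of the coordinate map outside
  the domain are irrelevant.\<close>
type_synonym ('m, 'e) chart = "'m set \<times> ('m \<Rightarrow> 'e)"

definition cdom :: "('m, 'e) chart \<Rightarrow> 'm set" where "cdom c = fst c"
definition cmap :: "('m, 'e) chart \<Rightarrow> 'm \<Rightarrow> 'e" where "cmap c = snd c"
definition cinv :: "('m, 'e) chart \<Rightarrow> 'e \<Rightarrow> 'm" where "cinv c = inv_into (cdom c) (cmap c)"

text \<open>The coordinate expression of the identity of points, from coordinates \<open>d\<close> to coordinates \<open>c\<close>.
  The model spaces may differ: for two charts of one manifold this is the transition map,
  for a chart \<open>d\<close> of a submanifold and a chart \<open>c\<close> of the ambient manifold it is the coordinate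
  expression of the inclusion, and \<open>tmap\<close> is the matrix of the differential of the inclusion.\<close>
definition trans_map :: "('m, 'f) chart \<Rightarrow> ('m, 'e) chart \<Rightarrow> 'f \<Rightarrow> 'e" where
  "trans_map d c = cmap c \<circ> cinv d"

definition tmap :: "('m, 'f::real_normed_vector) chart \<Rightarrow> ('m, 'e::real_normed_vector) chart
    \<Rightarrow> 'm \<Rightarrow> 'f \<Rightarrow> 'e" where
  "tmap d c p = frechet_derivative (trans_map d c) (at (cmap d p))"

definition smooth_manifold ::
  "'m::{second_countable_topology,t2_space} set \<Rightarrow> ('m, 'e::euclidean_space) chart set \<Rightarrow> bool" where
  "smooth_manifold S A \<longleftrightarrow>
     \<Union> (cdom ` A) = S \<and>
     (\<forall>c\<in>A. openin (top_of_set S) (cdom c) \<and> open (cmap c ` cdom c) \<and>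
        homeomorphism (cdom c) (cmap c ` cdom c) (cmap c) (cinv c)) \<and>
     (\<forall>c\<in>A. \<forall>c'\<in>A. smooth_on (cmap c ` (cdom c \<inter> cdom c')) (trans_map c c'))"

definition chart_at :: "('m, 'e) chart set \<Rightarrow> 'm \<Rightarrow> ('m, 'e) chart" where
  "chart_at A p = (SOME c. c \<in> A \<and> p \<in> cdom c)"

section \<open>Tensor fields\<close>

text \<open>A tangent vector at \<open>p\<close> is a family of component vectors, one for each chart around \<open>p\<close>,
  related by the differentials of the transition maps; tensors are families of multilinear forms
  on the component vectors, related in the same way.\<close>
type_synonym ('m, 'e) vec_field = "('m, 'e) chart \<Rightarrow> 'm \<Rightarrow> 'e"
type_synonym ('m, 'e) one_form = "('m, 'e) chart \<Rightarrow> 'm \<Rightarrow> 'e \<Rightarrow> real"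
type_synonym ('m, 'e) two_tensor = "('m, 'e) chart \<Rightarrow> 'm \<Rightarrow> 'e \<Rightarrow> 'e \<Rightarrow> real"

definition smooth_vec_field ::
  "('m, 'e::euclidean_space) chart set \<Rightarrow> 'm set \<Rightarrow> ('m, 'e) vec_field \<Rightarrow> bool" where
  "smooth_vec_field A U X \<longleftrightarrow>
     (\<forall>c\<in>A. smooth_on (cmap c ` (cdom c \<inter> U)) (\<lambda>x. X c (cinv c x))) \<and>
     (\<forall>c\<in>A. \<forall>c'\<in>A. \<forall>p \<in> cdom c \<inter> cdom c' \<inter> U. X c' p = tmap c c' p (X c p))"

definition smooth_sym_tensor ::
  "('m, 'e::euclidean_space) chart set \<Rightarrow> ('m, 'e) two_tensor \<Rightarrow> bool" where
  "smooth_sym_tensor A g \<longleftrightarrow>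
     (\<forall>c\<in>A. \<forall>p\<in>cdom c. bilinear (g c p) \<and> (\<forall>u v. g c p u v = g c p v u)) \<and>
     (\<forall>c\<in>A. \<forall>u v. smooth_on (cmap c ` cdom c) (\<lambda>x. g c (cinv c x) u v)) \<and>
     (\<forall>c\<in>A. \<forall>c'\<in>A. \<forall>p \<in> cdom c \<inter> cdom c'. \<forall>u v.
        g c p u v = g c' p (tmap c c' p u) (tmap c c' p v))"

definition pullback_one ::
  "('m, 'e::euclidean_space) chart set \<Rightarrow> ('m, 'e) one_form \<Rightarrow> ('m, 'f::euclidean_space) one_form" where
  "pullback_one A \<beta> d p u = (let c = chart_at A p in \<beta> c p (tmap d c p u))"

definition pullback_two ::
  "('m, 'e::euclidean_space) chart set \<Rightarrow> ('m, 'e) two_tensor \<Rightarrow> ('m, 'f::euclidean_space) two_tensor" where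
  "pullback_two A h d p u v = (let c = chart_at A p in h c p (tmap d c p u) (tmap d c p v))"

definition exterior_derivative ::
  "('m, 'e::euclidean_space) one_form \<Rightarrow> ('m, 'e) two_tensor" where
  "exterior_derivative \<beta> c p u v =
     frechet_derivative (\<lambda>x. \<beta> c (cinv c x) v) (at (cmap c p)) u
   - frechet_derivative (\<lambda>x. \<beta> c (cinv c x) u) (at (cmap c p)) v"

definition closed_one_form_on ::
  "('m, 'e::euclidean_space) chart set \<Rightarrow> 'm set \<Rightarrow> ('m, 'e) one_form \<Rightarrow> bool" where
  "closed_one_form_on A U \<beta> \<longleftrightarrow>
     (\<forall>c\<in>A. \<forall>p \<in> cdom c \<inter> U. \<forall>u v. exterior_derivative \<beta> c p u v = 0)"

section \<open>Bilinear forms and Lorentzian metrics\<close>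

definition nondegenerate :: "('a::real_vector \<Rightarrow> 'a \<Rightarrow> real) \<Rightarrow> bool" where
  "nondegenerate b \<longleftrightarrow> (\<forall>u. (\<forall>v. b u v = 0) \<longrightarrow> u = 0)"

text \<open>Positive or negative definite on the subspace \<open>W\<close>.\<close>
definition definite_on :: "'a::real_vector set \<Rightarrow> ('a \<Rightarrow> 'a \<Rightarrow> real) \<Rightarrow> bool" where
  "definite_on W b \<longleftrightarrow> (\<forall>v\<in>W - {0}. b v v > 0) \<or> (\<forall>v\<in>W - {0}. b v v < 0)"

definition form_index :: "('a::euclidean_space \<Rightarrow> 'a \<Rightarrow> real) \<Rightarrow> nat" where
  "form_index b = Max {dim W | W. subspace W \<and> (\<forall>v\<in>W - {0}. b v v < 0)}"

text \<open>Signature \<open>(-,+,\<dots>,+)\<close>, in dimension at least two.\<close>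
definition lorentzian_manifold ::
  "'m::{second_countable_topology,t2_space} set \<Rightarrow> ('m, 'e::euclidean_space) chart set
    \<Rightarrow> ('m, 'e) two_tensor \<Rightarrow> bool" where
  "lorentzian_manifold S A g \<longleftrightarrow>
     smooth_manifold S A \<and> DIM('e) \<ge> 2 \<and> smooth_sym_tensor A g \<and>
     (\<forall>c\<in>A. \<forall>p\<in>cdom c. nondegenerate (g c p) \<and> form_index (g c p) = 1)"

section \<open>Levi-Civita connection, geodesics, completeness\<close>

definition metric_deriv ::
  "('m, 'e::euclidean_space) two_tensor \<Rightarrow> ('m, 'e) chart \<Rightarrow> 'm \<Rightarrow> 'e \<Rightarrow> 'e \<Rightarrow> 'e \<Rightarrow> real" where
  "metric_deriv g c p u v w = frechet_derivative (\<lambda>x. g c (cinv c x) v w) (at (cmap c p)) u"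

text \<open>Components in the chart \<open>c\<close> of the Levi-Civita derivative of the constant coordinate field
  \<open>v\<close> in the direction \<open>u\<close>, given by the Koszul formula; for basis vectors these are the
  Christoffel symbols.\<close>
definition christoffel ::
  "('m, 'e::euclidean_space) two_tensor \<Rightarrow> ('m, 'e) chart \<Rightarrow> 'm \<Rightarrow> 'e \<Rightarrow> 'e \<Rightarrow> 'e" where
  "christoffel g c p u v = (THE w. \<forall>z.
     g c p w z = (metric_deriv g c p u v z + metric_deriv g c p v u z - metric_deriv g c p z u v) / 2)"

text \<open>Only meant for open intervals \<open>I\<close>.\<close>
definition geodesic_on ::
  "'m::topological_space set \<Rightarrow> ('m, 'e::euclidean_space) chart set \<Rightarrow> ('m, 'e) two_tensor
    \<Rightarrow> real set \<Rightarrow> (real \<Rightarrow> 'm) \<Rightarrow> bool" where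
  "geodesic_on S A g I \<gamma> \<longleftrightarrow>
     continuous_on I \<gamma> \<and> \<gamma> ` I \<subseteq> S \<and>
     (\<forall>t\<in>I. \<forall>c\<in>A. \<gamma> t \<in> cdom c \<longrightarrow>
        (\<exists>v. \<forall>\<^sub>F s in nhds t.
           ((\<lambda>r. cmap c (\<gamma> r)) has_vector_derivative v s) (at s) \<and>
           (v has_vector_derivative - christoffel g c (\<gamma> s) (v s) (v s)) (at s)))"

text \<open>Geodesic completeness, which for Riemannian metrics amounts to completeness of the distance
  by the Hopf-Rinow theorem.\<close>
definition geodesically_complete ::
  "'m::topological_space set \<Rightarrow> ('m, 'e::euclidean_space) chart set \<Rightarrow> ('m, 'e) two_tensor \<Rightarrow> bool" where
  "geodesically_complete S A g \<longleftrightarrow>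
     (\<forall>a b \<gamma>. a < b \<and> geodesic_on S A g {a<..<b} \<gamma> \<longrightarrow>
        (\<exists>\<delta>. geodesic_on S A g UNIV \<delta> \<and> (\<forall>t\<in>{a<..<b}. \<delta> t = \<gamma> t)))"

definition closed_geodesic ::
  "'m::topological_space set \<Rightarrow> ('m, 'e::euclidean_space) chart set \<Rightarrow> ('m, 'e) two_tensor
    \<Rightarrow> (real \<Rightarrow> 'm) \<Rightarrow> bool" where
  "closed_geodesic S A g \<gamma> \<longleftrightarrow>
     geodesic_on S A g UNIV \<gamma> \<and> (\<exists>T>0. \<forall>t. \<gamma> (t + T) = \<gamma> t) \<and> (\<exists>s t. \<gamma> s \<noteq> \<gamma> t)"

section \<open>Null hypersurfaces and normalizations\<close>

text \<open>\<open>M\<close> carries the subspace topology, so a smooth injective differential of the inclusion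
  makes it an embedded submanifold.\<close>
definition hypersurface ::
  "'m::{second_countable_topology,t2_space} set \<Rightarrow> ('m, 'e::euclidean_space) chart set
    \<Rightarrow> 'm set \<Rightarrow> ('m, 'f::euclidean_space) chart set \<Rightarrow> bool" where
  "hypersurface S A M D \<longleftrightarrow>
     M \<subseteq> S \<and> smooth_manifold M D \<and> DIM('e) = DIM('f) + 1 \<and>
     (\<forall>d\<in>D. \<forall>c\<in>A.
        smooth_on (cmap d ` (cdom d \<inter> cdom c)) (trans_map d c) \<and>
        (\<forall>p \<in> cdom d \<inter> cdom c. inj (tmap d c p)))"

definition null_hypersurface ::
  "'m::{second_countable_topology,t2_space} set \<Rightarrow> ('m, 'e::euclidean_space) chart set
    \<Rightarrow> ('m, 'e) two_tensor \<Rightarrow> 'm set \<Rightarrow> ('m, 'f::euclidean_space) chart set \<Rightarrow> bool" where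
  "null_hypersurface S A g M D \<longleftrightarrow>
     hypersurface S A M D \<and>
     (\<forall>d\<in>D. \<forall>p\<in>cdom d. \<not> nondegenerate (pullback_two A g d p))"

definition rigging ::
  "'m::{second_countable_topology,t2_space} set \<Rightarrow> ('m, 'e::euclidean_space) chart set
    \<Rightarrow> 'm set \<Rightarrow> ('m, 'f::euclidean_space) chart set \<Rightarrow> 'm set \<Rightarrow> ('m, 'e) vec_field \<Rightarrow> bool" where
  "rigging S A M D U \<zeta> \<longleftrightarrow>
     openin (top_of_set S) U \<and> M \<subseteq> U \<and> smooth_vec_field A U \<zeta> \<and>
     (\<forall>d\<in>D. \<forall>c\<in>A. \<forall>p \<in> cdom d \<inter> cdom c. \<zeta> c p \<notin> range (tmap d c p))"

definition rigging_form ::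
  "('m, 'e::euclidean_space) two_tensor \<Rightarrow> ('m, 'e) vec_field \<Rightarrow> ('m, 'e) one_form" where
  "rigging_form g \<zeta> c p v = g c p (\<zeta> c p) v"

text \<open>The rigging lives on an open set \<open>U\<close> with \<open>M \<subseteq> U \<subseteq> S\<close>, where \<open>U = S\<close> is allowed. Its form
  \<open>\<alpha>\<close> is closed on \<open>U\<close>, so a global argument such as exactness of \<open>\<alpha>\<close> depends on the
  topology of \<open>U\<close>; simple connectedness of \<open>S\<close> does not pass to \<open>U\<close>.\<close>
definition closed_normalization ::
  "'m::{second_countable_topology,t2_space} set \<Rightarrow> ('m, 'e::euclidean_space) chart set
    \<Rightarrow> ('m, 'e) two_tensor \<Rightarrow> 'm set \<Rightarrow> ('m, 'f::euclidean_space) chart set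
    \<Rightarrow> 'm set \<Rightarrow> ('m, 'e) vec_field \<Rightarrow> bool" where
  "closed_normalization S A g M D U \<zeta> \<longleftrightarrow>
     rigging S A M D U \<zeta> \<and> closed_one_form_on A U (rigging_form g \<zeta>)"

definition rigged_form ::
  "('m, 'e::euclidean_space) chart set \<Rightarrow> ('m, 'e) two_tensor \<Rightarrow> ('m, 'e) vec_field
    \<Rightarrow> ('m, 'f::euclidean_space) one_form" where
  "rigged_form A g \<zeta> = pullback_one A (rigging_form g \<zeta>)"

definition rigged_metric ::
  "('m, 'e::euclidean_space) chart set \<Rightarrow> ('m, 'e) two_tensor \<Rightarrow> ('m, 'e) vec_field
    \<Rightarrow> ('m, 'f::euclidean_space) two_tensor" where
  "rigged_metric A g \<zeta> =
     pullback_two A (\<lambda>c p u v. g c p u v + rigging_form g \<zeta> c p u * rigging_form g \<zeta> c p v)"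

definition rigged_field ::
  "('m, 'e::euclidean_space) chart set \<Rightarrow> ('m, 'e) two_tensor \<Rightarrow> ('m, 'e) vec_field
    \<Rightarrow> ('m, 'f::euclidean_space) vec_field" where
  "rigged_field A g \<zeta> d p = (THE x. \<forall>u. rigged_metric A g \<zeta> d p x u = rigged_form A g \<zeta> d p u)"

definition screen ::
  "('m, 'e::euclidean_space) chart set \<Rightarrow> ('m, 'e) two_tensor \<Rightarrow> ('m, 'e) vec_field
    \<Rightarrow> ('m, 'f::euclidean_space) chart \<Rightarrow> 'm \<Rightarrow> 'f set" where
  "screen A g \<zeta> d p = {u. rigged_form A g \<zeta> d p u = 0}"

text \<open>Components in the chart \<open>c\<close> of the ambient Levi-Civita derivative, in the direction \<open>u\<close>
  tangent to the submanifold, of a vector field \<open>Y\<close> along the submanifold (again given by its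
  components in \<open>c\<close>).\<close>
definition ambient_deriv ::
  "('m, 'e::euclidean_space) two_tensor \<Rightarrow> ('m, 'f::euclidean_space) chart \<Rightarrow> ('m, 'e) chart
    \<Rightarrow> 'm \<Rightarrow> 'f \<Rightarrow> ('m \<Rightarrow> 'e) \<Rightarrow> 'e" where
  "ambient_deriv g d c p u Y =
     frechet_derivative (\<lambda>x. Y (cinv d x)) (at (cmap d p)) u + christoffel g c p (tmap d c p u) (Y p)"

text \<open>The tangent vector \<open>v\<close> is extended to the tangent field with constant components in \<open>d\<close>;
  the value does not depend on the extension.\<close>
definition null_second_form ::
  "('m, 'e::euclidean_space) chart set \<Rightarrow> ('m, 'e) two_tensor \<Rightarrow> ('m, 'e) vec_field
    \<Rightarrow> ('m, 'f::euclidean_space) two_tensor" where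
  "null_second_form A g \<zeta> d p u v =
     (let c = chart_at A p in
        g c p (ambient_deriv g d c p u (\<lambda>q. tmap d c q v)) (tmap d c p (rigged_field A g \<zeta> d p)))"

end

theory Submission
  imports Defs
begin

text \<open>
  Write \<open>h\<close> for the degenerate metric that the ambient metric induces on the hypersurface, \<open>\<omega>\<close> for the
  rigged form, \<open>\<xi>\<close> for the rigged field and \<open>B\<close> for the null second fundamental form, so that the
  rigged metric is \<open>h + \<omega> \<otimes> \<omega>\<close>. For a geodesic \<open>\<gamma>\<close> of the rigged metric put \<open>f = \<omega>(\<gamma>')\<close>.

  The form \<open>\<omega>\<close> is closed, so the Christoffel symbols of first kind of the rigged metric are
  those of \<open>h\<close> plus \<open>(D\<^sub>u \<omega>)(v) \<omega>(z)\<close> (lemma \<open>koszul_gt\<close>). Evaluating them at \<open>z = \<xi>\<close>, where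
  \<open>h(\<xi>, \<cdot>) = 0\<close> and \<open>\<omega>(\<xi>) = 1\<close>, gives \<open>f' = - B(\<gamma>', \<gamma>')\<close> (lemma \<open>rigged_component_derivative\<close>),
  because \<open>B(u, v)\<close> is the first kind Christoffel symbol of \<open>h\<close> at \<open>(u, v, \<xi>)\<close> (lemma
  \<open>B_eq_koszul\<close>). No derivative of \<open>\<xi>\<close> enters.

  Since the ambient metric has index one, \<open>h\<close> is positive semidefinite, so \<open>h(\<xi>\<^sub>p, \<xi>\<^sub>p)\<close>,
  with \<open>\<xi>\<^sub>p\<close> extended by constant components, has a minimum at \<open>p\<close>. This yields \<open>B(\<cdot>, \<xi>) = 0\<close>
  (lemma \<open>B_\<xi>\<close>), and definiteness on the screen makes \<open>B\<close> semidefinite with kernel spanned by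
  \<open>\<xi>\<close>. The sign of \<open>B\<close> is constant along \<open>\<gamma>\<close> by continuity (lemma \<open>sign_along_curve\<close>).
  Hence \<open>f\<close> is monotone. If \<open>\<gamma>\<close> is closed, \<open>f\<close> is periodic, therefore constant, and \<open>B(\<gamma>', \<gamma>') = 0\<close>, so that \<open>\<gamma>' = f \<xi>\<close>.

  The rigging form is closed on a simply connected set, so it has a primitive along the loop \<open>\<gamma>\<close>
  that takes the same value at both ends (lemma \<open>loop_primitive_of_potentials\<close>). The derivative
  of this primitive along \<open>\<gamma>\<close> is \<open>f\<close>, and Rolle's theorem gives a zero of \<open>f\<close>.
  Thus \<open>f = 0\<close>, \<open>\<gamma>' = 0\<close>, and \<open>\<gamma>\<close> is constant.
\<close>

section \<open>Differentiating fields of linear maps\<close>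

text \<open>Product rule for a field of linear maps of which only the values on fixed vectors are known to
  be differentiable. In finite dimension this suffices, by expansion in a basis.\<close>
lemma has_derivative_linear_field:
  fixes L :: "'a::real_normed_vector \<Rightarrow> 'b::euclidean_space \<Rightarrow> 'c::real_normed_vector"
  assumes "open S" "x0 \<in> S" and lin: "\<And>x. x \<in> S \<Longrightarrow> linear (L x)"
    and L': "\<And>b. ((\<lambda>x. L x b) has_derivative L' b) (at x0)"
    and X': "(X has_derivative X') (at x0)"
  shows "((\<lambda>x. L x (X x)) has_derivative (\<lambda>a. L' (X x0) a + L x0 (X' a))) (at x0)"
proof -
  have expand: "L x b = (\<Sum>i\<in>Basis. (b \<bullet> i) *\<^sub>R L x i)" if "x \<in> S" for x b
  proof -
    have "L x b = L x (\<Sum>i\<in>Basis. (b \<bullet> i) *\<^sub>R i)" by (simp add: euclidean_representation)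
    also have "\<dots> = (\<Sum>i\<in>Basis. (b \<bullet> i) *\<^sub>R L x i)"
      using lin[OF that] by (simp add: linear_sum linear_cmul)
    finally show ?thesis .
  qed
  have L'expand: "L' b = (\<lambda>a. \<Sum>i\<in>Basis. (b \<bullet> i) *\<^sub>R L' i a)" for b
  proof -
    have "((\<lambda>x. \<Sum>i\<in>Basis. (b \<bullet> i) *\<^sub>R L x i) has_derivative
            (\<lambda>a. \<Sum>i\<in>Basis. (b \<bullet> i) *\<^sub>R L' i a)) (at x0)"
      by (intro derivative_intros L')
    then have "((\<lambda>x. L x b) has_derivative (\<lambda>a. \<Sum>i\<in>Basis. (b \<bullet> i) *\<^sub>R L' i a)) (at x0)"
      by (rule has_derivative_transform_within_open[OF _ assms(1,2)]) (rule expand[symmetric])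
    then show ?thesis using L'[of b] has_derivative_unique by blast
  qed
  have "((\<lambda>x. \<Sum>i\<in>Basis. (X x \<bullet> i) *\<^sub>R L x i) has_derivative
          (\<lambda>a. \<Sum>i\<in>Basis. (X x0 \<bullet> i) *\<^sub>R L' i a + (X' a \<bullet> i) *\<^sub>R L x0 i)) (at x0)"
    by (intro derivative_intros L' X')
  then have "((\<lambda>x. L x (X x)) has_derivative
          (\<lambda>a. \<Sum>i\<in>Basis. (X x0 \<bullet> i) *\<^sub>R L' i a + (X' a \<bullet> i) *\<^sub>R L x0 i)) (at x0)"
    by (rule has_derivative_transform_within_open[OF _ assms(1,2)]) (rule expand[symmetric])
  moreover have "(\<Sum>i\<in>Basis. (X x0 \<bullet> i) *\<^sub>R L' i a + (X' a \<bullet> i) *\<^sub>R L x0 i) = L' (X x0) a + L x0 (X' a)" for a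
    using expand[OF assms(2), of "X' a"] fun_cong[OF L'expand[of "X x0"], of a] by (simp add: sum.distrib)
  ultimately show ?thesis by simp
qed

lemma linear_of_derivatives:
  fixes L :: "'a::real_normed_vector \<Rightarrow> 'b::real_normed_vector \<Rightarrow> 'c::real_normed_vector"
  assumes "open S" "x0 \<in> S" and lin: "\<And>x. x \<in> S \<Longrightarrow> linear (L x)"
    and L': "\<And>b. ((\<lambda>x. L x b) has_derivative L' b) (at x0)"
  shows "linear (\<lambda>b. L' b a)"
proof (rule linearI)
  fix b c :: 'b and r :: real
  have "((\<lambda>x. L x b + L x c) has_derivative (\<lambda>a. L' b a + L' c a)) (at x0)"
    by (intro derivative_intros L')
  then have "((\<lambda>x. L x (b + c)) has_derivative (\<lambda>a. L' b a + L' c a)) (at x0)"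
    by (rule has_derivative_transform_within_open[OF _ assms(1,2)]) (simp add: linear_add[OF lin])
  then show "L' (b + c) a = L' b a + L' c a"
    using has_derivative_unique[OF L'] by metis
  have "((\<lambda>x. r *\<^sub>R L x b) has_derivative (\<lambda>a. r *\<^sub>R L' b a)) (at x0)"
    by (intro derivative_intros L')
  then have "((\<lambda>x. L x (r *\<^sub>R b)) has_derivative (\<lambda>a. r *\<^sub>R L' b a)) (at x0)"
    by (rule has_derivative_transform_within_open[OF _ assms(1,2)]) (simp add: linear_cmul[OF lin])
  then show "L' (r *\<^sub>R b) a = r *\<^sub>R L' b a"
    using has_derivative_unique[OF L'] by metis
qed

lemma tendsto_linear_field:
  fixes L :: "'a \<Rightarrow> 'b::euclidean_space \<Rightarrow> 'c::real_normed_vector"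
  assumes lin: "\<forall>\<^sub>F x in G. linear (L x)" and "linear L0"
    and L: "\<And>b. ((\<lambda>x. L x b) \<longlongrightarrow> L0 b) G" and X: "(X \<longlongrightarrow> X0) G"
  shows "((\<lambda>x. L x (X x)) \<longlongrightarrow> L0 X0) G"
proof -
  have expand: "l b = (\<Sum>i\<in>Basis. (b \<bullet> i) *\<^sub>R l i)" if "linear l" for l :: "'b \<Rightarrow> 'c" and b
  proof -
    have "l b = l (\<Sum>i\<in>Basis. (b \<bullet> i) *\<^sub>R i)" by (simp add: euclidean_representation)
    also have "\<dots> = (\<Sum>i\<in>Basis. (b \<bullet> i) *\<^sub>R l i)"
      by (simp only: linear_sum[OF that] linear_cmul[OF that])
    finally show ?thesis .
  qed
  have eq: "\<forall>\<^sub>F x in G. (\<Sum>i\<in>Basis. (X x \<bullet> i) *\<^sub>R L x i) = L x (X x)"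
    using lin by (rule eventually_mono) (rule expand[symmetric])
  have "((\<lambda>x. \<Sum>i\<in>Basis. (X x \<bullet> i) *\<^sub>R L x i) \<longlongrightarrow> (\<Sum>i\<in>Basis. (X0 \<bullet> i) *\<^sub>R L0 i)) G"
    by (intro tendsto_intros L X)
  then have "((\<lambda>x. L x (X x)) \<longlongrightarrow> (\<Sum>i\<in>Basis. (X0 \<bullet> i) *\<^sub>R L0 i)) G"
    using eq by (rule Lim_transform_eventually)
  then show ?thesis by (simp only: expand[OF assms(2), symmetric])
qed

lemma continuous_on_linear_field:
  fixes L :: "'a::topological_space \<Rightarrow> 'b::euclidean_space \<Rightarrow> 'c::real_normed_vector"
  assumes "\<And>x. x \<in> S \<Longrightarrow> linear (L x)" "\<And>b. continuous_on S (\<lambda>x. L x b)" "continuous_on S X"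
  shows "continuous_on S (\<lambda>x. L x (X x))"
  unfolding continuous_on_def
proof
  fix x assume x: "x \<in> S"
  show "((\<lambda>x. L x (X x)) \<longlongrightarrow> L x (X x)) (at x within S)"
  proof (rule tendsto_linear_field)
    show "\<forall>\<^sub>F y in at x within S. linear (L y)"
      using assms(1) by (simp add: eventually_at_filter)
    show "linear (L x)" by (rule assms(1)[OF x])
    show "((\<lambda>x. L x b) \<longlongrightarrow> L x b) (at x within S)" for b
      using assms(2) x by (simp add: continuous_on_def)
    show "(X \<longlongrightarrow> X x) (at x within S)"
      using assms(3) x by (simp add: continuous_on_def)
  qed
qed

section \<open>Symmetry of second derivatives\<close>

lemma has_real_derivative_along_line:
  fixes f :: "'a::real_normed_vector \<Rightarrow> real"
  assumes "(f has_derivative f') (at (p + t *\<^sub>R u))"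
  shows "((\<lambda>t. f (p + t *\<^sub>R u)) has_real_derivative f' u) (at t)"
proof -
  have "((\<lambda>t. p + t *\<^sub>R u) has_derivative (\<lambda>h. h *\<^sub>R u)) (at t)"
    by (auto intro!: derivative_eq_intros)
  then have "((\<lambda>t. f (p + t *\<^sub>R u)) has_derivative (\<lambda>h. f' (h *\<^sub>R u))) (at t)"
    using assms by (rule has_derivative_compose)
  moreover have "(\<lambda>h. f' (h *\<^sub>R u)) = (*) (f' u)"
    using has_derivative_linear[OF assms] by (simp add: linear_cmul fun_eq_iff)
  ultimately show ?thesis by (simp only: has_field_derivative_def)
qed

text \<open>Applying this with \<open>u\<close> and \<open>v\<close> exchanged expresses one and the same second difference by
  both mixed second derivatives.\<close>
lemma second_difference_mean_value:
  fixes f :: "'a::real_normed_vector \<Rightarrow> real"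
  assumes f': "\<And>y. y \<in> S \<Longrightarrow> (f has_derivative f' y) (at y)"
    and f'': "\<And>y. y \<in> S \<Longrightarrow> ((\<lambda>y. f' y u) has_derivative f'' y) (at y)"
    and s: "s > 0" and S: "\<And>a b. a \<in> {0..s} \<Longrightarrow> b \<in> {0..s} \<Longrightarrow> x + a *\<^sub>R u + b *\<^sub>R v \<in> S"
  obtains a b where "a \<in> {0..s}" "b \<in> {0..s}"
    "f (x + s *\<^sub>R u + s *\<^sub>R v) - f (x + s *\<^sub>R u) - f (x + s *\<^sub>R v) + f x
      = s\<^sup>2 * f'' (x + a *\<^sub>R u + b *\<^sub>R v) v"
proof -
  define k where "k t = f (x + s *\<^sub>R v + t *\<^sub>R u) - f (x + t *\<^sub>R u)" for t
  define k' where "k' t = f' (x + s *\<^sub>R v + t *\<^sub>R u) u - f' (x + t *\<^sub>R u) u" for t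
  have S0: "x + t *\<^sub>R u \<in> S" if "t \<in> {0..s}" for t using S[OF that, of 0] s by simp
  have S1: "x + s *\<^sub>R v + t *\<^sub>R u \<in> S" if "t \<in> {0..s}" for t
    using S[OF that, of s] s by (simp add: ac_simps)
  have k': "(k has_real_derivative k' t) (at t)" if t: "t \<in> {0..s}" for t
    unfolding k_def k'_def
    by (intro DERIV_diff has_real_derivative_along_line f' S0 S1 t)
  obtain a where a: "0 < a" "a < s" "k s - k 0 = (s - 0) * k' a"
    using MVT2[OF s, of k k'] k' by auto
  define m where "m t = f' (x + a *\<^sub>R u + t *\<^sub>R v) u" for t
  have m': "(m has_real_derivative f'' (x + a *\<^sub>R u + t *\<^sub>R v) v) (at t)" if t: "t \<in> {0..s}" for t
    unfolding m_def
    by (intro has_real_derivative_along_line f'' S) (use t a in auto)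
  obtain b where b: "0 < b" "b < s" "m s - m 0 = (s - 0) * f'' (x + a *\<^sub>R u + b *\<^sub>R v) v"
    using MVT2[OF s, of m "\<lambda>t. f'' (x + a *\<^sub>R u + t *\<^sub>R v) v"] m' by auto
  have "f (x + s *\<^sub>R u + s *\<^sub>R v) = f (x + s *\<^sub>R v + s *\<^sub>R u)"
    by (rule arg_cong[of _ _ f]) simp
  then have "f (x + s *\<^sub>R u + s *\<^sub>R v) - f (x + s *\<^sub>R u) - f (x + s *\<^sub>R v) + f x = k s - k 0"
    by (simp add: k_def)
  also have "\<dots> = s * k' a" using a(3) by simp
  also have "k' a = m s - m 0" unfolding k'_def m_def by (simp add: ac_simps)
  also have "s * \<dots> = s\<^sup>2 * f'' (x + a *\<^sub>R u + b *\<^sub>R v) v"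
    using b(3) by (simp add: power2_eq_square)
  finally show ?thesis using a b by (intro that[of a b]) auto
qed

lemma second_derivative_symmetric_real:
  fixes f :: "'a::real_normed_vector \<Rightarrow> real"
  assumes "open S" "x \<in> S"
    and f': "\<And>y. y \<in> S \<Longrightarrow> (f has_derivative f' y) (at y)"
    and f'': "\<And>y w. y \<in> S \<Longrightarrow> ((\<lambda>y. f' y w) has_derivative f'' y w) (at y)"
    and cont: "\<And>w z. continuous_on S (\<lambda>y. f'' y w z)"
  shows "f'' x u v = f'' x v u"
proof -
  obtain r where r: "r > 0" "ball x r \<subseteq> S" using assms(1,2) openE by blast
  define K where "K = norm u + norm v + 1"
  have K: "K > 0" by (simp add: K_def add_nonneg_pos)
  have bd: "norm (a *\<^sub>R u + b *\<^sub>R v) < s * K" if "a \<in> {0..s}" "b \<in> {0..s}" "s > 0" for a b s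
  proof -
    have "norm (a *\<^sub>R u + b *\<^sub>R v) \<le> a * norm u + b * norm v"
      using norm_triangle_ineq[of "a *\<^sub>R u" "b *\<^sub>R v"] that by auto
    also have "\<dots> \<le> s * norm u + s * norm v"
      using that by (intro add_mono mult_right_mono) auto
    also have "\<dots> < s * K" using that by (simp add: K_def algebra_simps)
    finally show ?thesis .
  qed
  have inb: "x + a *\<^sub>R u + b *\<^sub>R v \<in> ball x e" if "a \<in> {0..s}" "b \<in> {0..s}" "s > 0" "s * K \<le> e" for a b s e
  proof -
    have "dist x (x + (a *\<^sub>R u + b *\<^sub>R v)) = norm (a *\<^sub>R u + b *\<^sub>R v)"
      by (metis add_diff_cancel_left' dist_commute dist_norm)
    then show ?thesis using bd[OF that(1-3)] that(4) by (simp add: add.assoc)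
  qed
  have inb': "x + b *\<^sub>R v + a *\<^sub>R u \<in> ball x e" if "a \<in> {0..s}" "b \<in> {0..s}" "s > 0" "s * K \<le> e" for a b s e
    using inb[OF that] by (simp only: add.assoc add.commute[of "b *\<^sub>R v"])
  have near: "\<exists>y z. y \<in> ball x e \<and> z \<in> ball x e \<and> f'' y u v = f'' z v u" if e: "e > 0" "e \<le> r" for e
  proof -
    define s where "s = e / K"
    have s: "s > 0" "s * K \<le> e" using K e by (auto simp: s_def)
    have 1: "x + a *\<^sub>R u + b *\<^sub>R v \<in> S" if "a \<in> {0..s}" "b \<in> {0..s}" for a b
      using inb[OF that s] r e by auto
    have 2: "x + a *\<^sub>R v + b *\<^sub>R u \<in> S" if "a \<in> {0..s}" "b \<in> {0..s}" for a b
      using inb'[OF that(2,1) s] r e by auto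
    obtain a b where ab: "a \<in> {0..s}" "b \<in> {0..s}"
      "f (x + s *\<^sub>R u + s *\<^sub>R v) - f (x + s *\<^sub>R u) - f (x + s *\<^sub>R v) + f x
       = s\<^sup>2 * f'' (x + a *\<^sub>R u + b *\<^sub>R v) u v"
      using second_difference_mean_value[where f=f and f'=f' and S=S and s=s and u=u and v=v and x=x
          and f''="\<lambda>y. f'' y u", OF f' f'' s(1) 1] by blast
    obtain c d where cd: "c \<in> {0..s}" "d \<in> {0..s}"
      "f (x + s *\<^sub>R v + s *\<^sub>R u) - f (x + s *\<^sub>R v) - f (x + s *\<^sub>R u) + f x
       = s\<^sup>2 * f'' (x + c *\<^sub>R v + d *\<^sub>R u) v u"
      using second_difference_mean_value[where f=f and f'=f' and S=S and s=s and u=v and v=u and x=x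
          and f''="\<lambda>y. f'' y v", OF f' f'' s(1) 2] by blast
    have "s\<^sup>2 * f'' (x + a *\<^sub>R u + b *\<^sub>R v) u v = s\<^sup>2 * f'' (x + c *\<^sub>R v + d *\<^sub>R u) v u"
    proof -
      have "f (x + s *\<^sub>R u + s *\<^sub>R v) = f (x + s *\<^sub>R v + s *\<^sub>R u)"
        by (rule arg_cong[of _ _ f]) simp
      then show ?thesis using ab(3) cd(3) by linarith
    qed
    then have "f'' (x + a *\<^sub>R u + b *\<^sub>R v) u v = f'' (x + c *\<^sub>R v + d *\<^sub>R u) v u" using s by simp
    then show ?thesis using inb[OF ab(1,2) s] inb'[OF cd(2,1) s] by blast
  qed
  have ex: "\<exists>y z. y \<in> ball x (min r (inverse (Suc n))) \<and> z \<in> ball x (min r (inverse (Suc n))) \<and> f'' y u v = f'' z v u" for n :: nat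
    by (rule near) (use r in simp_all)
  obtain Y Z where YZ: "\<And>n. Y n \<in> ball x (min r (inverse (Suc n)))" "\<And>n. Z n \<in> ball x (min r (inverse (Suc n)))"
    "\<And>n. f'' (Y n) u v = f'' (Z n) v u" using ex by metis
  have lim: "W \<longlonglongrightarrow> x" if "\<And>n. W n \<in> ball x (min r (inverse (Suc n)))" for W
  proof (rule metric_tendsto_imp_tendsto[OF LIMSEQ_inverse_real_of_nat])
    show "\<forall>\<^sub>F n in sequentially. dist (W n) x \<le> dist (inverse (real (Suc n))) 0"
      using that by (intro always_eventually allI) (simp add: dist_commute less_imp_le)
  qed
  have isc: "isCont (\<lambda>y. f'' y w z) x" for w z
    using cont[of w z] assms(1,2) continuous_on_eq_continuous_at by blast
  have "(\<lambda>n. f'' (Y n) u v) \<longlonglongrightarrow> f'' x u v" "(\<lambda>n. f'' (Z n) v u) \<longlonglongrightarrow> f'' x v u"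
    using isCont_tendsto_compose[OF isc lim[OF YZ(1)]] isCont_tendsto_compose[OF isc lim[OF YZ(2)]] by auto
  then show ?thesis using YZ(3) LIMSEQ_unique by auto
qed

lemma smooth_on_has_derivative:
  assumes "smooth_on S f" "x \<in> S"
  shows "(f has_derivative frechet_derivative f (at x)) (at x)"
proof -
  have "Ck_on (Suc 0) S f" using assms(1) by (simp only: smooth_on_def)
  then show ?thesis using assms(2) by (simp add: frechet_derivative_works)
qed

lemma smooth_on_frechet_derivative:
  assumes "smooth_on S f"
  shows "smooth_on S (\<lambda>x. frechet_derivative f (at x) v)"
  unfolding smooth_on_def
proof
  fix k
  have "Ck_on (Suc k) S f" using assms by (simp only: smooth_on_def)
  then show "Ck_on k S (\<lambda>x. frechet_derivative f (at x) v)" by simp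
qed

lemma smooth_on_imp_continuous_on: "smooth_on S f \<Longrightarrow> continuous_on S f"
  unfolding smooth_on_def by (drule spec[of _ 0]) simp

lemma second_derivative_symmetric:
  fixes f :: "'a::real_normed_vector \<Rightarrow> 'b::euclidean_space"
  assumes "open S" "x \<in> S" "smooth_on S f"
  shows "frechet_derivative (\<lambda>y. frechet_derivative f (at y) u) (at x) v
       = frechet_derivative (\<lambda>y. frechet_derivative f (at y) v) (at x) u"
proof (rule euclidean_eqI)
  fix i :: 'b assume "i \<in> Basis"
  define f' where "f' y w = frechet_derivative f (at y) w \<bullet> i" for y w
  define f'' where "f'' y w z = frechet_derivative (\<lambda>y. frechet_derivative f (at y) w) (at y) z \<bullet> i" for y w z
  have "f'' x u v = f'' x v u"
  proof (rule second_derivative_symmetric_real[OF assms(1,2)])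
    show "((\<lambda>y. f y \<bullet> i) has_derivative f' y) (at y)" if "y \<in> S" for y
      unfolding f'_def by (intro derivative_intros smooth_on_has_derivative[OF assms(3) that])
    show "((\<lambda>y. f' y w) has_derivative f'' y w) (at y)" if "y \<in> S" for y w
      unfolding f'_def f''_def
      by (intro derivative_intros smooth_on_has_derivative[OF smooth_on_frechet_derivative[OF assms(3)] that])
    show "continuous_on S (\<lambda>y. f'' y w z)" for w z
      unfolding f''_def
      by (intro continuous_intros smooth_on_imp_continuous_on smooth_on_frechet_derivative assms(3))
  qed
  then show "frechet_derivative (\<lambda>y. frechet_derivative f (at y) u) (at x) v \<bullet> i
       = frechet_derivative (\<lambda>y. frechet_derivative f (at y) v) (at x) u \<bullet> i"
    by (simp add: f''_def)
qed

section \<open>The Poincare lemma for one-forms\<close>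

text \<open>The primitive is \<open>F x = \<integral>\<^sub>0\<^sup>1 \<beta>(x\<^sub>0 + t (x - x\<^sub>0)) (x - x\<^sub>0) dt\<close>. By the
  symmetry of \<open>\<beta>'\<close>, the derivative of the integrand in direction \<open>u\<close> is the derivative with respect
  to \<open>t\<close> of \<open>t \<beta>(x\<^sub>0 + t (x - x\<^sub>0)) u\<close>.\<close>
lemma poincare_one_form:
  fixes \<beta> :: "'a::euclidean_space \<Rightarrow> 'a \<Rightarrow> real"
  assumes S: "open S" "convex S"
    and lin: "\<And>x. x \<in> S \<Longrightarrow> linear (\<beta> x)"
    and D: "\<And>x v. x \<in> S \<Longrightarrow> ((\<lambda>y. \<beta> y v) has_derivative \<beta>' x v) (at x)"
    and cont: "\<And>u v. continuous_on S (\<lambda>x. \<beta>' x v u)"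
    and sym: "\<And>x u v. x \<in> S \<Longrightarrow> \<beta>' x v u = \<beta>' x u v"
  shows "\<exists>F. \<forall>x\<in>S. (F has_derivative \<beta> x) (at x)"
proof (cases "S = {}")
  case False
  then obtain x0 where x0: "x0 \<in> S" by blast
  define p where "p x t = x0 + t *\<^sub>R (x - x0)" for x t
  have pS: "p x t \<in> S" if "x \<in> S" "t \<in> {0..1}" for x t
  proof -
    have "p x t = (1 - t) *\<^sub>R x0 + t *\<^sub>R x" by (simp add: p_def algebra_simps)
    then show ?thesis using convexD_alt[OF S(2) x0 that(1)] that(2) by auto
  qed
  have lin': "linear (\<lambda>b. \<beta>' x b a)" if "x \<in> S" for x a
    by (rule linear_of_derivatives[OF S(1) that lin D[OF that]])
  have lin'': "linear (\<beta>' x b)" if "x \<in> S" for x b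
    using D[OF that] by (rule has_derivative_linear)
  have cont_\<beta>: "continuous_on S (\<lambda>x. \<beta> x v)" for v
    using D by (meson continuous_on_eq_continuous_within has_derivative_at_withinI has_derivative_continuous)
  define d where "d x t u = t * \<beta>' (p x t) (x - x0) u + \<beta> (p x t) u" for x t u
  define fx where "fx x t = Blinfun (d x t)" for x t
  have der: "((\<lambda>x. \<beta> (p x t) (x - x0)) has_derivative d x t) (at x)" if x: "x \<in> S" and t: "t \<in> {0..1}" for x t
  proof -
    have "((\<lambda>x. \<beta> (p x t) (x - x0)) has_derivative (\<lambda>a. t *\<^sub>R \<beta>' (p x t) (x - x0) a + \<beta> (p x t) a)) (at x)"
    proof (rule has_derivative_linear_field[OF S(1) x, where L="\<lambda>x. \<beta> (p x t)" and X="\<lambda>x. x - x0"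
           and X'="\<lambda>a. a" and L'="\<lambda>b a. t *\<^sub>R \<beta>' (p x t) b a"])
      show "linear (\<beta> (p y t))" if "y \<in> S" for y by (intro lin pS that t)
      show "((\<lambda>x. x - x0) has_derivative (\<lambda>a. a)) (at x)" by (auto intro!: derivative_eq_intros)
      show "((\<lambda>y. \<beta> (p y t) b) has_derivative (\<lambda>a. t *\<^sub>R \<beta>' (p x t) b a)) (at x)" for b
      proof -
        have "((\<lambda>y. p y t) has_derivative (\<lambda>a. t *\<^sub>R a)) (at x)"
          unfolding p_def by (auto intro!: derivative_eq_intros)
        then have "((\<lambda>y. \<beta> (p y t) b) has_derivative (\<lambda>a. \<beta>' (p x t) b (t *\<^sub>R a))) (at x)"
          using D[OF pS[OF x t]] by (rule has_derivative_compose)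
        then show ?thesis by (simp only: linear_cmul[OF lin''[OF pS[OF x t]]])
      qed
    qed
    then show ?thesis unfolding d_def by simp
  qed
  have fx: "blinfun_apply (fx x t) = d x t" if "x \<in> S" "t \<in> {0..1}" for x t
    unfolding fx_def using der[OF that] has_derivative_bounded_linear
    by (intro bounded_linear_Blinfun_apply) blast
  have cont_p: "continuous_on (S \<times> {0..1}) (\<lambda>z. p (fst z) (snd z))"
    unfolding p_def by (intro continuous_intros)
  have pS': "(\<lambda>z. p (fst z) (snd z)) ` (S \<times> {0..1}) \<subseteq> S" using pS by auto
  have cont_d: "continuous_on (S \<times> {0..1}) (\<lambda>z. d (fst z) (snd z) u)" for u
  proof -
    have "continuous_on (S \<times> {0..1}) (\<lambda>z. \<beta>' (p (fst z) (snd z)) (fst z - x0) u)"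
    proof (rule continuous_on_linear_field[where L="\<lambda>z b. \<beta>' (p (fst z) (snd z)) b u"])
      show "linear (\<lambda>b. \<beta>' (p (fst z) (snd z)) b u)" if "z \<in> S \<times> {0..1}" for z
        using that by (intro lin' pS) auto
      show "continuous_on (S \<times> {0..1}) (\<lambda>z. \<beta>' (p (fst z) (snd z)) b u)" for b
        using continuous_on_compose2[OF cont cont_p pS'] .
      show "continuous_on (S \<times> {0..1}) (\<lambda>z. fst z - x0)"
        by (intro continuous_intros)
    qed
    moreover have "continuous_on (S \<times> {0..1}) (\<lambda>z. \<beta> (p (fst z) (snd z)) u)"
      using continuous_on_compose2[OF cont_\<beta> cont_p pS'] .
    ultimately show ?thesis unfolding d_def by (intro continuous_intros)
  qed
  define F where "F x = integral (cbox 0 1) (\<lambda>t. \<beta> (p x t) (x - x0))" for x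
  have "(F has_derivative \<beta> x) (at x)" if x: "x \<in> S" for x
  proof -
    have cfx: "continuous_on (S \<times> {0..1}) (\<lambda>(x, t). fx x t)"
    proof (rule continuous_on_blinfun_componentwise)
      fix i :: 'a
      show "continuous_on (S \<times> {0..1}) (\<lambda>z. blinfun_apply (case z of (x, t) \<Rightarrow> fx x t) i)"
        by (rule continuous_on_eq[OF cont_d[of i]]) (auto simp: fx)
    qed
    have "(F has_derivative integral (cbox 0 1) (fx x)) (at x within S)"
      unfolding F_def
    proof (rule leibniz_rule[OF _ _ _ x S(2)])
      show "((\<lambda>x. \<beta> (p x t) (x - x0)) has_derivative blinfun_apply (fx y t)) (at y within S)"
        if "y \<in> S" "t \<in> cbox 0 1" for y t
        using der[of y t] that by (simp add: fx has_derivative_at_withinI)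
      show "(\<lambda>t. \<beta> (p y t) (y - x0)) integrable_on cbox 0 1" if y: "y \<in> S" for y
      proof (rule integrable_continuous, rule continuous_on_compose2[OF cont_\<beta>])
        show "continuous_on (cbox 0 1) (p y)" unfolding p_def by (intro continuous_intros)
        show "p y ` cbox 0 1 \<subseteq> S" using pS[OF y] by auto
      qed
      show "continuous_on (S \<times> cbox 0 1) (\<lambda>(x, t). fx x t)" using cfx by simp
    qed
    then have *: "(F has_derivative blinfun_apply (integral (cbox 0 1) (fx x))) (at x)"
      using S(1) x at_within_open by metis
    have "blinfun_apply (integral (cbox 0 1) (fx x)) u = \<beta> x u" for u
    proof -
      have "continuous_on {0..1} (\<lambda>t. case (x, t) of (x, t) \<Rightarrow> fx x t)"
        by (rule continuous_on_compose2[OF cfx]) (use x in \<open>auto intro!: continuous_intros\<close>)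
      then have "(fx x) integrable_on cbox 0 1"
        by (intro integrable_continuous) simp
      then have "(fx x has_integral integral (cbox 0 1) (fx x)) (cbox 0 1)"
        by (rule integrable_integral)
      from has_integral_linear[OF this bounded_bilinear.bounded_linear_left[OF bounded_bilinear_blinfun_apply, of u]]
      have "((\<lambda>t. blinfun_apply (fx x t) u) has_integral blinfun_apply (integral (cbox 0 1) (fx x)) u) (cbox 0 1)"
        by (simp add: o_def)
      then have 1: "((\<lambda>t. d x t u) has_integral blinfun_apply (integral (cbox 0 1) (fx x)) u) {0..1}"
        unfolding cbox_interval by (rule has_integral_eq[rotated]) (simp add: fx x)
      have "((\<lambda>t. d x t u) has_integral (1 * \<beta> (p x 1) u - 0 * \<beta> (p x 0) u)) {0..1}"
      proof (rule fundamental_theorem_of_calculus)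
        fix t :: real assume t: "t \<in> {0..1}"
        have "((\<lambda>t. \<beta> (x0 + t *\<^sub>R (x - x0)) u) has_real_derivative \<beta>' (p x t) u (x - x0)) (at t)"
          by (rule has_real_derivative_along_line) (use D[OF pS[OF x t]] in \<open>simp add: p_def\<close>)
        then have "((\<lambda>t. t * \<beta> (p x t) u) has_real_derivative (1 * \<beta> (p x t) u + \<beta>' (p x t) u (x - x0) * t)) (at t)"
          unfolding p_def by (intro DERIV_mult DERIV_ident)
        moreover have "1 * \<beta> (p x t) u + \<beta>' (p x t) u (x - x0) * t = d x t u"
          using sym[OF pS[OF x t]] by (simp add: d_def)
        ultimately show "((\<lambda>t. t * \<beta> (p x t) u) has_vector_derivative d x t u) (at t within {0..1})"
          by (simp add: has_real_derivative_iff_has_vector_derivative has_vector_derivative_at_within)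
      qed simp
      from has_integral_unique[OF 1 this] show ?thesis by (simp add: p_def)
    qed
    then have "blinfun_apply (integral (cbox 0 1) (fx x)) = \<beta> x" by blast
    then show ?thesis using * by simp
  qed
  then show ?thesis by blast
qed simp

section \<open>Potentials along loops in a simply connected set\<close>

text \<open>A function of pairs of close points that is additive on small triangles is a difference
  \<open>G y - G x\<close>. The value \<open>G x\<close> is the sum of \<open>D\<close> over \<open>N\<close> equal steps of the segment from \<open>0\<close>
  to \<open>x\<close>. The segments to \<open>x\<close> and to \<open>y\<close> bound a strip of \<open>N\<close> small quadrilaterals, and
  additivity makes the contributions of the inner edges cancel.\<close>
lemma local_cocycle_primitive:
  fixes S :: "'a::real_normed_vector set" and D :: "'a \<Rightarrow> 'a \<Rightarrow> real"
  assumes star: "\<And>x r. x \<in> S \<Longrightarrow> r \<in> {0..1} \<Longrightarrow> r *\<^sub>R x \<in> S" and "bounded S" and \<delta>: "\<delta> > 0"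
    and add: "\<And>x y z. \<lbrakk>x \<in> S; y \<in> S; z \<in> S; dist x y < \<delta>; dist y z < \<delta>; dist x z < \<delta>\<rbrakk>
               \<Longrightarrow> D x y + D y z = D x z"
  shows "\<exists>G. \<forall>x\<in>S. \<forall>y\<in>S. dist x y < \<delta> / 2 \<longrightarrow> D x y = G y - G x"
proof -
  obtain B where B: "\<And>x. x \<in> S \<Longrightarrow> norm x \<le> B" "B > 0" using \<open>bounded S\<close> bounded_pos by metis
  obtain N :: nat where N: "2 * B / \<delta> < N" using reals_Archimedean2 by blast
  have N0: "N > 0"
  proof (rule ccontr)
    assume "\<not> N > 0"
    then show False using N B(2) \<delta> by (simp add: field_simps)
  qed
  have BN: "B / N < \<delta> / 2" using N N0 \<delta> by (simp add: field_simps)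
  define q where "q k x = (real k / real N) *\<^sub>R x" for k and x :: 'a
  have qS: "q k x \<in> S" if "x \<in> S" "k \<le> N" for k x
    unfolding q_def by (rule star[OF that(1)]) (use that(2) N0 in auto)
  have step: "dist (q k x) (q (Suc k) x) < \<delta> / 2" if "x \<in> S" for k x
  proof -
    have "q (Suc k) x - q k x = (1 / N) *\<^sub>R x"
      unfolding q_def by (simp add: scaleR_diff_left[symmetric] diff_divide_distrib[symmetric])
    then have "dist (q k x) (q (Suc k) x) = norm x / N"
      by (metis (no_types) dist_commute dist_norm norm_scaleR abs_of_nonneg divide_inverse inverse_eq_divide mult.commute of_nat_0_le_iff zero_le_divide_1_iff)
    also have "\<dots> \<le> B / N" using B(1)[OF that] by (simp add: divide_right_mono)
    finally show ?thesis using BN by linarith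
  qed
  have side: "dist (q k x) (q k y) \<le> dist x y" if "k \<le> N" for k x y
  proof -
    have "dist (q k x) (q k y) = (real k / real N) * dist x y"
      unfolding q_def by (simp add: dist_norm scaleR_diff_right[symmetric])
    also have "\<dots> \<le> 1 * dist x y" by (rule mult_right_mono) (use that N0 in auto)
    finally show ?thesis by simp
  qed
  define G where "G x = (\<Sum>k<N. D (q k x) (q (Suc k) x))" for x
  have "D x y = G y - G x" if x: "x \<in> S" and y: "y \<in> S" and xy: "dist x y < \<delta> / 2" for x y
  proof -
    have sq: "D (q k y) (q (Suc k) y) - D (q k x) (q (Suc k) x)
          = D (q (Suc k) x) (q (Suc k) y) - D (q k x) (q k y)" if k: "k < N" for k
    proof -
      have mem: "q k x \<in> S" "q k y \<in> S" "q (Suc k) x \<in> S" "q (Suc k) y \<in> S"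
        using k by (auto intro!: qS x y)
      have d: "dist (q k x) (q (Suc k) x) < \<delta> / 2" "dist (q k y) (q (Suc k) y) < \<delta> / 2"
        "dist (q k x) (q k y) < \<delta> / 2" "dist (q (Suc k) x) (q (Suc k) y) < \<delta> / 2"
        using step[OF x, of k] step[OF y, of k] side[of k x y] side[of "Suc k" x y] k xy by auto
      have diag: "dist (q k x) (q (Suc k) y) < \<delta>"
        using dist_triangle[of "q k x" "q (Suc k) y" "q k y"] d by linarith
      have "D (q k x) (q (Suc k) x) + D (q (Suc k) x) (q (Suc k) y) = D (q k x) (q (Suc k) y)"
        by (rule add) (use mem d diag \<delta> in auto)
      moreover have "D (q k x) (q k y) + D (q k y) (q (Suc k) y) = D (q k x) (q (Suc k) y)"
        by (rule add) (use mem d diag \<delta> in auto)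
      ultimately show ?thesis by simp
    qed
    have "G y - G x = (\<Sum>k<N. D (q k y) (q (Suc k) y) - D (q k x) (q (Suc k) x))"
      by (simp add: G_def sum_subtractf)
    also have "\<dots> = (\<Sum>k<N. D (q (Suc k) x) (q (Suc k) y) - D (q k x) (q k y))"
      by (rule sum.cong) (auto simp: sq)
    also have "\<dots> = D (q N x) (q N y) - D (q 0 x) (q 0 y)"
      by (rule sum_lessThan_telescope)
    also have "\<dots> = D x y - D 0 0" using N0 by (simp add: q_def)
    finally have "G y - G x = D x y - D 0 0" .
    moreover have "(0::'a) \<in> S" using star[OF x, of 0] by simp
    then have "D 0 0 = 0" using add[of 0 0 0] \<delta> by simp
    ultimately show ?thesis by simp
  qed
  then show ?thesis by blast
qed

lemma locally_constant_imp_eq: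
  fixes f :: "'a::topological_space \<Rightarrow> 'b"
  assumes "connected S" "a \<in> S" "b \<in> S"
    and "\<And>x. x \<in> S \<Longrightarrow> \<exists>T. openin (top_of_set S) T \<and> x \<in> T \<and> (\<forall>y\<in>T. f y = f x)"
  shows "f a = f b"
proof -
  have "f constant_on S"
    using assms(1,4) by (rule locally_constant_imp_constant)
  then show ?thesis using assms(2,3) unfolding constant_on_def by metis
qed

lemma locally_constant_on_real_imp_eq:
  fixes f :: "real \<Rightarrow> 'b"
  assumes "connected S" "a \<in> S" "b \<in> S" "e > 0"
    and "\<And>x y. x \<in> S \<Longrightarrow> y \<in> S \<Longrightarrow> dist x y < e \<Longrightarrow> f y = f x"
  shows "f a = f b"
proof (rule locally_constant_imp_eq[OF assms(1-3)])
  fix x assume x: "x \<in> S"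
  have "openin (top_of_set S) (S \<inter> ball x e)" by (simp add: openin_open_Int)
  moreover have "x \<in> S \<inter> ball x e" using x assms(4) by simp
  moreover have "\<forall>y\<in>S \<inter> ball x e. f y = f x" using assms(5)[OF x] by (simp add: Ball_def)
  ultimately show "\<exists>T. openin (top_of_set S) T \<and> x \<in> T \<and> (\<forall>y\<in>T. f y = f x)" by blast
qed

text \<open>Let \<open>P\<close> be a family of local potentials whose differences are locally constant. A null homotopy
  of the loop is a map on a square. The increments of the potentials along short segments of the
  square form a cocycle as in the previous lemma, hence there is a primitive on the whole square.
  Its restriction to the edge that carries the loop is the required \<open>G\<close>.\<close>
lemma loop_primitive_of_potentials:
  fixes U :: "'m::topological_space set" and P :: "'m set \<Rightarrow> ('m \<Rightarrow> real) \<Rightarrow> bool"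
    and \<gamma> :: "real \<Rightarrow> 'm"
  assumes U: "simply_connected U"
    and op: "\<And>W F. P W F \<Longrightarrow> openin (top_of_set U) W"
    and cov: "\<And>x. x \<in> U \<Longrightarrow> \<exists>W F. P W F \<and> x \<in> W"
    and diff: "\<And>W F W' F' x. \<lbrakk>P W F; P W' F'; x \<in> W \<inter> W'\<rbrakk> \<Longrightarrow>
        \<exists>N. openin (top_of_set U) N \<and> x \<in> N \<and> N \<subseteq> W \<inter> W' \<and> (\<forall>y\<in>N. F y - F' y = F x - F' x)"
    and \<gamma>: "continuous_on {0..1} \<gamma>" "\<gamma> ` {0..1} \<subseteq> U" "\<gamma> 1 = \<gamma> 0"
  shows "\<exists>G. G 0 = G 1 \<and> (\<forall>t\<in>{0..1}. \<forall>W F. P W F \<and> \<gamma> t \<in> W \<longrightarrow>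
           (\<forall>\<^sub>F s in at t within {0..1}. G s - G t = F (\<gamma> s) - F (\<gamma> t)))"
proof -
  define S where "S = {0..1::real} \<times> {0..1::real}"
  define a where "a = \<gamma> 0"
  have aU: "a \<in> U" using \<gamma>(2) by (simp add: a_def image_subset_iff)
  have "homotopic_loops U \<gamma> (\<lambda>_. a)"
  proof -
    have "path \<gamma> \<and> pathfinish \<gamma> = pathstart \<gamma> \<and> path_image \<gamma> \<subseteq> U"
      using \<gamma> by (simp add: path_def path_image_def pathstart_def pathfinish_def)
    moreover have "path (\<lambda>_. a) \<and> pathfinish (\<lambda>_::real. a) = pathstart (\<lambda>_::real. a) \<and> path_image (\<lambda>_. a) \<subseteq> U"
      using aU by (auto simp: path_def path_image_def pathstart_def pathfinish_def)
    ultimately show ?thesis using U unfolding simply_connected_def by blast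
  qed
  then obtain H where h: "continuous_on S H" "H \<in> S \<rightarrow> U" "\<forall>x\<in>{0..1}. H (0, x) = \<gamma> x"
      "\<forall>x\<in>{0..1}. H (1, x) = a" "\<forall>t\<in>{0..1}. H (t, 1) = H (t, 0)"
    unfolding homotopic_loops S_def by (auto simp: pathstart_def pathfinish_def)
  have H: "continuous_on S H" "H ` S \<subseteq> U" "\<And>x. x \<in> {0..1} \<Longrightarrow> H (0, x) = \<gamma> x"
    "\<And>x. x \<in> {0..1} \<Longrightarrow> H (1, x) = a" "\<And>t. t \<in> {0..1} \<Longrightarrow> H (t, 1) = H (t, 0)"
    using h by blast+
  have convS: "convex S" unfolding S_def by (intro convex_Times) auto
  have segS: "closed_segment z z' \<subseteq> S" if "z \<in> S" "z' \<in> S" for z z'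
    using convS that by (simp add: closed_segment_subset)
  have pre: "\<exists>T. open T \<and> S \<inter> T = S \<inter> H -` W" if "P W F" for W F
  proof -
    have "openin (top_of_set S) (S \<inter> H -` W)"
      by (rule continuous_openin_preimage[OF H(1) _ op[OF that]]) (use H(2) in auto)
    then show ?thesis unfolding openin_open by metis
  qed
  \<comment> \<open>a Lebesgue number of the cover of the square by preimages of domains of potentials\<close>
  obtain \<delta> where \<delta>: "\<delta> > 0" "\<And>z. z \<in> S \<Longrightarrow> \<exists>W F. P W F \<and> H ` (S \<inter> ball z \<delta>) \<subseteq> W"
  proof -
    define \<C> where "\<C> = {T. open T \<and> (\<exists>W F. P W F \<and> H ` (S \<inter> T) \<subseteq> W)}"
    have "compact S" unfolding S_def by (intro compact_Times) auto
    moreover have "S \<subseteq> \<Union>\<C>"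
    proof
      fix z assume z: "z \<in> S"
      then obtain W F where W: "P W F" "H z \<in> W" using cov H(2) by blast
      then obtain T where "open T" "S \<inter> T = S \<inter> H -` W" using pre by blast
      then have "T \<in> \<C>" "z \<in> T" using W z unfolding \<C>_def by (blast, blast)
      then show "z \<in> \<Union>\<C>" by blast
    qed
    ultimately obtain e where e: "e > 0" "\<And>z. z \<in> S \<Longrightarrow> \<exists>T\<in>\<C>. ball z e \<subseteq> T"
      using Heine_Borel_lemma[of S \<C>] unfolding \<C>_def by blast
    have "\<exists>W F. P W F \<and> H ` (S \<inter> ball z e) \<subseteq> W" if "z \<in> S" for z
      using e(2)[OF that] unfolding \<C>_def by blast
    then show ?thesis using that e(1) by blast
  qed
  \<comment> \<open>the increment of a potential along a segment depends only on the image of the segment\<close>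
  define D where "D z z' = (THE r. \<forall>W F. P W F \<and> H ` closed_segment z z' \<subseteq> W \<longrightarrow> F (H z') - F (H z) = r)" for z z'
  have D: "D z z' = F (H z') - F (H z)"
    if z: "z \<in> S" "z' \<in> S" and W: "P W F" "H ` closed_segment z z' \<subseteq> W" for z z' W F
  proof -
    have *: "F' (H z') - F' (H z) = F (H z') - F (H z)"
      if W': "P W' F'" "H ` closed_segment z z' \<subseteq> W'" for W' F'
    proof -
      have "F (H z) - F' (H z) = F (H z') - F' (H z')"
      proof (rule locally_constant_imp_eq[where f="\<lambda>w. F (H w) - F' (H w)" and S="closed_segment z z'"])
        fix w assume w: "w \<in> closed_segment z z'"
        then obtain N where N: "openin (top_of_set U) N" "H w \<in> N" "\<forall>y\<in>N. F y - F' y = F (H w) - F' (H w)"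
          using diff[OF W(1) W'(1), of "H w"] W(2) W'(2) by blast
        have "continuous_on (closed_segment z z') H"
          using H(1) segS[OF z] continuous_on_subset by blast
        then have "openin (top_of_set (closed_segment z z')) (closed_segment z z' \<inter> H -` N)"
          by (rule continuous_openin_preimage[OF _ _ N(1)]) (use H(2) segS[OF z] in blast)
        then show "\<exists>T. openin (top_of_set (closed_segment z z')) T \<and> w \<in> T \<and>
            (\<forall>y\<in>T. F (H y) - F' (H y) = F (H w) - F' (H w))"
          by (intro exI[of _ "closed_segment z z' \<inter> H -` N"] conjI ballI) (use N(2,3) w in blast)+
      qed auto
      then show ?thesis by simp
    qed
    show ?thesis unfolding D_def
      by (rule the_equality) (use * W in blast)+
  qed
  have "\<exists>G. \<forall>x\<in>S. \<forall>y\<in>S. dist x y < \<delta> / 2 \<longrightarrow> D x y = G y - G x"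
  proof (rule local_cocycle_primitive[OF _ _ \<delta>(1)])
    show "r *\<^sub>R x \<in> S" if "x \<in> S" "r \<in> {0..1}" for x r
      using that unfolding S_def by (auto simp: mult_le_one)
    show "bounded S" unfolding S_def by (intro bounded_Times) auto
    fix x y z assume S: "x \<in> S" "y \<in> S" "z \<in> S" and d: "dist x y < \<delta>" "dist y z < \<delta>" "dist x z < \<delta>"
    obtain W F where W: "P W F" "H ` (S \<inter> ball x \<delta>) \<subseteq> W" using \<delta>(2)[OF S(1)] by blast
    have conv: "convex (S \<inter> ball x \<delta>)" by (intro convex_Int convS convex_ball)
    have mem: "x \<in> S \<inter> ball x \<delta>" "y \<in> S \<inter> ball x \<delta>" "z \<in> S \<inter> ball x \<delta>"
      using S d \<delta>(1) by auto
    have seg: "H ` closed_segment v w \<subseteq> W" if "v \<in> S \<inter> ball x \<delta>" "w \<in> S \<inter> ball x \<delta>" for v w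
      using closed_segment_subset[OF that conv] W(2) by blast
    show "D x y + D y z = D x z"
      by (simp add: D[OF S(1,2) W(1) seg[OF mem(1,2)]] D[OF S(2,3) W(1) seg[OF mem(2,3)]]
          D[OF S(1,3) W(1) seg[OF mem(1,3)]])
  qed
  then obtain G where G: "\<And>x y. \<lbrakk>x \<in> S; y \<in> S; dist x y < \<delta> / 2\<rbrakk> \<Longrightarrow> D x y = G y - G x" by blast
  have SI: "(s, t) \<in> S \<longleftrightarrow> s \<in> {0..1} \<and> t \<in> {0..1}" for s t unfolding S_def by simp
  have near: "\<exists>W F. P W F \<and> H ` closed_segment x y \<subseteq> W"
    if xy: "x \<in> S" "y \<in> S" "dist x y < \<delta> / 2" for x y
  proof -
    obtain W F where W: "P W F" "H ` (S \<inter> ball x \<delta>) \<subseteq> W" using \<delta>(2)[OF xy(1)] by blast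
    have "closed_segment x y \<subseteq> S \<inter> ball x \<delta>"
      using xy \<delta>(1) by (intro closed_segment_subset convex_Int convS convex_ball) auto
    then show ?thesis using W by blast
  qed
  \<comment> \<open>every stage of the homotopy is a loop, so \<open>H\<close> agrees on the edges \<open>t = 0\<close> and \<open>t = 1\<close>, and
    the increment of \<open>G\<close> over the loop does not depend on the stage\<close>
  have "G (0, 1) - G (0, 0) = G (1, 1) - G (1, 0)"
  proof (rule locally_constant_on_real_imp_eq[where f="\<lambda>s. G (s, 1) - G (s, 0)" and S="{0..1}" and e="\<delta> / 2"])
    fix s s' :: real assume s: "s \<in> {0..1}" "s' \<in> {0..1}" and d: "dist s s' < \<delta> / 2"
    have d': "dist (s, r) (s', r) < \<delta> / 2" for r :: real using d by (simp add: dist_Pair_Pair)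
    obtain W F where W: "P W F" "H ` closed_segment (s, 0) (s', 0) \<subseteq> W"
      using near[of "(s, 0)" "(s', 0)"] s d' SI by auto
    have "H ` closed_segment (s, 1) (s', 1) \<subseteq> W"
    proof (rule image_subsetI)
      fix w assume "w \<in> closed_segment (s, 1::real) (s', 1)"
      then obtain u where u: "0 \<le> u" "u \<le> 1" "w = (1 - u) *\<^sub>R (s, 1) + u *\<^sub>R (s', 1)"
        by (auto simp: in_segment)
      define r where "r = (1 - u) * s + u * s'"
      have "w = (r, 1)" using u by (simp add: r_def)
      moreover have "(r, 0) \<in> closed_segment (s, 0::real) (s', 0)"
        using u by (auto simp: in_segment r_def intro!: exI[of _ u])
      moreover have "r \<in> {0..1}"
        using convexD_alt[of "{0..1::real}" s s' u] s u by (simp add: r_def)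
      ultimately show "H w \<in> W" using H(5)[of r] W(2) by auto
    qed
    then have "D (s, 1) (s', 1) = F (H (s', 1)) - F (H (s, 1))"
      using D[of "(s, 1)" "(s', 1)"] W(1) s SI by auto
    also have "\<dots> = D (s, 0) (s', 0)"
      using D[of "(s, 0)" "(s', 0)"] W s SI H(5) by auto
    finally show "G (s', 1) - G (s', 0) = G (s, 1) - G (s, 0)"
      using G[OF _ _ d'[of 1]] G[OF _ _ d'[of 0]] s SI by auto
  qed (use \<delta>(1) in auto)
  \<comment> \<open>the final stage is a constant loop\<close>
  also have "G (1, 1) = G (1, 0)"
  proof (rule locally_constant_on_real_imp_eq[where f="\<lambda>t. G (1, t)" and S="{0..1}" and e="\<delta> / 2"])
    fix s s' :: real assume s: "s \<in> {0..1}" "s' \<in> {0..1}" and d: "dist s s' < \<delta> / 2"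
    have d': "dist (1::real, s) (1, s') < \<delta> / 2" using d by (simp add: dist_Pair_Pair)
    obtain W F where W: "P W F" "H ` closed_segment (1, s) (1, s') \<subseteq> W"
      using near[of "(1, s)" "(1, s')"] s d' SI by auto
    have "D (1, s) (1, s') = 0"
      using D[of "(1, s)" "(1, s')"] W s SI H(4) by auto
    then show "G (1, s') = G (1, s)" using G[OF _ _ d'] s SI by auto
  qed (use \<delta>(1) in auto)
  finally have G01: "G (0, 0) = G (0, 1)" by simp
  have "\<forall>\<^sub>F s in at t within {0..1}. G (0, s) - G (0, t) = F (\<gamma> s) - F (\<gamma> t)"
    if t: "t \<in> {0..1}" and W: "P W F" "\<gamma> t \<in> W" for t W F
  proof -
    obtain T where T: "open T" "S \<inter> T = S \<inter> H -` W" using pre[OF W(1)] by blast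
    have "(0, t) \<in> T" using T(2) W(2) H(3)[OF t] t SI[of 0 t] by auto
    then obtain e where e: "e > 0" "ball (0, t) e \<subseteq> T" using T(1) openE by blast
    have "G (0, s) - G (0, t) = F (\<gamma> s) - F (\<gamma> t)" if s: "s \<in> {0..1}" "dist s t < min e (\<delta> / 2)" for s
    proof -
      have S: "(0, t) \<in> S" "(0, s) \<in> S" using s t SI by auto
      have d: "dist (0::real, t) (0, s) < min e (\<delta> / 2)" using s by (simp add: dist_Pair_Pair dist_commute)
      have "closed_segment (0, t) (0, s) \<subseteq> S \<inter> ball (0, t) e"
        using d S e(1) by (intro closed_segment_subset convex_Int convS convex_ball) auto
      then have "H ` closed_segment (0, t) (0, s) \<subseteq> W" using e T by blast
      then have "D (0, t) (0, s) = F (H (0, s)) - F (H (0, t))" using D[OF S W(1)] by simp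
      then show ?thesis using G[OF S] d H(3) s t by simp
    qed
    then show ?thesis unfolding eventually_at using e(1) \<delta>(1)
      by (intro exI[of _ "min e (\<delta> / 2)"]) auto
  qed
  then show ?thesis using G01 by (intro exI[of _ "\<lambda>t. G (0, t)"]) auto
qed

section \<open>A periodic monotone function\<close>

lemma periodic_monotone_derivative_zero:
  fixes f f' :: "real \<Rightarrow> real"
  assumes f: "\<And>t. (f has_real_derivative f' t) (at t)" and T: "T > 0" "\<And>t. f (t + T) = f t"
    and sign: "(\<forall>t. f' t \<le> 0) \<or> (\<forall>t. f' t \<ge> 0)"
  shows "f' t = 0"
proof -
  have *: "k' t = 0" if k: "\<And>t. (k has_real_derivative k' t) (at t)" "\<And>t. k (t + T) = k t" "\<And>t. k' t \<le> 0"
    for k k' :: "real \<Rightarrow> real"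
  proof -
    have mono: "k b \<le> k a" if "a \<le> b" for a b
      using that k(1,3) by (intro DERIV_nonpos_imp_nonincreasing[of a b k]) blast+
    have "k t = k s" if "\<bar>t - s\<bar> < T" for s
    proof (cases "t \<le> s")
      case True
      then have "k s \<le> k t" "k (t + T) \<le> k s" using that by (auto intro!: mono)
      then show ?thesis using k(2)[of t] by simp
    next
      case False
      then have "k t \<le> k s" "k (s + T) \<le> k t" using that by (auto intro!: mono)
      then show ?thesis using k(2)[of s] by simp
    qed
    then show ?thesis using DERIV_local_const[OF k(1) T(1)] by blast
  qed
  show ?thesis
    using sign
  proof
    assume "\<forall>t. f' t \<le> 0"
    then show ?thesis using *[of f f'] f T(2) by blast
  next
    assume "\<forall>t. f' t \<ge> 0"
    moreover have "((\<lambda>t. - f t) has_real_derivative - f' t) (at t)" for t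
      by (intro derivative_intros f)
    ultimately have "- f' t = 0" using *[of "\<lambda>t. - f t" "\<lambda>t. - f' t"] T(2) by simp
    then show ?thesis by simp
  qed
qed

section \<open>Linear algebra of bilinear forms\<close>

lemma bilinear_linear:
  assumes "bilinear b"
  shows "linear (b x)" "linear (\<lambda>x. b x y)"
  using assms unfolding bilinear_def by auto

lemma nondegenerate_represents:
  fixes b :: "'a::euclidean_space \<Rightarrow> 'a \<Rightarrow> real"
  assumes b: "bilinear b" "nondegenerate b" and L: "linear L"
  shows "\<exists>!w. \<forall>z. b w z = L z"
proof -
  have expand: "l z = (\<Sum>i\<in>Basis. (z \<bullet> i) * l i)" if "linear l" for l :: "'a \<Rightarrow> real" and z
  proof -
    have "l z = l (\<Sum>i\<in>Basis. (z \<bullet> i) *\<^sub>R i)" by (simp add: euclidean_representation)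
    also have "\<dots> = (\<Sum>i\<in>Basis. (z \<bullet> i) * l i)"
      by (simp only: linear_sum[OF that] linear_cmul[OF that] real_scaleR_def)
    finally show ?thesis .
  qed
  define R where "R w = (\<Sum>i\<in>Basis. b w i *\<^sub>R i)" for w
  have Ri: "R w \<bullet> i = b w i" if "i \<in> Basis" for w i
    using that by (simp add: R_def inner_sum_left_Basis)
  have "linear R"
    by (rule linearI)
       (simp_all add: R_def bilinear_ladd[OF b(1)] bilinear_lmul[OF b(1)] scaleR_add_left sum.distrib
         scaleR_sum_right)
  moreover have "inj R"
  proof (subst linear_injective_0[OF \<open>linear R\<close>], intro allI impI)
    fix w assume w: "R w = 0"
    have "b w z = 0" for z
    proof -
      have "b w i = 0" if "i \<in> Basis" for i using Ri[OF that, of w] w by simp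
      then show ?thesis by (subst expand[OF bilinear_linear(1)[OF b(1)]]) simp
    qed
    then show "w = 0" using b(2) by (simp add: nondegenerate_def)
  qed
  ultimately have "surj R" by (rule linear_injective_imp_surjective) (rule refl)
  then obtain w where w: "R w = (\<Sum>i\<in>Basis. L i *\<^sub>R i)" by (metis surjD)
  have "b w i = L i" if "i \<in> Basis" for i
    using Ri[OF that, of w] that by (simp add: w inner_sum_left_Basis)
  then have "b w z = L z" for z
    by (subst expand[OF bilinear_linear(1)[OF b(1)]], subst expand[OF L]) simp
  moreover have "w' = w" if "\<forall>z. b w' z = L z" for w'
  proof -
    have "b (w' - w) z = 0" for z
      using linear_diff[OF bilinear_linear(2)[OF b(1)]] that \<open>\<And>z. b w z = L z\<close> by simp
    then show ?thesis using b(2) unfolding nondegenerate_def by (metis eq_iff_diff_eq_0)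
  qed
  ultimately show ?thesis by blast
qed

text \<open>A negative vector orthogonal to a null vector \<open>n\<close> has, in its orthogonal complement, a
  second negative vector, a combination of \<open>n\<close> and a vector not orthogonal to \<open>n\<close>; the two span
  a negative definite plane, which index one excludes.\<close>
lemma null_orthogonal_nonneg:
  fixes g :: "'a::euclidean_space \<Rightarrow> 'a \<Rightarrow> real"
  assumes g: "bilinear g" "\<And>u v. g u v = g v u" "nondegenerate g" "form_index g = 1"
    and n: "n \<noteq> 0" "g n n = 0" "g n w = 0"
  shows "g w w \<ge> 0"
proof (rule ccontr)
  assume "\<not> g w w \<ge> 0"
  then have ww: "g w w < 0" by simp
  note lin = bilinear_ladd[OF g(1)] bilinear_radd[OF g(1)] bilinear_lmul[OF g(1)] bilinear_rmul[OF g(1)]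
    bilinear_lsub[OF g(1)] bilinear_rsub[OF g(1)]
  obtain y where y: "g n y \<noteq> 0" using g(3) n(1) unfolding nondegenerate_def by blast
  define y' where "y' = y - (g w y / g w w) *\<^sub>R w"
  have y': "g w y' = 0" "g n y' \<noteq> 0" using ww y n g(2)[of w n] by (auto simp: y'_def lin)
  \<comment> \<open>chosen to give \<open>g z z = -1\<close>\<close>
  define c where "c = (-1 - g y' y') / (2 * g n y')"
  define z where "z = y' + c *\<^sub>R n"
  have wz: "g w z = 0" using y' n(3) g(2)[of w n] by (simp add: z_def lin)
  have "g z z = g y' y' + 2 * c * g n y'"
    using n(2) g(2)[of y' n] by (simp add: z_def lin algebra_simps)
  moreover have "2 * c * g n y' = -1 - g y' y'" using y'(2) by (simp add: c_def)
  ultimately have zz: "g z z = -1" by simp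
  have neg: "g v v < 0" if v: "v \<in> span {w, z}" "v \<noteq> 0" for v
  proof -
    obtain a where "v - a *\<^sub>R w \<in> span {z}" using v(1) span_breakdown_eq[of v w "{z}"] by auto
    then obtain b where "v - a *\<^sub>R w = b *\<^sub>R z" by (auto simp: span_singleton)
    then have v': "v = a *\<^sub>R w + b *\<^sub>R z" by (simp add: algebra_simps)
    have "g v v = a\<^sup>2 * g w w - b\<^sup>2"
      using wz zz g(2)[of z w] by (simp add: v' lin power2_eq_square)
    moreover have "a \<noteq> 0 \<or> b \<noteq> 0" using v(2) v' by auto
    then have "a\<^sup>2 * g w w - b\<^sup>2 < 0"
    proof
      assume "a \<noteq> 0"
      then have "a\<^sup>2 * g w w < 0" using ww by (simp add: mult_pos_neg)
      then show ?thesis using zero_le_power2[of b] by linarith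
    next
      assume "b \<noteq> 0"
      then have "b\<^sup>2 > 0" by simp
      moreover have "a\<^sup>2 * g w w \<le> 0" using ww by (simp add: mult_nonneg_nonpos)
      ultimately show ?thesis by linarith
    qed
    ultimately show ?thesis by simp
  qed
  have z0: "z \<noteq> 0" using zz bilinear_lzero[OF g(1)] by auto
  have "w \<notin> span {z}"
  proof
    assume "w \<in> span {z}"
    then obtain b where "w = b *\<^sub>R z" by (auto simp: span_singleton)
    then show False using wz zz ww by (auto simp: lin bilinear_lzero[OF g(1)])
  qed
  then have "independent {w, z}" "w \<noteq> z"
    using z0 by (auto simp: independent_insert span_base)
  then have "dim (span {w, z}) = 2" by (simp add: dim_eq_card_independent)
  define Ws where "Ws = {dim W | W. subspace W \<and> (\<forall>v\<in>W - {0}. g v v < 0)}"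
  have "2 \<in> Ws" unfolding Ws_def
    using \<open>dim (span {w, z}) = 2\<close> neg subspace_span[of "{w, z}"]
    by (intro CollectI exI[of _ "span {w, z}"]) auto
  moreover have "finite Ws"
    by (rule finite_subset[of _ "{..DIM('a)}"]) (auto simp: Ws_def dim_subset_UNIV)
  ultimately have "2 \<le> Max Ws" by simp
  then show False using g(4) unfolding form_index_def Ws_def by simp
qed

lemma hyperplane_transversal_span:
  fixes T :: "'f::euclidean_space \<Rightarrow> 'e::euclidean_space"
  assumes "linear T" "inj T" "DIM('e) = DIM('f) + 1" "n \<notin> range T"
  shows "\<exists>u k. v = T u + k *\<^sub>R n"
proof -
  have sp: "span (range T) = range T"
    using linear_subspace_image[OF assms(1) subspace_UNIV] by (simp only: span_eq_iff)
  have "dim (range T) = DIM('f)" using dim_image_eq[OF assms(1), of UNIV] assms(2) by simp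
  then have "dim (insert n (range T)) = DIM('e)" using assms(3,4) by (simp add: dim_insert sp del: span_eq_iff)
  then have "span (insert n (range T)) = UNIV" by (simp only: dim_eq_full)
  then have "v \<in> span (insert n (range T))" by simp
  then obtain k where "v - k *\<^sub>R n \<in> span (range T)" using span_breakdown_eq by blast
  then obtain u where "v - k *\<^sub>R n = T u" using sp by auto
  then show ?thesis by (metis diff_add_cancel)
qed

lemma hyperplane_radical_trivial:
  fixes T :: "'f::euclidean_space \<Rightarrow> 'e::euclidean_space"
  assumes T: "linear T" "inj T" "DIM('e) = DIM('f) + 1" "n \<notin> range T"
    and g: "bilinear g" "\<And>u v. g u v = g v u" "nondegenerate g"
    and x: "\<And>u. g (T x) (T u) = 0" "g n (T x) = 0"
  shows "x = 0"
proof -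
  have "g (T x) v = 0" for v
  proof -
    obtain u k where "v = T u + k *\<^sub>R n" using hyperplane_transversal_span[OF T] by blast
    then show ?thesis using x g(2)[of "T x" n] by (simp add: bilinear_radd[OF g(1)] bilinear_rmul[OF g(1)])
  qed
  then have "T x = 0" using g(3) by (simp add: nondegenerate_def)
  then show ?thesis using linear_injective_0[OF T(1)] T(2) by simp
qed

text \<open>The algebra behind the rigged field and the rigged metric at one point.\<close>
lemma rank_one_perturbation:
  fixes h :: "'f::real_vector \<Rightarrow> 'f \<Rightarrow> real" and w :: "'f \<Rightarrow> real"
  assumes h: "bilinear h" "\<not> nondegenerate h" and w: "linear w"
    and triv: "\<And>x. (\<And>u. h x u = 0) \<Longrightarrow> w x = 0 \<Longrightarrow> x = 0" and sym: "\<And>u v. h u v = h v u"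
  shows "\<exists>\<xi>. (\<forall>u. h \<xi> u = 0) \<and> w \<xi> = 1" "nondegenerate (\<lambda>u v. h u v + w u * w v)"
proof -
  obtain n where n: "n \<noteq> 0" "\<And>v. h n v = 0" using h(2) unfolding nondegenerate_def by blast
  then have wn: "w n \<noteq> 0" using triv by blast
  define \<xi> where "\<xi> = (1 / w n) *\<^sub>R n"
  have \<xi>: "h \<xi> u = 0" "w \<xi> = 1" for u
    using n wn by (auto simp: \<xi>_def bilinear_lmul[OF h(1)] linear_cmul[OF w])
  then show "\<exists>\<xi>. (\<forall>u. h \<xi> u = 0) \<and> w \<xi> = 1" by blast
  show "nondegenerate (\<lambda>u v. h u v + w u * w v)"
    unfolding nondegenerate_def
  proof (intro allI impI)
    fix u assume u: "\<forall>v. h u v + w u * w v = 0"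
    then have "h u \<xi> + w u * w \<xi> = 0" by blast
    then have "w u = 0" using \<xi> sym[of u \<xi>] by simp
    then show "u = 0" using triv[of u] u by simp
  qed
qed

text \<open>Solutions of linear systems with nondegenerate limit converge. The vectors \<open>z j\<close> represent
  the coordinate functionals with respect to the limit form, so \<open>E x\<close> measures the distance of the
  system at \<open>x\<close> from the identity and \<open>R x\<close> the residual of the limit solution.\<close>
lemma tendsto_represented:
  fixes Q :: "'a \<Rightarrow> 'b::euclidean_space \<Rightarrow> 'b \<Rightarrow> real"
  assumes Q: "\<forall>\<^sub>F x in G. bilinear (Q x)" "bilinear Q0" "nondegenerate Q0" "\<And>u v. Q0 u v = Q0 v u"
      "\<And>u v. ((\<lambda>x. Q x u v) \<longlongrightarrow> Q0 u v) G"
    and L: "\<And>u. ((\<lambda>x. L x u) \<longlongrightarrow> L0 u) G"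
    and X: "\<forall>\<^sub>F x in G. \<forall>u. Q x (X x) u = L x u" "\<And>u. Q0 X0 u = L0 u"
  shows "(X \<longlongrightarrow> X0) G"
proof -
  have "\<exists>z. \<forall>y. Q0 y z = y \<bullet> j" for j
  proof -
    have "linear (\<lambda>y. y \<bullet> j)" by (simp add: bounded_linear.linear bounded_linear_inner_left)
    then show ?thesis using nondegenerate_represents[OF Q(2,3)] Q(4) by metis
  qed
  then obtain z where z: "\<And>j y. Q0 y (z j) = y \<bullet> j" by metis
  define E where "E x = (\<Sum>j\<in>Basis. \<Sum>i\<in>Basis. \<bar>Q x i (z j) - i \<bullet> j\<bar>)" for x
  define R where "R x = (\<Sum>j\<in>Basis. \<bar>L x (z j) - Q x X0 (z j)\<bar>)" for x
  have "(E \<longlongrightarrow> (\<Sum>j\<in>Basis. \<Sum>i\<in>Basis. \<bar>Q0 i (z j) - i \<bullet> j\<bar>)) G"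
    unfolding E_def by (intro tendsto_intros Q(5))
  then have "(E \<longlongrightarrow> 0) G" by (simp add: z)
  then have Ev: "\<forall>\<^sub>F x in G. E x < 1 / 2" by (rule order_tendstoD) simp
  have "(R \<longlongrightarrow> (\<Sum>j\<in>Basis. \<bar>L0 (z j) - Q0 X0 (z j)\<bar>)) G"
    unfolding R_def by (intro tendsto_intros Q(5) L)
  then have R0: "(R \<longlongrightarrow> 0) G" by (simp add: X(2))
  have "\<forall>\<^sub>F x in G. norm (X x - X0) \<le> 2 * R x"
    using Q(1) X(1) Ev
  proof eventually_elim
    fix x assume b: "bilinear (Q x)" and rep: "\<forall>u. Q x (X x) u = L x u" and E: "E x < 1 / 2"
    define Y where "Y = X x - X0"
    have QY: "Q x Y u = L x u - Q x X0 u" for u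
      using rep by (simp add: Y_def bilinear_lsub[OF b])
    have comp: "\<bar>Y \<bullet> j\<bar> \<le> \<bar>L x (z j) - Q x X0 (z j)\<bar> + norm Y * (\<Sum>i\<in>Basis. \<bar>Q x i (z j) - i \<bullet> j\<bar>)"
      for j
    proof -
      have "Q x Y (z j) = Q x (\<Sum>i\<in>Basis. (Y \<bullet> i) *\<^sub>R i) (z j)" by (simp add: euclidean_representation)
      also have "\<dots> = (\<Sum>i\<in>Basis. (Y \<bullet> i) * Q x i (z j))"
        by (simp only: linear_sum[OF bilinear_linear(2)[OF b]] bilinear_lmul[OF b] real_scaleR_def)
      finally have 1: "Q x Y (z j) = (\<Sum>i\<in>Basis. (Y \<bullet> i) * Q x i (z j))" .
      have 2: "Y \<bullet> j = (\<Sum>i\<in>Basis. (Y \<bullet> i) * (i \<bullet> j))"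
        by (subst (1) euclidean_representation[of Y, symmetric]) (simp only: inner_sum_left inner_scaleR_left)
      have "Y \<bullet> j = Q x Y (z j) - (\<Sum>i\<in>Basis. (Y \<bullet> i) * (Q x i (z j) - i \<bullet> j))"
        unfolding 1 2 by (simp add: right_diff_distrib sum_subtractf)
      then have "\<bar>Y \<bullet> j\<bar> \<le> \<bar>Q x Y (z j)\<bar> + \<bar>\<Sum>i\<in>Basis. (Y \<bullet> i) * (Q x i (z j) - i \<bullet> j)\<bar>" by linarith
      also have "\<bar>\<Sum>i\<in>Basis. (Y \<bullet> i) * (Q x i (z j) - i \<bullet> j)\<bar>
          \<le> (\<Sum>i\<in>Basis. \<bar>(Y \<bullet> i) * (Q x i (z j) - i \<bullet> j)\<bar>)" by (rule sum_abs)
      also have "\<dots> \<le> (\<Sum>i\<in>Basis. norm Y * \<bar>Q x i (z j) - i \<bullet> j\<bar>)"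
        by (intro sum_mono) (simp add: abs_mult Basis_le_norm mult_right_mono)
      also have "\<dots> = norm Y * (\<Sum>i\<in>Basis. \<bar>Q x i (z j) - i \<bullet> j\<bar>)" by (simp add: sum_distrib_left)
      finally show ?thesis using QY[of "z j"] by simp
    qed
    have "norm Y \<le> (\<Sum>j\<in>Basis. \<bar>Y \<bullet> j\<bar>)" by (rule norm_le_l1)
    also have "\<dots> \<le> (\<Sum>j\<in>Basis. \<bar>L x (z j) - Q x X0 (z j)\<bar> + norm Y * (\<Sum>i\<in>Basis. \<bar>Q x i (z j) - i \<bullet> j\<bar>))"
      by (intro sum_mono comp)
    also have "\<dots> = R x + norm Y * E x" by (simp add: R_def E_def sum.distrib sum_distrib_left)
    also have "\<dots> \<le> R x + norm Y * (1 / 2)" using E by (intro add_left_mono mult_left_mono) auto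
    finally show "norm (X x - X0) \<le> 2 * R x" by (simp add: Y_def)
  qed
  moreover have "((\<lambda>x. 2 * R x) \<longlongrightarrow> 0) G" using tendsto_mult_right_zero[OF R0] by simp
  ultimately have "((\<lambda>x. X x - X0) \<longlongrightarrow> 0) G" by (rule Lim_null_comparison)
  then show ?thesis by (simp add: LIM_zero_iff)
qed

section \<open>Charts and changes of coordinates\<close>

text \<open>A chart with open domain in \<open>S\<close>.\<close>
definition coord_chart :: "'m::topological_space set \<Rightarrow> ('m, 'e::euclidean_space) chart \<Rightarrow> bool" where
  "coord_chart S c \<longleftrightarrow> openin (top_of_set S) (cdom c) \<and> open (cmap c ` cdom c) \<and>
     homeomorphism (cdom c) (cmap c ` cdom c) (cmap c) (cinv c)"

lemma smooth_manifold_coord_chart: "smooth_manifold S A \<Longrightarrow> c \<in> A \<Longrightarrow> coord_chart S c"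
  unfolding smooth_manifold_def coord_chart_def by blast

lemma cinv_cmap: "coord_chart S c \<Longrightarrow> p \<in> cdom c \<Longrightarrow> cinv c (cmap c p) = p"
  unfolding coord_chart_def homeomorphism_def by blast

lemma cmap_cinv: "coord_chart S c \<Longrightarrow> x \<in> cmap c ` cdom c \<Longrightarrow> cmap c (cinv c x) = x"
  unfolding coord_chart_def homeomorphism_def by blast

lemma cdom_subset: "coord_chart S c \<Longrightarrow> cdom c \<subseteq> S"
  unfolding coord_chart_def by (blast dest: openin_imp_subset)

lemma open_cmap_image:
  assumes c: "coord_chart S c" and V: "openin (top_of_set S') V" and "S \<subseteq> S'"
  shows "open (cmap c ` (cdom c \<inter> V))"
proof -
  obtain T where T: "open T" "V = S' \<inter> T" using V by (auto simp: openin_open)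
  have "cdom c \<inter> V = cdom c \<inter> T" using T cdom_subset[OF c] assms(3) by blast
  then have "openin (top_of_set (cdom c)) (cdom c \<inter> V)" using T by (simp add: openin_open_Int)
  moreover have "homeomorphism (cdom c) (cmap c ` cdom c) (cmap c) (cinv c)"
    using c by (simp add: coord_chart_def)
  ultimately have "openin (top_of_set (cmap c ` cdom c)) (cmap c ` (cdom c \<inter> V))"
    using homeomorphism_imp_open_map by blast
  moreover have "open (cmap c ` cdom c)" using c by (simp add: coord_chart_def)
  ultimately show ?thesis using openin_open_trans by blast
qed

lemma openin_chart_preimage:
  assumes c: "coord_chart S c" and "open B"
  shows "openin (top_of_set S) (cdom c \<inter> cmap c -` B)"
proof -
  have "continuous_on (cdom c) (cmap c)" using c by (simp add: coord_chart_def homeomorphism_def)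
  then have "openin (top_of_set (cdom c)) (cdom c \<inter> cmap c -` B)"
    using assms(2) by (rule continuous_openin_preimage_gen)
  then show ?thesis using c openin_trans unfolding coord_chart_def by blast
qed

lemma chart_at_mem:
  assumes "p \<in> \<Union> (cdom ` A)"
  shows "chart_at A p \<in> A" "p \<in> cdom (chart_at A p)"
proof -
  have "\<exists>c. c \<in> A \<and> p \<in> cdom c" using assms by blast
  from someI_ex[OF this] show "chart_at A p \<in> A" "p \<in> cdom (chart_at A p)"
    unfolding chart_at_def by auto
qed

lemma trans_map_cmap: "coord_chart S d \<Longrightarrow> p \<in> cdom d \<Longrightarrow> trans_map d c (cmap d p) = cmap c p"
  by (simp add: trans_map_def cinv_cmap)

lemma trans_map_has_derivative:
  assumes "smooth_on (cmap d ` (cdom d \<inter> cdom c)) (trans_map d c)" "p \<in> cdom d \<inter> cdom c"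
  shows "(trans_map d c has_derivative tmap d c p) (at (cmap d p))"
  unfolding tmap_def using assms by (intro smooth_on_has_derivative) auto

lemma tmap_trans:
  fixes b :: "('m::topological_space, 'e1::euclidean_space) chart"
    and c :: "('m, 'e2::euclidean_space) chart" and c' :: "('m, 'e3::euclidean_space) chart"
  assumes b: "coord_chart S b" and c: "coord_chart S' c" and op: "open (cmap b ` (cdom b \<inter> cdom c))"
    and p: "p \<in> cdom b" "p \<in> cdom c"
    and bc: "(trans_map b c has_derivative tmap b c p) (at (cmap b p))"
    and cc': "(trans_map c c' has_derivative tmap c c' p) (at (cmap c p))"
  shows "tmap b c' p u = tmap c c' p (tmap b c p u)"
proof -
  have "((\<lambda>x. trans_map c c' (trans_map b c x)) has_derivative (\<lambda>u. tmap c c' p (tmap b c p u))) (at (cmap b p))"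
    using bc cc' by (intro has_derivative_compose[of "trans_map b c" _ _ _ "trans_map c c'"])
      (simp_all add: trans_map_cmap[OF b p(1)])
  then have "(trans_map b c' has_derivative (\<lambda>u. tmap c c' p (tmap b c p u))) (at (cmap b p))"
  proof (rule has_derivative_transform_within_open[OF _ op])
    show "cmap b p \<in> cmap b ` (cdom b \<inter> cdom c)" using p by blast
    fix x assume "x \<in> cmap b ` (cdom b \<inter> cdom c)"
    then obtain q where q: "q \<in> cdom b" "q \<in> cdom c" "x = cmap b q" by blast
    then show "trans_map c c' (trans_map b c x) = trans_map b c' x"
      by (simp add: trans_map_cmap[OF b] trans_map_cmap[OF c])
  qed
  then show ?thesis unfolding tmap_def using frechet_derivative_at by metis
qed

section \<open>Lowered Christoffel symbols and their pullback\<close>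

text \<open>The second derivative, in direction \<open>u\<close>, of the change of coordinates applied to the constant
  vector \<open>v\<close>.\<close>
definition hess_trans :: "('m, 'f::euclidean_space) chart \<Rightarrow> ('m, 'e::euclidean_space) chart \<Rightarrow> 'm \<Rightarrow> 'f \<Rightarrow> 'f \<Rightarrow> 'e" where
  "hess_trans d c p u v = frechet_derivative (\<lambda>x. tmap d c (cinv d x) v) (at (cmap d p)) u"

text \<open>Christoffel symbols of first kind. They make sense for degenerate tensors as well.\<close>
definition koszul ::
  "('m, 'e::euclidean_space) two_tensor \<Rightarrow> ('m, 'e) chart \<Rightarrow> 'm \<Rightarrow> 'e \<Rightarrow> 'e \<Rightarrow> 'e \<Rightarrow> real" where
  "koszul g c p u v z = (metric_deriv g c p u v z + metric_deriv g c p v u z - metric_deriv g c p z u v) / 2"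

text \<open>Two charts with a smooth change of coordinates from the first to the second. The model spaces
  may differ, so this covers charts of one manifold as well as the inclusion of the hypersurface.\<close>
locale chart_pair =
  fixes S S' :: "'m::topological_space set"
    and d :: "('m, 'f::euclidean_space) chart" and c :: "('m, 'e::euclidean_space) chart"
  assumes d: "coord_chart S d" and c: "coord_chart S' c" and sub: "S \<subseteq> S'"
    and smooth: "smooth_on (cmap d ` (cdom d \<inter> cdom c)) (trans_map d c)"
begin

text \<open>The coordinate image of the common domain.\<close>
definition "overlap = cmap d ` (cdom d \<inter> cdom c)"

lemma open_overlap: "open overlap"
  unfolding overlap_def by (rule open_cmap_image[OF d _ sub]) (use c in \<open>simp add: coord_chart_def\<close>)

lemma overlap_mem: "p \<in> cdom d \<Longrightarrow> p \<in> cdom c \<Longrightarrow> cmap d p \<in> overlap"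
  unfolding overlap_def by blast

lemma overlap_cases:
  assumes "x \<in> overlap"
  obtains q where "q \<in> cdom d" "q \<in> cdom c" "x = cmap d q" "cinv d x = q"
  using assms cinv_cmap[OF d] unfolding overlap_def by blast

lemma tmap_cinv: "x \<in> overlap \<Longrightarrow> tmap d c (cinv d x) v = frechet_derivative (trans_map d c) (at x) v"
  by (erule overlap_cases) (simp add: tmap_def)

lemma smooth_overlap: "smooth_on overlap (trans_map d c)" using smooth by (simp add: overlap_def)

lemma trans_has_derivative:
  "p \<in> cdom d \<Longrightarrow> p \<in> cdom c \<Longrightarrow> (trans_map d c has_derivative tmap d c p) (at (cmap d p))"
  using trans_map_has_derivative[OF smooth] by blast

lemma linear_tmap: "p \<in> cdom d \<Longrightarrow> p \<in> cdom c \<Longrightarrow> linear (tmap d c p)"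
  using trans_has_derivative has_derivative_linear by blast

lemma frechet_derivative_tmap:
  assumes "x \<in> overlap"
  shows "frechet_derivative (\<lambda>x. tmap d c (cinv d x) v) (at x)
       = frechet_derivative (\<lambda>x. frechet_derivative (trans_map d c) (at x) v) (at x)"
    and "((\<lambda>x. tmap d c (cinv d x) v) has_derivative frechet_derivative (\<lambda>x. tmap d c (cinv d x) v) (at x)) (at x)"
proof -
  have "((\<lambda>x. frechet_derivative (trans_map d c) (at x) v) has_derivative
      frechet_derivative (\<lambda>x. frechet_derivative (trans_map d c) (at x) v) (at x)) (at x)"
    by (rule smooth_on_has_derivative[OF smooth_on_frechet_derivative[OF smooth_overlap] assms])
  then have *: "((\<lambda>x. tmap d c (cinv d x) v) has_derivative
      frechet_derivative (\<lambda>x. frechet_derivative (trans_map d c) (at x) v) (at x)) (at x)"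
    by (rule has_derivative_transform_within_open[OF _ open_overlap assms]) (simp add: tmap_cinv)
  then show "frechet_derivative (\<lambda>x. tmap d c (cinv d x) v) (at x)
       = frechet_derivative (\<lambda>x. frechet_derivative (trans_map d c) (at x) v) (at x)"
    by (rule frechet_derivative_at[symmetric])
  then show "((\<lambda>x. tmap d c (cinv d x) v) has_derivative frechet_derivative (\<lambda>x. tmap d c (cinv d x) v) (at x)) (at x)"
    using * by simp
qed

lemma tmap_has_derivative:
  assumes "p \<in> cdom d" "p \<in> cdom c"
  shows "((\<lambda>x. tmap d c (cinv d x) v) has_derivative (\<lambda>u. hess_trans d c p u v)) (at (cmap d p))"
  using frechet_derivative_tmap(2)[OF overlap_mem[OF assms]] by (simp add: hess_trans_def)

lemma hess_trans_sym:
  assumes "p \<in> cdom d" "p \<in> cdom c"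
  shows "hess_trans d c p u v = hess_trans d c p v u"
  using second_derivative_symmetric[OF open_overlap overlap_mem[OF assms] smooth_overlap]
  by (simp add: hess_trans_def frechet_derivative_tmap(1)[OF overlap_mem[OF assms]])

lemma isCont_hess_trans:
  assumes "p \<in> cdom d" "p \<in> cdom c"
  shows "isCont (\<lambda>x. hess_trans d c (cinv d x) u v) (cmap d p)"
proof -
  have "continuous_on overlap (\<lambda>x. frechet_derivative (\<lambda>x. frechet_derivative (trans_map d c) (at x) v) (at x) u)"
    by (intro smooth_on_imp_continuous_on smooth_on_frechet_derivative smooth_overlap)
  then have "continuous_on overlap (\<lambda>x. hess_trans d c (cinv d x) u v)"
  proof (rule continuous_on_eq)
    fix x assume "x \<in> overlap"
    then obtain q where "q \<in> cdom d" "q \<in> cdom c" "x = cmap d q" "cinv d x = q" by (rule overlap_cases)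
    then show "frechet_derivative (\<lambda>x. frechet_derivative (trans_map d c) (at x) v) (at x) u = hess_trans d c (cinv d x) u v"
      using frechet_derivative_tmap(1)[OF \<open>x \<in> overlap\<close>] by (simp add: hess_trans_def)
  qed
  then show ?thesis using open_overlap overlap_mem[OF assms] continuous_on_eq_continuous_at by blast
qed

lemma isCont_tmap:
  assumes "p \<in> cdom d" "p \<in> cdom c"
  shows "isCont (\<lambda>x. tmap d c (cinv d x) v) (cmap d p)"
  using tmap_has_derivative[OF assms] has_derivative_continuous by blast

lemma compose_chart:
  assumes p: "p \<in> cdom d" "p \<in> cdom c"
    and F: "((\<lambda>y. F (cinv c y)) has_derivative F') (at (cmap c p))"
  shows "((\<lambda>x. F (cinv d x)) has_derivative (\<lambda>u. F' (tmap d c p u))) (at (cmap d p))"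
proof -
  have "((\<lambda>x. F (cinv c (trans_map d c x))) has_derivative (\<lambda>u. F' (tmap d c p u))) (at (cmap d p))"
    using trans_has_derivative[OF p] F
    by (intro has_derivative_compose[of "trans_map d c" _ _ _ "\<lambda>y. F (cinv c y)"])
       (simp_all add: trans_map_cmap[OF d p(1)])
  then show ?thesis
  proof (rule has_derivative_transform_within_open[OF _ open_overlap overlap_mem[OF p]])
    fix x assume "x \<in> overlap"
    then obtain q where "q \<in> cdom d" "q \<in> cdom c" "x = cmap d q" "cinv d x = q" by (rule overlap_cases)
    then show "F (cinv c (trans_map d c x)) = F (cinv d x)"
      by (simp add: trans_map_cmap[OF d] cinv_cmap[OF c])
  qed
qed

lemma isCont_compose_chart:
  assumes p: "p \<in> cdom d" "p \<in> cdom c"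
    and F: "isCont (\<lambda>y. F (cinv c y)) (cmap c p)"
  shows "isCont (\<lambda>x. F (cinv d x)) (cmap d p)"
proof -
  have "isCont (trans_map d c) (cmap d p)"
    using trans_has_derivative[OF p] has_derivative_continuous by blast
  then have 1: "isCont (\<lambda>x. F (cinv c (trans_map d c x))) (cmap d p)"
    by (rule isCont_o2) (simp add: trans_map_cmap[OF d p(1)] F)
  have "\<forall>\<^sub>F x in nhds (cmap d p). F (cinv c (trans_map d c x)) = F (cinv d x)"
    unfolding eventually_nhds
  proof (intro exI[of _ overlap] conjI ballI open_overlap overlap_mem[OF p])
    fix x assume "x \<in> overlap"
    then obtain q where "q \<in> cdom d" "q \<in> cdom c" "x = cmap d q" "cinv d x = q" by (rule overlap_cases)
    then show "F (cinv c (trans_map d c x)) = F (cinv d x)"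
      by (simp add: trans_map_cmap[OF d] cinv_cmap[OF c])
  qed
  from isCont_cong[OF this] 1 show ?thesis by simp
qed

lemma eventually_overlap:
  assumes p: "p \<in> cdom d" "p \<in> cdom c"
  shows "\<forall>\<^sub>F x in nhds (cmap d p). cinv d x \<in> cdom d \<and> cinv d x \<in> cdom c \<and> cmap d (cinv d x) = x"
  unfolding eventually_nhds
proof (intro exI[of _ overlap] conjI ballI open_overlap overlap_mem[OF p])
  fix x assume "x \<in> overlap"
  then obtain q where q: "q \<in> cdom d" "q \<in> cdom c" "x = cmap d q" "cinv d x = q" by (rule overlap_cases)
  then show "cinv d x \<in> cdom d" "cinv d x \<in> cdom c" "cmap d (cinv d x) = x" by auto
qed

text \<open>The tensor \<open>h\<close> is the pullback of \<open>g\<close> along the change of coordinates.\<close>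

context
  fixes g :: "('m, 'e) two_tensor" and h :: "('m, 'f) two_tensor"
  assumes bil: "\<And>p. p \<in> cdom c \<Longrightarrow> bilinear (g c p)"
    and sym: "\<And>p u v. p \<in> cdom c \<Longrightarrow> g c p u v = g c p v u"
    and diff: "\<And>p u v. p \<in> cdom c \<Longrightarrow> (\<lambda>y. g c (cinv c y) u v) differentiable (at (cmap c p))"
    and pull: "\<And>p u v. p \<in> cdom d \<Longrightarrow> p \<in> cdom c \<Longrightarrow> h d p u v = g c p (tmap d c p u) (tmap d c p v)"
begin

lemma pullback_has_derivative:
  assumes p: "p \<in> cdom d" "p \<in> cdom c"
  shows "((\<lambda>x. h d (cinv d x) u v) has_derivative
     (\<lambda>a. metric_deriv g c p (tmap d c p a) (tmap d c p u) (tmap d c p v)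
        + g c p (hess_trans d c p a u) (tmap d c p v) + g c p (tmap d c p u) (hess_trans d c p a v)))
     (at (cmap d p))"
proof -
  let ?x = "cmap d p"
  have bilx: "bilinear (g c (cinv d x))" if "x \<in> overlap" for x
    using overlap_cases[OF that] bil by metis
  have cx: "cinv d ?x = p" using p cinv_cmap[OF d] by blast
  have base: "((\<lambda>x. g c (cinv d x) a b) has_derivative (\<lambda>u. metric_deriv g c p (tmap d c p u) a b)) (at ?x)" for a b
    unfolding metric_deriv_def
    by (rule compose_chart[OF p, where F="\<lambda>q. g c q a b"])
       (use diff[OF p(2)] in \<open>simp add: frechet_derivative_works\<close>)
  have one: "((\<lambda>x. g c (cinv d x) a (tmap d c (cinv d x) v)) has_derivative
      (\<lambda>u. metric_deriv g c p (tmap d c p u) a (tmap d c p v) + g c p a (hess_trans d c p u v))) (at ?x)" for a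
    using has_derivative_linear_field[OF open_overlap overlap_mem[OF p], where L="\<lambda>x. g c (cinv d x) a",
        OF bilinear_linear(1)[OF bilx] base tmap_has_derivative[OF p, of v]]
    by (simp add: cx)
  have "((\<lambda>x. g c (cinv d x) (tmap d c (cinv d x) u) (tmap d c (cinv d x) v)) has_derivative
      (\<lambda>a. (metric_deriv g c p (tmap d c p a) (tmap d c p u) (tmap d c p v) + g c p (tmap d c p u) (hess_trans d c p a v))
         + g c p (hess_trans d c p a u) (tmap d c p v))) (at ?x)"
    using has_derivative_linear_field[OF open_overlap overlap_mem[OF p], where L="\<lambda>x a. g c (cinv d x) a (tmap d c (cinv d x) v)",
        OF bilinear_linear(2)[OF bilx] one tmap_has_derivative[OF p, of u]]
    by (simp add: cx)
  then have "((\<lambda>x. h d (cinv d x) u v) has_derivative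
      (\<lambda>a. (metric_deriv g c p (tmap d c p a) (tmap d c p u) (tmap d c p v) + g c p (tmap d c p u) (hess_trans d c p a v))
         + g c p (hess_trans d c p a u) (tmap d c p v))) (at ?x)"
  proof (rule has_derivative_transform_within_open[OF _ open_overlap overlap_mem[OF p]])
    fix x assume "x \<in> overlap"
    then obtain q where "q \<in> cdom d" "q \<in> cdom c" "x = cmap d q" "cinv d x = q" by (rule overlap_cases)
    then show "g c (cinv d x) (tmap d c (cinv d x) u) (tmap d c (cinv d x) v) = h d (cinv d x) u v"
      using pull by simp
  qed
  then show ?thesis by (simp add: algebra_simps)
qed

text \<open>The inhomogeneous term of the transformation law is paired with \<open>g\<close>. It disappears when the last
  argument is mapped into the radical of \<open>g\<close>.\<close>
lemma koszul_pullback: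
  assumes p: "p \<in> cdom d" "p \<in> cdom c"
  shows "koszul h d p u v z =
    koszul g c p (tmap d c p u) (tmap d c p v) (tmap d c p z) + g c p (hess_trans d c p u v) (tmap d c p z)"
proof -
  have md: "metric_deriv h d p a u v = metric_deriv g c p (tmap d c p a) (tmap d c p u) (tmap d c p v)
        + g c p (hess_trans d c p a u) (tmap d c p v) + g c p (tmap d c p u) (hess_trans d c p a v)" for a u v
    unfolding metric_deriv_def[of h] frechet_derivative_at[OF pullback_has_derivative[OF p], symmetric] ..
  show ?thesis unfolding koszul_def md
    using hess_trans_sym[OF p] sym[OF p(2)] by (simp add: field_simps)
qed

end

end

lemma metric_deriv_linear:
  assumes c: "coord_chart S c" and p: "p \<in> cdom c"
    and bil: "\<And>q. q \<in> cdom c \<Longrightarrow> bilinear (k c q)"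
    and der: "\<And>u v. ((\<lambda>x. k c (cinv c x) u v) has_derivative (\<lambda>a. metric_deriv k c p a u v)) (at (cmap c p))"
  shows "linear (\<lambda>a. metric_deriv k c p a u v)" "linear (\<lambda>u. metric_deriv k c p a u v)"
    "linear (\<lambda>v. metric_deriv k c p a u v)"
proof -
  have op: "open (cmap c ` cdom c)" using c by (simp add: coord_chart_def)
  have x: "cmap c p \<in> cmap c ` cdom c" using p by blast
  have bilx: "bilinear (k c (cinv c x))" if "x \<in> cmap c ` cdom c" for x
    using that bil cinv_cmap[OF c] by auto
  show "linear (\<lambda>a. metric_deriv k c p a u v)" using der by (rule has_derivative_linear)
  show "linear (\<lambda>u. metric_deriv k c p a u v)"
    by (rule linear_of_derivatives[OF op x, where L="\<lambda>x u. k c (cinv c x) u v" and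
          L'="\<lambda>u a. metric_deriv k c p a u v", OF bilinear_linear(2)[OF bilx] der])
  show "linear (\<lambda>v. metric_deriv k c p a u v)"
    by (rule linear_of_derivatives[OF op x, where L="\<lambda>x. k c (cinv c x) u" and
          L'="\<lambda>v a. metric_deriv k c p a u v", OF bilinear_linear(1)[OF bilx] der])
qed

lemma koszul_linear:
  assumes c: "coord_chart S c" and p: "p \<in> cdom c"
    and bil: "\<And>q. q \<in> cdom c \<Longrightarrow> bilinear (k c q)"
    and der: "\<And>u v. ((\<lambda>x. k c (cinv c x) u v) has_derivative (\<lambda>a. metric_deriv k c p a u v)) (at (cmap c p))"
  shows "linear (\<lambda>u. koszul k c p u v z)" "linear (\<lambda>v. koszul k c p u v z)" "linear (\<lambda>z. koszul k c p u v z)"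
proof -
  note l = metric_deriv_linear[OF assms]
  show "linear (\<lambda>u. koszul k c p u v z)" "linear (\<lambda>v. koszul k c p u v z)" "linear (\<lambda>z. koszul k c p u v z)"
    by (rule linearI; simp add: koszul_def linear_add[OF l(1)] linear_add[OF l(2)] linear_add[OF l(3)]
        linear_cmul[OF l(1)] linear_cmul[OF l(2)] linear_cmul[OF l(3)] field_simps)+
qed

lemma koszul_commute:
  assumes c: "coord_chart S c" and p: "p \<in> cdom c"
    and sym: "\<And>q u v. q \<in> cdom c \<Longrightarrow> k c q u v = k c q v u"
    and der: "\<And>u v. ((\<lambda>x. k c (cinv c x) u v) has_derivative (\<lambda>a. metric_deriv k c p a u v)) (at (cmap c p))"
  shows "koszul k c p u v z = koszul k c p v u z"
proof -
  have op: "open (cmap c ` cdom c)" using c by (simp add: coord_chart_def)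
  have x: "cmap c p \<in> cmap c ` cdom c" using p by blast
  have "metric_deriv k c p a u v = metric_deriv k c p a v u" for a u v
  proof -
    have "((\<lambda>x. k c (cinv c x) v u) has_derivative (\<lambda>a. metric_deriv k c p a u v)) (at (cmap c p))"
      by (rule has_derivative_transform_within_open[OF der op x]) (use sym cinv_cmap[OF c] in auto)
    from has_derivative_unique[OF this der] show ?thesis by (rule fun_cong)
  qed
  then show ?thesis unfolding koszul_def by (simp add: add.commute)
qed

lemma christoffel_koszul:
  fixes k :: "('m::topological_space, 'e::euclidean_space) two_tensor"
  assumes c: "coord_chart S c" and p: "p \<in> cdom c"
    and bil: "\<And>q. q \<in> cdom c \<Longrightarrow> bilinear (k c q)"
    and der: "\<And>u v. ((\<lambda>x. k c (cinv c x) u v) has_derivative (\<lambda>a. metric_deriv k c p a u v)) (at (cmap c p))"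
    and nd: "nondegenerate (k c p)"
  shows "k c p (christoffel k c p u v) z = koszul k c p u v z"
proof -
  have "\<exists>!w. \<forall>z. k c p w z = koszul k c p u v z"
    by (rule nondegenerate_represents[OF bil[OF p] nd koszul_linear(3)[OF c p bil der]])
  from theI'[OF this] show ?thesis unfolding christoffel_def koszul_def by blast
qed

section \<open>Closed normalizations of null hypersurfaces\<close>

text \<open>In this locale \<open>h\<close> is the induced degenerate metric and \<open>gt\<close> the rigged metric.\<close>
locale closed_null_normalization =
  fixes Mbar U M :: "'m::{second_countable_topology,t2_space} set"
    and A :: "('m, 'e::euclidean_space) chart set"
    and D :: "('m, 'f::euclidean_space) chart set"
    and g :: "('m, 'e) two_tensor"
    and \<zeta> :: "('m, 'e) vec_field"
  assumes lorentz: "lorentzian_manifold Mbar A g"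
    and null: "null_hypersurface Mbar A g M D"
    and closed_norm: "closed_normalization Mbar A g M D U \<zeta>"
begin

abbreviation "\<alpha> \<equiv> rigging_form g \<zeta>"
abbreviation "\<omega> \<equiv> rigged_form A g \<zeta> :: ('m, 'f) one_form"
abbreviation "h \<equiv> pullback_two A g :: ('m, 'f) two_tensor"
abbreviation "gt \<equiv> rigged_metric A g \<zeta> :: ('m, 'f) two_tensor"
abbreviation "\<xi> \<equiv> rigged_field A g \<zeta> :: ('m, 'f) vec_field"
abbreviation "B \<equiv> null_second_form A g \<zeta> :: ('m, 'f) two_tensor"

lemma A_chart: "c \<in> A \<Longrightarrow> coord_chart Mbar c"
  using lorentz unfolding lorentzian_manifold_def by (blast intro: smooth_manifold_coord_chart)

lemma D_chart: "d \<in> D \<Longrightarrow> coord_chart M d"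
  using null unfolding null_hypersurface_def hypersurface_def by (blast intro: smooth_manifold_coord_chart)

lemma M_subset_U: "M \<subseteq> U" and openin_U: "openin (top_of_set Mbar) U"
  using closed_norm unfolding closed_normalization_def rigging_def by blast+

lemma U_subset: "U \<subseteq> Mbar" using openin_U openin_imp_subset by blast

lemma A_cover: "p \<in> Mbar \<Longrightarrow> p \<in> \<Union> (cdom ` A)"
  using lorentz unfolding lorentzian_manifold_def smooth_manifold_def by blast

lemma D_cover: "p \<in> M \<Longrightarrow> \<exists>d\<in>D. p \<in> cdom d"
  using null unfolding null_hypersurface_def hypersurface_def smooth_manifold_def by blast

lemma D_dom: "d \<in> D \<Longrightarrow> p \<in> cdom d \<Longrightarrow> p \<in> M"
  using D_chart cdom_subset by blast

lemma M_mem: "p \<in> M \<Longrightarrow> p \<in> U" "p \<in> M \<Longrightarrow> p \<in> Mbar"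
  using M_subset_U U_subset by auto

lemma ambient_chart: "p \<in> Mbar \<Longrightarrow> chart_at A p \<in> A" "p \<in> Mbar \<Longrightarrow> p \<in> cdom (chart_at A p)"
  using chart_at_mem[OF A_cover] by auto

lemma chart_pair_AA: "c \<in> A \<Longrightarrow> c' \<in> A \<Longrightarrow> chart_pair Mbar Mbar c c'"
  using lorentz unfolding lorentzian_manifold_def smooth_manifold_def
  by (intro chart_pair.intro A_chart) auto

lemma chart_pair_DD: "d \<in> D \<Longrightarrow> d' \<in> D \<Longrightarrow> chart_pair M M d d'"
  using null unfolding null_hypersurface_def hypersurface_def smooth_manifold_def
  by (intro chart_pair.intro D_chart) auto

lemma chart_pair_DA: "d \<in> D \<Longrightarrow> c \<in> A \<Longrightarrow> chart_pair M Mbar d c"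
  using null unfolding null_hypersurface_def hypersurface_def
  by (intro chart_pair.intro D_chart A_chart) auto

lemma tmap_DAA:
  assumes "d \<in> D" "c \<in> A" "c' \<in> A" and p: "p \<in> cdom d" "p \<in> cdom c" "p \<in> cdom c'"
  shows "tmap d c' p u = tmap c c' p (tmap d c p u)"
proof -
  interpret dc: chart_pair M Mbar d c by (rule chart_pair_DA[OF assms(1,2)])
  interpret cc: chart_pair Mbar Mbar c c' by (rule chart_pair_AA[OF assms(2,3)])
  show ?thesis
    by (rule tmap_trans[OF dc.d dc.c dc.open_overlap[unfolded dc.overlap_def] p(1,2) dc.trans_has_derivative[OF p(1,2)]
          cc.trans_has_derivative[OF p(2,3)]])
qed

lemma tmap_DDA:
  assumes "d \<in> D" "d' \<in> D" "c \<in> A" and p: "p \<in> cdom d" "p \<in> cdom d'" "p \<in> cdom c"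
  shows "tmap d c p u = tmap d' c p (tmap d d' p u)"
proof -
  interpret dd: chart_pair M M d d' by (rule chart_pair_DD[OF assms(1,2)])
  interpret dc: chart_pair M Mbar d' c by (rule chart_pair_DA[OF assms(2,3)])
  show ?thesis
    by (rule tmap_trans[OF dd.d dd.c dd.open_overlap[unfolded dd.overlap_def] p(1,2) dd.trans_has_derivative[OF p(1,2)]
          dc.trans_has_derivative[OF p(2,3)]])
qed

lemma inj_tmap: "d \<in> D \<Longrightarrow> c \<in> A \<Longrightarrow> p \<in> cdom d \<Longrightarrow> p \<in> cdom c \<Longrightarrow> inj (tmap d c p)"
  using null unfolding null_hypersurface_def hypersurface_def by blast

lemma g_bilinear: "c \<in> A \<Longrightarrow> p \<in> cdom c \<Longrightarrow> bilinear (g c p)"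
  and g_sym: "c \<in> A \<Longrightarrow> p \<in> cdom c \<Longrightarrow> g c p u v = g c p v u"
  and g_smooth: "c \<in> A \<Longrightarrow> smooth_on (cmap c ` cdom c) (\<lambda>x. g c (cinv c x) u v)"
  and g_tensor: "c \<in> A \<Longrightarrow> c' \<in> A \<Longrightarrow> p \<in> cdom c \<Longrightarrow> p \<in> cdom c' \<Longrightarrow>
      g c p u v = g c' p (tmap c c' p u) (tmap c c' p v)"
  and g_nondegenerate: "c \<in> A \<Longrightarrow> p \<in> cdom c \<Longrightarrow> nondegenerate (g c p)"
  and g_index: "c \<in> A \<Longrightarrow> p \<in> cdom c \<Longrightarrow> form_index (g c p) = 1"
  using lorentz unfolding lorentzian_manifold_def smooth_sym_tensor_def by blast+

lemma \<zeta>_smooth: "c \<in> A \<Longrightarrow> smooth_on (cmap c ` (cdom c \<inter> U)) (\<lambda>x. \<zeta> c (cinv c x))"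
  and \<zeta>_vector: "c \<in> A \<Longrightarrow> c' \<in> A \<Longrightarrow> p \<in> cdom c \<Longrightarrow> p \<in> cdom c' \<Longrightarrow> p \<in> U \<Longrightarrow>
      \<zeta> c' p = tmap c c' p (\<zeta> c p)"
  using closed_norm unfolding closed_normalization_def rigging_def smooth_vec_field_def by blast+

lemma \<zeta>_transversal: "d \<in> D \<Longrightarrow> c \<in> A \<Longrightarrow> p \<in> cdom d \<Longrightarrow> p \<in> cdom c \<Longrightarrow> \<zeta> c p \<notin> range (tmap d c p)"
  using closed_norm unfolding closed_normalization_def rigging_def by blast

lemma g_has_derivative:
  assumes "c \<in> A" "p \<in> cdom c"
  shows "((\<lambda>x. g c (cinv c x) u v) has_derivative (\<lambda>a. metric_deriv g c p a u v)) (at (cmap c p))"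
  unfolding metric_deriv_def using smooth_on_has_derivative[OF g_smooth[OF assms(1)]] assms(2) by blast

lemma open_cmap: "c \<in> A \<Longrightarrow> open (cmap c ` (cdom c \<inter> U))"
  by (rule open_cmap_image[OF A_chart openin_U order_refl])

section \<open>The rigging form\<close>

lemma \<alpha>_linear: "c \<in> A \<Longrightarrow> p \<in> cdom c \<Longrightarrow> linear (\<alpha> c p)"
  unfolding rigging_form_def by (rule bilinear_linear(1)[OF g_bilinear])

lemma \<alpha>_form:
  assumes "c \<in> A" "c' \<in> A" "p \<in> cdom c" "p \<in> cdom c'" "p \<in> U"
  shows "\<alpha> c p v = \<alpha> c' p (tmap c c' p v)"
  unfolding rigging_form_def using g_tensor[OF assms(1-4)] \<zeta>_vector[OF assms] by simp

text \<open>The coordinate derivative of \<open>\<alpha>\<close> in direction \<open>u\<close>, evaluated at \<open>v\<close>; closedness of \<open>\<alpha>\<close> is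
  its symmetry.\<close>
definition d\<alpha> :: "('m, 'e) chart \<Rightarrow> 'm \<Rightarrow> 'e \<Rightarrow> 'e \<Rightarrow> real" where
  "d\<alpha> c p u v = frechet_derivative (\<lambda>x. \<alpha> c (cinv c x) v) (at (cmap c p)) u"

lemma \<alpha>_has_derivative_explicit:
  assumes c: "c \<in> A" and p: "p \<in> cdom c" "p \<in> U"
  shows "((\<lambda>x. \<alpha> c (cinv c x) v) has_derivative
    (\<lambda>a. metric_deriv g c p a (\<zeta> c p) v + g c p (frechet_derivative (\<lambda>x. \<zeta> c (cinv c x)) (at (cmap c p)) a) v))
    (at (cmap c p))"
proof -
  have x: "cmap c p \<in> cmap c ` (cdom c \<inter> U)" using p by blast
  have cx: "cinv c (cmap c p) = p" by (rule cinv_cmap[OF A_chart[OF c] p(1)])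
  have lin: "linear (\<lambda>a. g c (cinv c y) a v)" if "y \<in> cmap c ` (cdom c \<inter> U)" for y
  proof -
    obtain q where "q \<in> cdom c" "y = cmap c q" using \<open>y \<in> cmap c ` (cdom c \<inter> U)\<close> by blast
    then have "cinv c y = q" using cinv_cmap[OF A_chart[OF c]] by blast
    then show ?thesis using bilinear_linear(2)[OF g_bilinear[OF c \<open>q \<in> cdom c\<close>]] by simp
  qed
  show ?thesis
    unfolding rigging_form_def
    using has_derivative_linear_field[OF open_cmap[OF c] x, where L="\<lambda>x a. g c (cinv c x) a v" and X="\<lambda>x. \<zeta> c (cinv c x)",
        OF lin g_has_derivative[OF c p(1)] smooth_on_has_derivative[OF \<zeta>_smooth[OF c] x]]
    by (simp add: cx)
qed

lemma \<alpha>_has_derivative: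
  assumes "c \<in> A" "p \<in> cdom c" "p \<in> U"
  shows "((\<lambda>x. \<alpha> c (cinv c x) v) has_derivative (\<lambda>u. d\<alpha> c p u v)) (at (cmap c p))"
  unfolding d\<alpha>_def frechet_derivative_at[OF \<alpha>_has_derivative_explicit[OF assms], symmetric]
  by (rule \<alpha>_has_derivative_explicit[OF assms])

lemma d\<alpha>_sym: "c \<in> A \<Longrightarrow> p \<in> cdom c \<Longrightarrow> p \<in> U \<Longrightarrow> d\<alpha> c p u v = d\<alpha> c p v u"
  using closed_norm unfolding closed_normalization_def closed_one_form_on_def exterior_derivative_def d\<alpha>_def
  by simp

lemma continuous_on_d\<alpha>:
  assumes c: "c \<in> A"
  shows "continuous_on (cmap c ` (cdom c \<inter> U)) (\<lambda>x. d\<alpha> c (cinv c x) u v)"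
proof -
  let ?O = "cmap c ` (cdom c \<inter> U)"
  let ?Z = "\<lambda>x. frechet_derivative (\<lambda>x. \<zeta> c (cinv c x)) (at x) u"
  have mem: "cinv c x \<in> cdom c" "cinv c x \<in> U" "cmap c (cinv c x) = x" if x: "x \<in> ?O" for x
    using x cinv_cmap[OF A_chart[OF c]] by auto
  have sub: "?O \<subseteq> cmap c ` cdom c" by blast
  have lin1: "linear (\<lambda>a. metric_deriv g c (cinv c x) u a v)" if x: "x \<in> ?O" for x
  proof -
    have lin: "linear (\<lambda>a. g c (cinv c y) a v)" if "y \<in> ?O" for y
      by (rule bilinear_linear(2)[OF g_bilinear[OF c mem(1)[OF that]]])
    show ?thesis
      using linear_of_derivatives[OF open_cmap[OF c] x lin, where L'="\<lambda>b a. metric_deriv g c (cinv c x) a b v"]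
        g_has_derivative[OF c mem(1)[OF x]] mem(3)[OF x] by simp
  qed
  have cz: "continuous_on ?O (\<lambda>x. \<zeta> c (cinv c x))"
    by (rule smooth_on_imp_continuous_on[OF \<zeta>_smooth[OF c]])
  have cm: "continuous_on ?O (\<lambda>x. metric_deriv g c (cinv c x) u a v)" for a
  proof (rule continuous_on_eq)
    show "continuous_on ?O (\<lambda>x. frechet_derivative (\<lambda>x. g c (cinv c x) a v) (at x) u)"
      using smooth_on_imp_continuous_on[OF smooth_on_frechet_derivative[OF g_smooth[OF c]]] sub
      by (rule continuous_on_subset)
  qed (simp add: metric_deriv_def mem)
  have cg: "continuous_on ?O (\<lambda>x. g c (cinv c x) a v)" for a
    using smooth_on_imp_continuous_on[OF g_smooth[OF c]] sub by (rule continuous_on_subset)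
  have "continuous_on ?O (\<lambda>x. metric_deriv g c (cinv c x) u (\<zeta> c (cinv c x)) v)"
    by (rule continuous_on_linear_field[where L="\<lambda>x a. metric_deriv g c (cinv c x) u a v", OF lin1 cm cz])
  moreover have "continuous_on ?O (\<lambda>x. g c (cinv c x) (?Z x) v)"
    by (rule continuous_on_linear_field[where L="\<lambda>x a. g c (cinv c x) a v",
          OF bilinear_linear(2)[OF g_bilinear[OF c mem(1)]] cg
             smooth_on_imp_continuous_on[OF smooth_on_frechet_derivative[OF \<zeta>_smooth[OF c]]]])
  ultimately have "continuous_on ?O (\<lambda>x. metric_deriv g c (cinv c x) u (\<zeta> c (cinv c x)) v + g c (cinv c x) (?Z x) v)"
    by (rule continuous_on_add)
  then show ?thesis
  proof (rule continuous_on_eq)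
    fix x assume x: "x \<in> ?O"
    show "metric_deriv g c (cinv c x) u (\<zeta> c (cinv c x)) v + g c (cinv c x) (?Z x) v = d\<alpha> c (cinv c x) u v"
      unfolding d\<alpha>_def frechet_derivative_at[OF \<alpha>_has_derivative_explicit[OF c mem(1,2)[OF x]], symmetric]
      by (simp add: mem(3)[OF x])
  qed
qed

section \<open>Local potentials\<close>

text \<open>A function on an open subset of \<open>U\<close> with differential \<open>\<alpha>\<close>, in every ambient chart.\<close>
definition potential :: "'m set \<Rightarrow> ('m \<Rightarrow> real) \<Rightarrow> bool" where
  "potential W F \<longleftrightarrow> openin (top_of_set U) W \<and>
     (\<forall>p\<in>W. \<forall>c\<in>A. p \<in> cdom c \<longrightarrow> ((\<lambda>x. F (cinv c x)) has_derivative \<alpha> c p) (at (cmap c p)))"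

lemma potential_subset: "potential W F \<Longrightarrow> W \<subseteq> U"
  unfolding potential_def using openin_imp_subset by blast

lemma potential_has_derivative:
  "\<lbrakk>potential W F; p \<in> W; c \<in> A; p \<in> cdom c\<rbrakk>
    \<Longrightarrow> ((\<lambda>x. F (cinv c x)) has_derivative \<alpha> c p) (at (cmap c p))"
  unfolding potential_def by blast

lemma potential_exists:
  assumes p: "p \<in> U"
  shows "\<exists>W F. potential W F \<and> p \<in> W"
proof -
  have pM: "p \<in> Mbar" using p U_subset by blast
  obtain c where c: "c \<in> A" "p \<in> cdom c" using ambient_chart[OF pM] by blast
  have cc: "coord_chart Mbar c" by (rule A_chart[OF c(1)])
  let ?O = "cmap c ` (cdom c \<inter> U)"
  have "cmap c p \<in> ?O" using c p by blast
  then obtain r where r: "r > 0" "ball (cmap c p) r \<subseteq> ?O" using open_cmap[OF c(1)] openE by blast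
  let ?B = "ball (cmap c p) r"
  have mem: "cinv c x \<in> cdom c" "cinv c x \<in> U" "cmap c (cinv c x) = x" if x: "x \<in> ?B" for x
  proof -
    obtain q where "q \<in> cdom c" "q \<in> U" "x = cmap c q" using x r(2) by blast
    then show "cinv c x \<in> cdom c" "cinv c x \<in> U" "cmap c (cinv c x) = x" using cinv_cmap[OF cc] by auto
  qed
  have "\<exists>f. \<forall>x\<in>?B. (f has_derivative \<alpha> c (cinv c x)) (at x)"
  proof (rule poincare_one_form[where \<beta>'="\<lambda>x v u. d\<alpha> c (cinv c x) u v"])
    show "linear (\<alpha> c (cinv c x))" if "x \<in> ?B" for x by (rule \<alpha>_linear[OF c(1) mem(1)[OF that]])
    show "((\<lambda>y. \<alpha> c (cinv c y) v) has_derivative (\<lambda>u. d\<alpha> c (cinv c x) u v)) (at x)" if "x \<in> ?B" for x v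
      using \<alpha>_has_derivative[OF c(1) mem(1,2)[OF that]] mem(3)[OF that] by simp
    show "continuous_on ?B (\<lambda>x. d\<alpha> c (cinv c x) u v)" for u v
      using continuous_on_d\<alpha>[OF c(1)] r(2) by (rule continuous_on_subset)
    show "d\<alpha> c (cinv c x) u v = d\<alpha> c (cinv c x) v u" if "x \<in> ?B" for x u v
      by (rule d\<alpha>_sym[OF c(1) mem(1,2)[OF that]])
  qed auto
  then obtain f where f: "\<And>x. x \<in> ?B \<Longrightarrow> (f has_derivative \<alpha> c (cinv c x)) (at x)" by blast
  define F where "F q = f (cmap c q)" for q
  define W where "W = cdom c \<inter> cmap c -` ?B"
  have WU: "W \<subseteq> U"
  proof
    fix q assume "q \<in> W"
    then show "q \<in> U" using mem(2)[of "cmap c q"] cinv_cmap[OF cc, of q] by (auto simp: W_def)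
  qed
  have "openin (top_of_set Mbar) W" unfolding W_def by (rule openin_chart_preimage[OF cc open_ball])
  then have "openin (top_of_set U) W" using WU U_subset by (rule openin_subset_trans)
  moreover have "((\<lambda>x. F (cinv c' x)) has_derivative \<alpha> c' q) (at (cmap c' q))"
    if q: "q \<in> W" and c': "c' \<in> A" "q \<in> cdom c'" for q c'
  proof -
    interpret t: chart_pair Mbar Mbar c' c by (rule chart_pair_AA[OF c'(1) c(1)])
    have qc: "q \<in> cdom c" "cmap c q \<in> ?B" using q by (auto simp: W_def)
    have "(f has_derivative \<alpha> c q) (at (cmap c q))" using f[OF qc(2)] cinv_cmap[OF cc qc(1)] by simp
    then have "((\<lambda>y. F (cinv c y)) has_derivative \<alpha> c q) (at (cmap c q))"
      by (rule has_derivative_transform_within_open[OF _ open_ball qc(2)]) (simp add: F_def mem(3))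
    then have "((\<lambda>x. F (cinv c' x)) has_derivative (\<lambda>u. \<alpha> c q (tmap c' c q u))) (at (cmap c' q))"
      by (rule t.compose_chart[OF c'(2) qc(1)])
    moreover have "q \<in> U" using q WU by blast
    then have "(\<lambda>u. \<alpha> c q (tmap c' c q u)) = \<alpha> c' q"
      using \<alpha>_form[OF c'(1) c(1) c'(2) qc(1)] by (intro ext) simp
    ultimately show ?thesis by simp
  qed
  ultimately have "potential W F" unfolding potential_def by blast
  moreover have "p \<in> W" using c r(1) by (simp add: W_def)
  ultimately show ?thesis by blast
qed

lemma potential_diff:
  assumes "potential W F" "potential W' F'" "p \<in> W \<inter> W'"
  shows "\<exists>N. openin (top_of_set U) N \<and> p \<in> N \<and> N \<subseteq> W \<inter> W' \<and> (\<forall>q\<in>N. F q - F' q = F p - F' p)"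
proof -
  have pU: "p \<in> U" using assms potential_subset by blast
  then have pM: "p \<in> Mbar" using U_subset by blast
  obtain c where c: "c \<in> A" "p \<in> cdom c" using ambient_chart[OF pM] by blast
  have cc: "coord_chart Mbar c" by (rule A_chart[OF c(1)])
  have op: "openin (top_of_set Mbar) (W \<inter> W')"
    using assms(1,2) openin_U unfolding potential_def by (meson openin_Int openin_trans)
  have "open (cmap c ` (cdom c \<inter> (W \<inter> W')))" by (rule open_cmap_image[OF cc op order_refl])
  moreover have "cmap c p \<in> cmap c ` (cdom c \<inter> (W \<inter> W'))" using c assms(3) by blast
  ultimately obtain r where r: "r > 0" "ball (cmap c p) r \<subseteq> cmap c ` (cdom c \<inter> (W \<inter> W'))" using openE by blast
  let ?B = "ball (cmap c p) r"
  define N where "N = cdom c \<inter> cmap c -` ?B"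
  have mem: "cinv c x \<in> cdom c" "cinv c x \<in> W \<inter> W'" "cmap c (cinv c x) = x" if x: "x \<in> ?B" for x
  proof -
    obtain q where "q \<in> cdom c" "q \<in> W \<inter> W'" "x = cmap c q" using x r(2) by blast
    then show "cinv c x \<in> cdom c" "cinv c x \<in> W \<inter> W'" "cmap c (cinv c x) = x" using cinv_cmap[OF cc] by auto
  qed
  have NW: "N \<subseteq> W \<inter> W'"
  proof
    fix q assume "q \<in> N"
    then show "q \<in> W \<inter> W'" using mem(2)[of "cmap c q"] cinv_cmap[OF cc, of q] by (auto simp: N_def)
  qed
  have "openin (top_of_set Mbar) N" unfolding N_def by (rule openin_chart_preimage[OF cc open_ball])
  then have "openin (top_of_set U) N"
    using NW potential_subset[OF assms(1)] U_subset by (intro openin_subset_trans[of Mbar N U]) auto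
  moreover have "p \<in> N" using c r(1) by (simp add: N_def)
  moreover have "F q - F' q = F p - F' p" if q: "q \<in> N" for q
  proof -
    have der: "((\<lambda>x. F (cinv c x) - F' (cinv c x)) has_derivative (\<lambda>u. 0)) (at x within ?B)" if x: "x \<in> ?B" for x
    proof -
      have "((\<lambda>x. F (cinv c x)) has_derivative \<alpha> c (cinv c x)) (at x)"
        using potential_has_derivative[OF assms(1) _ c(1) mem(1)[OF x]] mem(2,3)[OF x] by simp
      moreover have "((\<lambda>x. F' (cinv c x)) has_derivative \<alpha> c (cinv c x)) (at x)"
        using potential_has_derivative[OF assms(2) _ c(1) mem(1)[OF x]] mem(2,3)[OF x] by simp
      ultimately have "((\<lambda>x. F (cinv c x) - F' (cinv c x)) has_derivative (\<lambda>u. \<alpha> c (cinv c x) u - \<alpha> c (cinv c x) u)) (at x)"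
        by (rule has_derivative_diff)
      then show ?thesis by (simp add: has_derivative_at_withinI)
    qed
    have "\<exists>k. \<forall>x\<in>?B. F (cinv c x) - F' (cinv c x) = k"
      using has_derivative_zero_constant[OF convex_ball der] by blast
    then have "F (cinv c (cmap c q)) - F' (cinv c (cmap c q)) = F (cinv c (cmap c p)) - F' (cinv c (cmap c p))"
      using q r(1) by (auto simp: N_def)
    then show ?thesis using q c cinv_cmap[OF cc] by (auto simp: N_def)
  qed
  ultimately show ?thesis using NW by blast
qed

lemma \<omega>_eq:
  assumes d: "d \<in> D" and c: "c \<in> A" and p: "p \<in> cdom d" "p \<in> cdom c"
  shows "\<omega> d p u = \<alpha> c p (tmap d c p u)"
proof -
  have pM: "p \<in> Mbar" "p \<in> U" using D_dom[OF d p(1)] M_mem by auto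
  note c0 = ambient_chart[OF pM(1)]
  show ?thesis
    using \<alpha>_form[OF c c0(1) p(2) c0(2) pM(2)] tmap_DAA[OF d c c0(1) p c0(2)]
    by (simp add: rigged_form_def pullback_one_def Let_def)
qed

lemma h_eq:
  assumes d: "d \<in> D" and c: "c \<in> A" and p: "p \<in> cdom d" "p \<in> cdom c"
  shows "h d p u v = g c p (tmap d c p u) (tmap d c p v)"
proof -
  have pM: "p \<in> Mbar" using D_dom[OF d p(1)] M_mem by auto
  note c0 = ambient_chart[OF pM]
  show ?thesis
    using g_tensor[OF c c0(1) p(2) c0(2)] tmap_DAA[OF d c c0(1) p c0(2)]
    by (simp add: pullback_two_def Let_def)
qed

lemma gt_eq: "gt d p u v = h d p u v + \<omega> d p u * \<omega> d p v"
  by (simp add: rigged_metric_def rigged_form_def pullback_two_def pullback_one_def Let_def)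

lemma D_ambient_chart:
  assumes "d \<in> D" "p \<in> cdom d"
  obtains c where "c \<in> A" "p \<in> cdom c" "p \<in> U" "chart_at A p = c"
  using ambient_chart M_mem D_dom[OF assms] by metis

lemma h_tensor:
  assumes "d \<in> D" "d' \<in> D" and p: "p \<in> cdom d" "p \<in> cdom d'"
  shows "h d p u v = h d' p (tmap d d' p u) (tmap d d' p v)"
proof -
  obtain c where c: "c \<in> A" "p \<in> cdom c" using D_ambient_chart[OF assms(1) p(1)] by metis
  show ?thesis
    using h_eq[OF assms(1) c(1) p(1) c(2)] h_eq[OF assms(2) c(1) p(2) c(2)] tmap_DDA[OF assms(1,2) c(1) p c(2)]
    by simp
qed

lemma \<omega>_tensor:
  assumes "d \<in> D" "d' \<in> D" and p: "p \<in> cdom d" "p \<in> cdom d'"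
  shows "\<omega> d p u = \<omega> d' p (tmap d d' p u)"
proof -
  obtain c where c: "c \<in> A" "p \<in> cdom c" using D_ambient_chart[OF assms(1) p(1)] by metis
  show ?thesis
    using \<omega>_eq[OF assms(1) c(1) p(1) c(2)] \<omega>_eq[OF assms(2) c(1) p(2) c(2)] tmap_DDA[OF assms(1,2) c(1) p c(2)]
    by simp
qed

lemma linear_tmap_DA: "\<lbrakk>d \<in> D; c \<in> A; p \<in> cdom d; p \<in> cdom c\<rbrakk> \<Longrightarrow> linear (tmap d c p)"
  using chart_pair.linear_tmap[OF chart_pair_DA] by blast

lemma linear_tmap_DD: "\<lbrakk>d \<in> D; d' \<in> D; p \<in> cdom d; p \<in> cdom d'\<rbrakk> \<Longrightarrow> linear (tmap d d' p)"
  using chart_pair.linear_tmap[OF chart_pair_DD] by blast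

lemma h_bilinear:
  assumes "d \<in> D" "p \<in> cdom d"
  shows "bilinear (h d p)"
proof -
  obtain c where c: "c \<in> A" "p \<in> cdom c" using D_ambient_chart[OF assms] by metis
  have T: "linear (tmap d c p)" by (rule linear_tmap_DA[OF assms(1) c(1) assms(2) c(2)])
  have b: "bilinear (g c p)" by (rule g_bilinear[OF c])
  show ?thesis
    unfolding bilinear_def h_eq[OF assms(1) c(1) assms(2) c(2)]
    using linear_compose[OF T bilinear_linear(1)[OF b]] linear_compose[OF T bilinear_linear(2)[OF b]]
    by (simp add: o_def)
qed

lemma h_sym:
  assumes "d \<in> D" "p \<in> cdom d"
  shows "h d p u v = h d p v u"
proof -
  obtain c where c: "c \<in> A" "p \<in> cdom c" using D_ambient_chart[OF assms] by metis
  show ?thesis unfolding h_eq[OF assms(1) c(1) assms(2) c(2)] by (rule g_sym[OF c])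
qed

lemma \<omega>_linear:
  assumes "d \<in> D" "p \<in> cdom d"
  shows "linear (\<omega> d p)"
proof -
  obtain c where c: "c \<in> A" "p \<in> cdom c" using D_ambient_chart[OF assms] by metis
  have "linear (\<lambda>u. \<alpha> c p (tmap d c p u))"
    using linear_compose[OF linear_tmap_DA[OF assms(1) c(1) assms(2) c(2)] \<alpha>_linear[OF c]] by (simp add: o_def)
  moreover have "\<omega> d p = (\<lambda>u. \<alpha> c p (tmap d c p u))" using \<omega>_eq[OF assms(1) c(1) assms(2) c(2)] by blast
  ultimately show ?thesis by simp
qed

text \<open>The induced metric and the rigged form have no common kernel, since the tangent space and the
  rigging span the ambient tangent space.\<close>
lemma tangent_trivial:
  assumes "d \<in> D" "p \<in> cdom d" "\<And>u. h d p x u = 0" "\<omega> d p x = 0"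
  shows "x = 0"
proof -
  obtain c where c: "c \<in> A" "p \<in> cdom c" using D_ambient_chart[OF assms(1,2)] by metis
  have dim: "DIM('e) = DIM('f) + 1" using null unfolding null_hypersurface_def hypersurface_def by blast
  show ?thesis
    by (rule hyperplane_radical_trivial[OF linear_tmap_DA[OF assms(1) c(1) assms(2) c(2)]
        inj_tmap[OF assms(1) c(1) assms(2) c(2)] dim \<zeta>_transversal[OF assms(1) c(1) assms(2) c(2)]
        g_bilinear[OF c] g_sym[OF c] g_nondegenerate[OF c]])
      (use assms(3,4) h_eq[OF assms(1) c(1) assms(2) c(2)] \<omega>_eq[OF assms(1) c(1) assms(2) c(2)]
        in \<open>simp_all add: rigging_form_def\<close>)
qed

lemma h_degenerate: "d \<in> D \<Longrightarrow> p \<in> cdom d \<Longrightarrow> \<not> nondegenerate (h d p)"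
  using null unfolding null_hypersurface_def by blast

lemma gt_nondegenerate:
  assumes "d \<in> D" "p \<in> cdom d"
  shows "nondegenerate (gt d p)"
proof -
  have "gt d p = (\<lambda>u v. h d p u v + \<omega> d p u * \<omega> d p v)" by (intro ext gt_eq)
  then show ?thesis
    using rank_one_perturbation(2)[OF h_bilinear[OF assms] h_degenerate[OF assms] \<omega>_linear[OF assms]
        tangent_trivial[OF assms] h_sym[OF assms]] by simp
qed

lemma gt_bilinear:
  assumes "d \<in> D" "p \<in> cdom d"
  shows "bilinear (gt d p)"
  unfolding bilinear_def
proof (intro allI conjI)
  note l = bilinear_linear(1)[OF h_bilinear[OF assms]] bilinear_linear(2)[OF h_bilinear[OF assms]] \<omega>_linear[OF assms]
  show "linear (gt d p x)" "linear (\<lambda>x. gt d p x y)" for x y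
    by (rule linearI; simp add: gt_eq linear_add[OF l(1)] linear_add[OF l(2)] linear_add[OF l(3)]
        linear_cmul[OF l(1)] linear_cmul[OF l(2)] linear_cmul[OF l(3)] algebra_simps)+
qed

lemma gt_sym: "d \<in> D \<Longrightarrow> p \<in> cdom d \<Longrightarrow> gt d p u v = gt d p v u"
  by (simp add: gt_eq h_sym mult.commute)

lemma \<xi>_unique:
  assumes dp: "d \<in> D" "p \<in> cdom d" and x: "\<And>u. h d p x u = 0" "\<omega> d p x = 1"
  shows "x = \<xi> d p"
proof -
  have "\<exists>!x. \<forall>u. gt d p x u = \<omega> d p u"
    by (rule nondegenerate_represents[OF gt_bilinear[OF dp] gt_nondegenerate[OF dp] \<omega>_linear[OF dp]])
  moreover have "\<forall>u. gt d p x u = \<omega> d p u" by (simp add: gt_eq x)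
  ultimately show ?thesis unfolding rigged_field_def by (rule the1_equality[symmetric])
qed

lemma
  assumes dp: "d \<in> D" "p \<in> cdom d"
  shows h_\<xi>: "h d p (\<xi> d p) u = 0" and \<omega>_\<xi>: "\<omega> d p (\<xi> d p) = 1"
proof -
  obtain x where "\<forall>u. h d p x u = 0" "\<omega> d p x = 1"
    using rank_one_perturbation(1)[OF h_bilinear[OF dp] h_degenerate[OF dp] \<omega>_linear[OF dp]
        tangent_trivial[OF dp] h_sym[OF dp]] by blast
  moreover from this have "x = \<xi> d p" using \<xi>_unique[OF dp] by blast
  ultimately show "h d p (\<xi> d p) u = 0" "\<omega> d p (\<xi> d p) = 1" by auto
qed

text \<open>Every tangent vector is orthogonal to the image of \<open>\<xi>\<close>, which is null.\<close>
lemma h_nonneg: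
  assumes dp: "d \<in> D" "p \<in> cdom d"
  shows "h d p v v \<ge> 0"
proof -
  obtain c where c: "c \<in> A" "p \<in> cdom c" using D_ambient_chart[OF dp] by metis
  note he = h_eq[OF dp(1) c(1) dp(2) c(2)]
  have T: "linear (tmap d c p)" "inj (tmap d c p)"
    using linear_tmap_DA[OF dp(1) c(1) dp(2) c(2)] inj_tmap[OF dp(1) c(1) dp(2) c(2)] by auto
  have "\<xi> d p \<noteq> 0" using \<omega>_\<xi>[OF dp] linear_0[OF \<omega>_linear[OF dp]] by auto
  then have "tmap d c p (\<xi> d p) \<noteq> 0" using linear_injective_0[OF T(1)] T(2) by blast
  then have "0 \<le> g c p (tmap d c p v) (tmap d c p v)"
    by (rule null_orthogonal_nonneg[OF g_bilinear[OF c] g_sym[OF c] g_nondegenerate[OF c] g_index[OF c]])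
       (simp_all add: he[symmetric] h_\<xi>[OF dp])
  then show ?thesis by (simp add: he)
qed

section \<open>Christoffel symbols of the rigged metric\<close>

lemma g_differentiable:
  "c \<in> A \<Longrightarrow> p \<in> cdom c \<Longrightarrow> (\<lambda>y. g c (cinv c y) u v) differentiable (at (cmap c p))"
  using g_has_derivative unfolding differentiable_def by blast

lemma h_has_derivative:
  assumes dp: "d \<in> D" "p \<in> cdom d"
  shows "((\<lambda>x. h d (cinv d x) u v) has_derivative (\<lambda>a. metric_deriv h d p a u v)) (at (cmap d p))"
proof -
  obtain c where c: "c \<in> A" "p \<in> cdom c" using D_ambient_chart[OF dp] by metis
  note * = chart_pair.pullback_has_derivative[OF chart_pair_DA[OF dp(1) c(1)], of g h,
      OF g_bilinear[OF c(1)] g_sym[OF c(1)] g_differentiable[OF c(1)] h_eq[OF dp(1) c(1)] dp(2) c(2)]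
  have "(\<lambda>x. h d (cinv d x) u v) differentiable (at (cmap d p))"
    using * unfolding differentiable_def by blast
  then show ?thesis unfolding metric_deriv_def by (simp add: frechet_derivative_works)
qed

lemma h_differentiable:
  "d \<in> D \<Longrightarrow> p \<in> cdom d \<Longrightarrow> (\<lambda>y. h d (cinv d y) u v) differentiable (at (cmap d p))"
  using h_has_derivative unfolding differentiable_def by blast

lemma koszul_h_ambient:
  assumes dp: "d \<in> D" "p \<in> cdom d" and c: "c \<in> A" "p \<in> cdom c"
  shows "koszul h d p u v z = koszul g c p (tmap d c p u) (tmap d c p v) (tmap d c p z)
     + g c p (hess_trans d c p u v) (tmap d c p z)"
  by (rule chart_pair.koszul_pullback[OF chart_pair_DA[OF dp(1) c(1)], of g h,
      OF g_bilinear[OF c(1)] g_sym[OF c(1)] g_differentiable[OF c(1)] h_eq[OF dp(1) c(1)] dp(2) c(2)])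

lemma koszul_h_tensor:
  assumes dp: "d \<in> D" "p \<in> cdom d" and d': "d' \<in> D" "p \<in> cdom d'"
  shows "koszul h d p u v z = koszul h d' p (tmap d d' p u) (tmap d d' p v) (tmap d d' p z)
     + h d' p (hess_trans d d' p u v) (tmap d d' p z)"
  by (rule chart_pair.koszul_pullback[OF chart_pair_DD[OF dp(1) d'(1)], of h h,
      OF h_bilinear[OF d'(1)] h_sym[OF d'(1)] h_differentiable[OF d'(1)] h_tensor[OF dp(1) d'(1)] dp(2) d'(2)])

text \<open>The coordinate derivative of \<open>\<omega>\<close> in direction \<open>u\<close>, evaluated at \<open>v\<close>; it is symmetric because
  \<open>\<omega>\<close> is the pullback of a closed form.\<close>
definition d\<omega> :: "('m, 'f) chart \<Rightarrow> 'm \<Rightarrow> 'f \<Rightarrow> 'f \<Rightarrow> real" where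
  "d\<omega> d p u v = frechet_derivative (\<lambda>x. \<omega> d (cinv d x) v) (at (cmap d p)) u"

lemma \<omega>_has_derivative_explicit:
  assumes dp: "d \<in> D" "p \<in> cdom d" and c: "c \<in> A" "p \<in> cdom c"
  shows "((\<lambda>x. \<omega> d (cinv d x) v) has_derivative
    (\<lambda>u. d\<alpha> c p (tmap d c p u) (tmap d c p v) + \<alpha> c p (hess_trans d c p u v))) (at (cmap d p))"
proof -
  interpret t: chart_pair M Mbar d c by (rule chart_pair_DA[OF dp(1) c(1)])
  have pU: "p \<in> U" using D_dom[OF dp] M_mem by blast
  have cx: "cinv d (cmap d p) = p" by (rule cinv_cmap[OF D_chart[OF dp(1)] dp(2)])
  have lin: "linear (\<alpha> c (cinv d x))" if "x \<in> t.overlap" for x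
    using t.overlap_cases[OF that] \<alpha>_linear[OF c(1)] by metis
  have "((\<lambda>x. \<alpha> c (cinv d x) (tmap d c (cinv d x) v)) has_derivative
    (\<lambda>u. d\<alpha> c p (tmap d c p u) (tmap d c p v) + \<alpha> c p (hess_trans d c p u v))) (at (cmap d p))"
    using has_derivative_linear_field[OF t.open_overlap t.overlap_mem[OF dp(2) c(2)], where L="\<lambda>x. \<alpha> c (cinv d x)",
        OF lin t.compose_chart[OF dp(2) c(2), where F="\<lambda>q. \<alpha> c q b" for b, OF \<alpha>_has_derivative[OF c pU]]
           t.tmap_has_derivative[OF dp(2) c(2), of v]]
    by (simp add: cx)
  then show ?thesis
  proof (rule has_derivative_transform_within_open[OF _ t.open_overlap t.overlap_mem[OF dp(2) c(2)]])
    fix x assume "x \<in> t.overlap"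
    then obtain q where "q \<in> cdom d" "q \<in> cdom c" "cinv d x = q" by (rule t.overlap_cases)
    then show "\<alpha> c (cinv d x) (tmap d c (cinv d x) v) = \<omega> d (cinv d x) v"
      using \<omega>_eq[OF dp(1) c(1)] by simp
  qed
qed

lemma \<omega>_has_derivative:
  assumes dp: "d \<in> D" "p \<in> cdom d"
  shows "((\<lambda>x. \<omega> d (cinv d x) v) has_derivative (\<lambda>u. d\<omega> d p u v)) (at (cmap d p))"
proof -
  obtain c where c: "c \<in> A" "p \<in> cdom c" using D_ambient_chart[OF dp] by metis
  note * = \<omega>_has_derivative_explicit[OF dp c]
  show ?thesis unfolding d\<omega>_def frechet_derivative_at[OF *, symmetric] by (rule *)
qed

lemma d\<omega>_sym:
  assumes dp: "d \<in> D" "p \<in> cdom d"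
  shows "d\<omega> d p u v = d\<omega> d p v u"
proof -
  obtain c where c: "c \<in> A" "p \<in> cdom c" using D_ambient_chart[OF dp] by metis
  have pU: "p \<in> U" using D_dom[OF dp] M_mem by blast
  show ?thesis
    unfolding d\<omega>_def frechet_derivative_at[OF \<omega>_has_derivative_explicit[OF dp c], symmetric]
    using d\<alpha>_sym[OF c pU] chart_pair.hess_trans_sym[OF chart_pair_DA[OF dp(1) c(1)] dp(2) c(2)] by simp
qed

lemma gt_has_derivative_explicit:
  assumes dp: "d \<in> D" "p \<in> cdom d"
  shows "((\<lambda>x. gt d (cinv d x) u v) has_derivative
    (\<lambda>a. metric_deriv h d p a u v + (\<omega> d p u * d\<omega> d p a v + d\<omega> d p a u * \<omega> d p v))) (at (cmap d p))"
proof -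
  have cx: "cinv d (cmap d p) = p" by (rule cinv_cmap[OF D_chart[OF dp(1)] dp(2)])
  show ?thesis
    unfolding gt_eq
    using has_derivative_add[OF h_has_derivative[OF dp] has_derivative_mult[OF \<omega>_has_derivative[OF dp] \<omega>_has_derivative[OF dp]]]
    by (simp add: cx)
qed

lemma metric_deriv_gt:
  assumes dp: "d \<in> D" "p \<in> cdom d"
  shows "metric_deriv gt d p a u v = metric_deriv h d p a u v + (\<omega> d p u * d\<omega> d p a v + d\<omega> d p a u * \<omega> d p v)"
  unfolding metric_deriv_def[of gt] frechet_derivative_at[OF gt_has_derivative_explicit[OF dp], symmetric] ..

lemma gt_has_derivative:
  assumes dp: "d \<in> D" "p \<in> cdom d"
  shows "((\<lambda>x. gt d (cinv d x) u v) has_derivative (\<lambda>a. metric_deriv gt d p a u v)) (at (cmap d p))"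
  unfolding metric_deriv_gt[OF dp] by (rule gt_has_derivative_explicit[OF dp])

lemma koszul_gt:
  assumes dp: "d \<in> D" "p \<in> cdom d"
  shows "koszul gt d p u v z = koszul h d p u v z + d\<omega> d p u v * \<omega> d p z"
  unfolding koszul_def metric_deriv_gt[OF dp]
  using d\<omega>_sym[OF dp, of v u] d\<omega>_sym[OF dp, of z u] d\<omega>_sym[OF dp, of z v]
  by (simp add: field_simps)

lemma christoffel_gt:
  assumes dp: "d \<in> D" "p \<in> cdom d"
  shows "gt d p (christoffel gt d p u v) z = koszul gt d p u v z"
  by (rule christoffel_koszul[of M d p gt, OF D_chart[OF dp(1)] dp(2) gt_bilinear[OF dp(1)] gt_has_derivative[OF dp] gt_nondegenerate[OF dp]])

section \<open>The null second fundamental form\<close>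

lemma B_eq_koszul:
  assumes dp: "d \<in> D" "p \<in> cdom d"
  shows "B d p u v = koszul h d p u v (\<xi> d p)"
proof -
  obtain c where c: "c \<in> A" "p \<in> cdom c" "chart_at A p = c" using D_ambient_chart[OF dp] by metis
  have "g c p (christoffel g c p (tmap d c p u) (tmap d c p v)) z = koszul g c p (tmap d c p u) (tmap d c p v) z" for z
    by (rule christoffel_koszul[OF A_chart[OF c(1)] c(2) g_bilinear[OF c(1)] g_has_derivative[OF c(1,2)] g_nondegenerate[OF c(1,2)]])
  then show ?thesis
    unfolding null_second_form_def ambient_deriv_def c(3) Let_def koszul_h_ambient[OF dp c(1,2)]
      hess_trans_def[symmetric]
    by (simp add: bilinear_ladd[OF g_bilinear[OF c(1,2)]])
qed

text \<open>The rigged component of the Christoffel symbol is obtained by pairing with \<open>\<xi>\<close>, which the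
  rigged metric identifies with \<open>\<omega>\<close>.\<close>
lemma \<omega>_christoffel_gt:
  assumes dp: "d \<in> D" "p \<in> cdom d"
  shows "\<omega> d p (christoffel gt d p v v) = B d p v v + d\<omega> d p v v"
proof -
  let ?w = "christoffel gt d p v v"
  have "\<omega> d p ?w = gt d p ?w (\<xi> d p)"
    using h_\<xi>[OF dp, of ?w] h_sym[OF dp, of ?w "\<xi> d p"] \<omega>_\<xi>[OF dp] by (simp add: gt_eq)
  also have "\<dots> = koszul h d p v v (\<xi> d p) + d\<omega> d p v v * \<omega> d p (\<xi> d p)"
    by (simp only: christoffel_gt[OF dp] koszul_gt[OF dp])
  finally show ?thesis by (simp add: B_eq_koszul[OF dp] \<omega>_\<xi>[OF dp])
qed

lemma koszul_h_linear:
  assumes dp: "d \<in> D" "p \<in> cdom d"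
  shows "linear (\<lambda>u. koszul h d p u v z)" "linear (\<lambda>v. koszul h d p u v z)" "linear (\<lambda>z. koszul h d p u v z)"
  using koszul_linear[of M d p h, OF D_chart[OF dp(1)] dp(2) h_bilinear[OF dp(1)] h_has_derivative[OF dp]] by blast+

lemma B_sym: "d \<in> D \<Longrightarrow> p \<in> cdom d \<Longrightarrow> B d p u v = B d p v u"
  using koszul_commute[of M d p h, OF D_chart _ h_sym h_has_derivative] by (simp add: B_eq_koszul)

lemma B_bilinear:
  assumes dp: "d \<in> D" "p \<in> cdom d"
  shows "bilinear (B d p)"
proof -
  have "B d p = (\<lambda>u v. koszul h d p u v (\<xi> d p))" by (intro ext B_eq_koszul[OF dp])
  then show ?thesis using koszul_h_linear[OF dp] by (simp add: bilinear_def)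
qed

text \<open>The vector \<open>\<xi>\<close> at \<open>p\<close> is extended by constant components. The function \<open>h(\<xi>, \<xi>)\<close> is
  nonnegative and vanishes at \<open>p\<close>, so its differential vanishes there; half of that differential is
  \<open>B(\<cdot>, \<xi>)\<close>.\<close>
lemma B_\<xi>:
  assumes dp: "d \<in> D" "p \<in> cdom d"
  shows "B d p v (\<xi> d p) = 0"
proof -
  have c: "coord_chart M d" by (rule D_chart[OF dp(1)])
  let ?x = "\<xi> d p"
  have nn: "h d (cinv d y) ?x ?x \<ge> 0" if "y \<in> cmap d ` cdom d" for y
    using that cinv_cmap[OF c] h_nonneg[OF dp(1)] by auto
  have "h d (cinv d (cmap d p)) ?x ?x = 0" using cinv_cmap[OF c dp(2)] h_\<xi>[OF dp] by simp
  then have "(\<lambda>a. metric_deriv h d p a ?x ?x) = (\<lambda>a. 0)"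
    using c dp(2) nn by (intro differential_zero_maxmin[OF _ _ h_has_derivative[OF dp], of "cmap d ` cdom d"])
      (auto simp: coord_chart_def)
  then have "metric_deriv h d p a ?x ?x = 0" for a by meson
  then show ?thesis by (simp add: B_eq_koszul[OF dp] koszul_def)
qed

lemma B_screen_part:
  assumes dp: "d \<in> D" "p \<in> cdom d"
  shows "B d p v v = B d p (v - \<omega> d p v *\<^sub>R \<xi> d p) (v - \<omega> d p v *\<^sub>R \<xi> d p)"
    and "v - \<omega> d p v *\<^sub>R \<xi> d p \<in> screen A g \<zeta> d p"
proof -
  note b = B_bilinear[OF dp]
  show "B d p v v = B d p (v - \<omega> d p v *\<^sub>R \<xi> d p) (v - \<omega> d p v *\<^sub>R \<xi> d p)"
    using B_\<xi>[OF dp] B_sym[OF dp, of "\<xi> d p"]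
    by (simp add: bilinear_lsub[OF b] bilinear_rsub[OF b] bilinear_lmul[OF b] bilinear_rmul[OF b])
  show "v - \<omega> d p v *\<^sub>R \<xi> d p \<in> screen A g \<zeta> d p"
    by (simp add: screen_def linear_diff[OF \<omega>_linear[OF dp]] linear_cmul[OF \<omega>_linear[OF dp]] \<omega>_\<xi>[OF dp])
qed

lemma B_tensor:
  assumes dp: "d \<in> D" "p \<in> cdom d" and d': "d' \<in> D" "p \<in> cdom d'"
  shows "B d p u v = B d' p (tmap d d' p u) (tmap d d' p v)"
proof -
  obtain c where c: "c \<in> A" "p \<in> cdom c" using D_ambient_chart[OF dp] by metis
  let ?S = "tmap d d' p"
  have lin: "linear ?S" by (rule linear_tmap_DD[OF dp(1) d'(1) dp(2) d'(2)])
  have "inj ?S"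
    using inj_tmap[OF dp(1) c(1) dp(2) c(2)] tmap_DDA[OF dp(1) d'(1) c(1) dp(2) d'(2) c(2)]
    by (metis injD injI)
  then have surj: "surj ?S" using linear_injective_imp_surjective[OF lin] by simp
  have "?S (\<xi> d p) = \<xi> d' p"
  proof (rule \<xi>_unique[OF d'])
    show "h d' p (?S (\<xi> d p)) u = 0" for u
    proof -
      obtain w where "u = ?S w" using surj by (metis surjD)
      then show ?thesis using h_tensor[OF dp(1) d'(1) dp(2) d'(2), of "\<xi> d p" w] h_\<xi>[OF dp] by simp
    qed
    show "\<omega> d' p (?S (\<xi> d p)) = 1"
      using \<omega>_tensor[OF dp(1) d'(1) dp(2) d'(2), of "\<xi> d p"] \<omega>_\<xi>[OF dp] by simp
  qed
  then show ?thesis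
    using koszul_h_tensor[OF dp d', of u v "\<xi> d p"] h_\<xi>[OF d'] h_sym[OF d']
    by (simp add: B_eq_koszul[OF dp] B_eq_koszul[OF d'])
qed

section \<open>Continuity of the null second fundamental form\<close>

lemma eventually_chart:
  assumes d: "d \<in> D" and p: "p \<in> cdom d" and c: "c \<in> A" "p \<in> cdom c"
  shows "\<forall>\<^sub>F x in at (cmap d p). cinv d x \<in> cdom d \<and> cinv d x \<in> cdom c"
proof -
  have "\<forall>\<^sub>F x in nhds (cmap d p). cinv d x \<in> cdom d \<and> cinv d x \<in> cdom c \<and> cmap d (cinv d x) = x"
    by (rule chart_pair.eventually_overlap[OF chart_pair_DA[OF d c(1)] p c(2)])
  then show ?thesis unfolding eventually_at_filter by eventually_elim auto
qed

lemma isCont_metric_deriv_g: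
  assumes c: "c \<in> A" "p \<in> cdom c"
  shows "isCont (\<lambda>y. metric_deriv g c (cinv c y) a u v) (cmap c p)"
proof -
  have cc: "coord_chart Mbar c" by (rule A_chart[OF c(1)])
  have "continuous_on (cmap c ` cdom c) (\<lambda>x. frechet_derivative (\<lambda>x. g c (cinv c x) u v) (at x) a)"
    by (rule smooth_on_imp_continuous_on[OF smooth_on_frechet_derivative[OF g_smooth[OF c(1)]]])
  then have "continuous_on (cmap c ` cdom c) (\<lambda>y. metric_deriv g c (cinv c y) a u v)"
    by (rule continuous_on_eq) (simp add: metric_deriv_def cmap_cinv[OF cc])
  then show ?thesis using cc c(2) continuous_on_eq_continuous_at unfolding coord_chart_def by blast
qed

text \<open>Continuity is read off from the pullback formula, whose terms are multilinear expressions with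
  continuous coefficients in continuous arguments.\<close>
lemma isCont_koszul_h:
  assumes d: "d \<in> D" and p: "p \<in> cdom d"
  shows "isCont (\<lambda>x. koszul h d (cinv d x) u v z) (cmap d p)"
proof -
  obtain c where c: "c \<in> A" "p \<in> cdom c" using D_ambient_chart[OF d p] by metis
  interpret t: chart_pair M Mbar d c by (rule chart_pair_DA[OF d c(1)])
  let ?G = "at (cmap d p)"
  have cx: "cinv d (cmap d p) = p" by (rule cinv_cmap[OF D_chart[OF d] p])
  note ev = eventually_chart[OF d p c]
  have T: "((\<lambda>x. tmap d c (cinv d x) w) \<longlongrightarrow> tmap d c p w) ?G" for w
    using t.isCont_tmap[OF p c(2), of w] by (simp add: isCont_def cx)
  have H: "((\<lambda>x. hess_trans d c (cinv d x) u v) \<longlongrightarrow> hess_trans d c p u v) ?G"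
    using t.isCont_hess_trans[OF p c(2)] by (simp add: isCont_def cx)
  have kl: "linear (\<lambda>a. koszul g c q a b e)" "linear (\<lambda>b. koszul g c q a b e)" "linear (\<lambda>e. koszul g c q a b e)"
    if "q \<in> cdom c" for q a b e
    using koszul_linear[OF A_chart[OF c(1)] that g_bilinear[OF c(1)] g_has_derivative[OF c(1) that]] by blast+
  have K0: "((\<lambda>x. koszul g c (cinv d x) a b e) \<longlongrightarrow> koszul g c p a b e) ?G" for a b e
  proof -
    have "isCont (\<lambda>y. koszul g c (cinv c y) a b e) (cmap c p)"
      unfolding koszul_def by (intro continuous_intros isCont_metric_deriv_g[OF c]) simp
    from t.isCont_compose_chart[OF p c(2), of "\<lambda>q. koszul g c q a b e", OF this] show ?thesis
      by (simp add: isCont_def cx)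
  qed
  have K1: "((\<lambda>x. koszul g c (cinv d x) a b (tmap d c (cinv d x) z)) \<longlongrightarrow> koszul g c p a b (tmap d c p z)) ?G" for a b
    by (rule tendsto_linear_field[where L="\<lambda>x e. koszul g c (cinv d x) a b e", OF _ kl(3)[OF c(2)] K0 T])
       (use ev in \<open>eventually_elim, simp add: kl\<close>)
  have K2: "((\<lambda>x. koszul g c (cinv d x) a (tmap d c (cinv d x) v) (tmap d c (cinv d x) z))
      \<longlongrightarrow> koszul g c p a (tmap d c p v) (tmap d c p z)) ?G" for a
    by (rule tendsto_linear_field[where L="\<lambda>x b. koszul g c (cinv d x) a b (tmap d c (cinv d x) z)", OF _ kl(2)[OF c(2)] K1 T])
       (use ev in \<open>eventually_elim, simp add: kl\<close>)
  have K3: "((\<lambda>x. koszul g c (cinv d x) (tmap d c (cinv d x) u) (tmap d c (cinv d x) v) (tmap d c (cinv d x) z))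
      \<longlongrightarrow> koszul g c p (tmap d c p u) (tmap d c p v) (tmap d c p z)) ?G"
    by (rule tendsto_linear_field[where L="\<lambda>x a. koszul g c (cinv d x) a (tmap d c (cinv d x) v) (tmap d c (cinv d x) z)",
          OF _ kl(1)[OF c(2)] K2 T])
       (use ev in \<open>eventually_elim, simp add: kl\<close>)
  have g0: "((\<lambda>x. g c (cinv d x) a b) \<longlongrightarrow> g c p a b) ?G" for a b
    using has_derivative_continuous[OF t.compose_chart[OF p c(2), of "\<lambda>q. g c q a b", OF g_has_derivative[OF c]]]
    by (simp add: isCont_def cx)
  have g1: "((\<lambda>x. g c (cinv d x) a (tmap d c (cinv d x) z)) \<longlongrightarrow> g c p a (tmap d c p z)) ?G" for a
    by (rule tendsto_linear_field[where L="\<lambda>x. g c (cinv d x) a", OF _ bilinear_linear(1)[OF g_bilinear[OF c]] g0 T])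
       (use ev in \<open>eventually_elim, simp add: bilinear_linear(1)[OF g_bilinear[OF c(1)]]\<close>)
  have g2: "((\<lambda>x. g c (cinv d x) (hess_trans d c (cinv d x) u v) (tmap d c (cinv d x) z))
      \<longlongrightarrow> g c p (hess_trans d c p u v) (tmap d c p z)) ?G"
    by (rule tendsto_linear_field[where L="\<lambda>x a. g c (cinv d x) a (tmap d c (cinv d x) z)",
          OF _ bilinear_linear(2)[OF g_bilinear[OF c]] g1 H])
       (use ev in \<open>eventually_elim, simp add: bilinear_linear(2)[OF g_bilinear[OF c(1)]]\<close>)
  have "((\<lambda>x. koszul h d (cinv d x) u v z) \<longlongrightarrow> koszul h d p u v z) ?G"
    unfolding koszul_h_ambient[OF d p c]
    by (rule Lim_transform_eventually[OF tendsto_add[OF K3 g2]])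
       (use ev in \<open>eventually_elim, simp add: koszul_h_ambient[OF d _ c(1)]\<close>)
  then show ?thesis by (simp add: isCont_def cx)
qed

text \<open>The field \<open>\<xi>\<close> is defined pointwise as the solution of a linear system with continuous
  coefficients.\<close>
lemma tendsto_\<xi>:
  assumes d: "d \<in> D" and p: "p \<in> cdom d"
  shows "((\<lambda>x. \<xi> d (cinv d x)) \<longlongrightarrow> \<xi> d p) (at (cmap d p))"
proof -
  obtain c where c: "c \<in> A" "p \<in> cdom c" using D_ambient_chart[OF d p] by metis
  note ev = eventually_chart[OF d p c]
  have cx: "cinv d (cmap d p) = p" by (rule cinv_cmap[OF D_chart[OF d] p])
  have rep: "gt d q (\<xi> d q) u = \<omega> d q u" if "q \<in> cdom d" for q u
    by (simp add: gt_eq h_\<xi>[OF d that] \<omega>_\<xi>[OF d that])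
  show ?thesis
  proof (rule tendsto_represented[where Q="\<lambda>x. gt d (cinv d x)" and L="\<lambda>x. \<omega> d (cinv d x)",
        OF _ gt_bilinear[OF d p] gt_nondegenerate[OF d p] gt_sym[OF d p] _ _ _ rep[OF p]])
    show "\<forall>\<^sub>F x in at (cmap d p). bilinear (gt d (cinv d x))"
      using ev by eventually_elim (simp add: gt_bilinear[OF d])
    show "((\<lambda>x. gt d (cinv d x) u v) \<longlongrightarrow> gt d p u v) (at (cmap d p))" for u v
      using has_derivative_continuous[OF gt_has_derivative[OF d p, of u v]] by (simp add: isCont_def cx)
    show "((\<lambda>x. \<omega> d (cinv d x) u) \<longlongrightarrow> \<omega> d p u) (at (cmap d p))" for u
      using has_derivative_continuous[OF \<omega>_has_derivative[OF d p, of u]] by (simp add: isCont_def cx)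
    show "\<forall>\<^sub>F x in at (cmap d p). \<forall>u. gt d (cinv d x) (\<xi> d (cinv d x)) u = \<omega> d (cinv d x) u"
      using ev by eventually_elim (simp add: rep)
  qed
qed

lemma isCont_B:
  assumes d: "d \<in> D" and p: "p \<in> cdom d"
  shows "isCont (\<lambda>x. B d (cinv d x) u v) (cmap d p)"
proof -
  obtain c where c: "c \<in> A" "p \<in> cdom c" using D_ambient_chart[OF d p] by metis
  note ev = eventually_chart[OF d p c]
  have cx: "cinv d (cmap d p) = p" by (rule cinv_cmap[OF D_chart[OF d] p])
  have k: "((\<lambda>x. koszul h d (cinv d x) u v z) \<longlongrightarrow> koszul h d p u v z) (at (cmap d p))" for z
    using isCont_koszul_h[OF d p, of u v z] by (simp add: isCont_def cx)
  have "((\<lambda>x. koszul h d (cinv d x) u v (\<xi> d (cinv d x))) \<longlongrightarrow> koszul h d p u v (\<xi> d p)) (at (cmap d p))"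
    by (rule tendsto_linear_field[where L="\<lambda>x z. koszul h d (cinv d x) u v z", OF _ koszul_h_linear(3)[OF d p] k tendsto_\<xi>[OF d p]])
       (use ev in \<open>eventually_elim, simp add: koszul_h_linear(3)[OF d]\<close>)
  then have "((\<lambda>x. B d (cinv d x) u v) \<longlongrightarrow> koszul h d p u v (\<xi> d p)) (at (cmap d p))"
    by (rule Lim_transform_eventually) (use ev in \<open>eventually_elim, simp add: B_eq_koszul[OF d]\<close>)
  then show ?thesis by (simp add: isCont_def cx B_eq_koszul[OF d p])
qed

section \<open>Curves in the hypersurface\<close>

lemma open_curve_domain:
  fixes \<gamma> :: "real \<Rightarrow> 'm"
  assumes "continuous_on UNIV \<gamma>" "range \<gamma> \<subseteq> M" "d \<in> D"
  shows "open {t. \<gamma> t \<in> cdom d}"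
proof -
  have "openin (top_of_set UNIV) (UNIV \<inter> \<gamma> -` cdom d)"
    by (rule continuous_openin_preimage[of UNIV \<gamma> M]) (use assms D_chart in \<open>auto simp: coord_chart_def\<close>)
  then show ?thesis by (simp add: vimage_def)
qed

lemma isCont_curve_coordinates:
  fixes \<gamma> :: "real \<Rightarrow> 'm"
  assumes \<gamma>: "continuous_on UNIV \<gamma>" "range \<gamma> \<subseteq> M" and d: "d \<in> D" "\<gamma> t \<in> cdom d"
  shows "isCont (\<lambda>s. cmap d (\<gamma> s)) t"
proof -
  let ?J = "{s. \<gamma> s \<in> cdom d}"
  have "continuous_on (cdom d) (cmap d)"
    using D_chart[OF d(1)] unfolding coord_chart_def homeomorphism_def by blast
  moreover have "continuous_on ?J \<gamma>" using \<gamma>(1) continuous_on_subset by blast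
  ultimately have "continuous_on ?J (\<lambda>s. cmap d (\<gamma> s))"
    by (rule continuous_on_compose2) auto
  then show ?thesis using open_curve_domain[OF \<gamma> d(1)] d(2) continuous_on_eq_continuous_at by blast
qed

lemma potential_along_curve:
  fixes \<gamma> :: "real \<Rightarrow> 'm"
  assumes \<gamma>: "continuous_on UNIV \<gamma>" "range \<gamma> \<subseteq> M" and F: "potential W F" "\<gamma> t \<in> W"
    and d: "d \<in> D" "\<gamma> t \<in> cdom d" and w: "((\<lambda>s. cmap d (\<gamma> s)) has_vector_derivative w) (at t)"
  shows "((\<lambda>s. F (\<gamma> s)) has_real_derivative \<omega> d (\<gamma> t) w) (at t)"
proof -
  let ?p = "\<gamma> t"
  obtain c where c: "c \<in> A" "?p \<in> cdom c" using D_ambient_chart[OF d] by metis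
  have "((\<lambda>x. F (cinv d x)) has_derivative (\<lambda>u. \<alpha> c ?p (tmap d c ?p u))) (at (cmap d ?p))"
    by (rule chart_pair.compose_chart[OF chart_pair_DA[OF d(1) c(1)] d(2) c(2) potential_has_derivative[OF F c]])
  then have "((\<lambda>x. F (cinv d x)) has_derivative \<omega> d ?p) (at (cmap d ?p))"
    unfolding \<omega>_eq[OF d(1) c(1) d(2) c(2), symmetric] .
  with w[unfolded has_vector_derivative_def]
  have "((\<lambda>s. F (cinv d (cmap d (\<gamma> s)))) has_derivative (\<lambda>h. \<omega> d ?p (h *\<^sub>R w))) (at t)"
    by (rule has_derivative_compose)
  then have "((\<lambda>s. F (\<gamma> s)) has_derivative (\<lambda>h. \<omega> d ?p (h *\<^sub>R w))) (at t)"
    by (rule has_derivative_transform_within_open[OF _ open_curve_domain[OF \<gamma> d(1)]])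
       (use d cinv_cmap[OF D_chart[OF d(1)]] in auto)
  moreover have "(\<lambda>h. \<omega> d ?p (h *\<^sub>R w)) = (*) (\<omega> d ?p w)"
    by (simp add: linear_cmul[OF \<omega>_linear[OF d]] fun_eq_iff)
  ultimately show ?thesis by (simp only: has_field_derivative_def)
qed

lemma geodesic_velocity:
  assumes "geodesic_on M D gt UNIV \<gamma>" "d \<in> D" "\<gamma> t \<in> cdom d"
  obtains v where "\<forall>\<^sub>F s in nhds t. ((\<lambda>r. cmap d (\<gamma> r)) has_vector_derivative v s) (at s) \<and>
       (v has_vector_derivative - christoffel gt d (\<gamma> s) (v s) (v s)) (at s)"
  using assms unfolding geodesic_on_def by blast

text \<open>Along a geodesic of the rigged metric the rigged component of the velocity changes at the rate
  given by \<open>- B\<close> on the velocity. The function \<open>f\<close> is a parameter because it will be defined without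
  charts, as the derivative of local potentials along \<open>\<gamma>\<close>.\<close>

lemma rigged_component_derivative:
  fixes \<gamma> :: "real \<Rightarrow> 'm"
  assumes geo: "geodesic_on M D gt UNIV \<gamma>" and d: "d \<in> D" "\<gamma> t \<in> cdom d"
    and f: "\<And>s w. \<lbrakk>\<gamma> s \<in> cdom d; ((\<lambda>r. cmap d (\<gamma> r)) has_vector_derivative w) (at s)\<rbrakk> \<Longrightarrow> f s = \<omega> d (\<gamma> s) w"
  shows "\<exists>w. ((\<lambda>r. cmap d (\<gamma> r)) has_vector_derivative w) (at t) \<and> f t = \<omega> d (\<gamma> t) w \<and>
     (f has_real_derivative - B d (\<gamma> t) w w) (at t)"
proof -
  have \<gamma>: "continuous_on UNIV \<gamma>" "range \<gamma> \<subseteq> M" using geo unfolding geodesic_on_def by auto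
  obtain v where ev: "\<forall>\<^sub>F s in nhds t. ((\<lambda>r. cmap d (\<gamma> r)) has_vector_derivative v s) (at s) \<and>
       (v has_vector_derivative - christoffel gt d (\<gamma> s) (v s) (v s)) (at s)"
    by (rule geodesic_velocity[OF geo d])
  let ?p = "\<gamma> t" and ?J = "{s. \<gamma> s \<in> cdom d}" and ?\<Gamma> = "christoffel gt d (\<gamma> t) (v t) (v t)"
  have J: "open ?J" "t \<in> ?J" using open_curve_domain[OF \<gamma> d(1)] d(2) by auto
  have xv: "((\<lambda>r. cmap d (\<gamma> r)) has_vector_derivative v t) (at t)"
    and vv: "(v has_vector_derivative - ?\<Gamma>) (at t)"
    using eventually_nhds_x_imp_x[OF ev] by auto
  have L: "((\<lambda>s. \<omega> d (\<gamma> s) b) has_derivative (\<lambda>a. d\<omega> d ?p (a *\<^sub>R v t) b)) (at t)" for b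
  proof -
    have "((\<lambda>s. \<omega> d (cinv d (cmap d (\<gamma> s))) b) has_derivative (\<lambda>a. d\<omega> d ?p (a *\<^sub>R v t) b)) (at t)"
      using xv[unfolded has_vector_derivative_def] \<omega>_has_derivative[OF d] by (rule has_derivative_compose)
    then show ?thesis
      by (rule has_derivative_transform_within_open[OF _ J]) (use cinv_cmap[OF D_chart[OF d(1)]] in auto)
  qed
  have lin: "linear (\<omega> d (\<gamma> s))" if "s \<in> ?J" for s using \<omega>_linear[OF d(1)] that by blast
  have "((\<lambda>s. \<omega> d (\<gamma> s) (v s)) has_derivative (\<lambda>a. d\<omega> d ?p (a *\<^sub>R v t) (v t) + \<omega> d ?p (a *\<^sub>R - ?\<Gamma>))) (at t)"
    by (rule has_derivative_linear_field[OF J, where L="\<lambda>s. \<omega> d (\<gamma> s)", OF lin L vv[unfolded has_vector_derivative_def]])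
  moreover have "(\<lambda>a. d\<omega> d ?p (a *\<^sub>R v t) (v t) + \<omega> d ?p (a *\<^sub>R - ?\<Gamma>)) = (*) (- B d ?p (v t) (v t))"
  proof
    fix a
    have "linear (\<lambda>u. d\<omega> d ?p u (v t))" using \<omega>_has_derivative[OF d] by (rule has_derivative_linear)
    from linear_cmul[OF this, of a "v t"]
    have "d\<omega> d ?p (a *\<^sub>R v t) (v t) = a * d\<omega> d ?p (v t) (v t)" by simp
    moreover have "\<omega> d ?p (a *\<^sub>R - ?\<Gamma>) = - (a * \<omega> d ?p ?\<Gamma>)"
      by (simp add: linear_cmul[OF \<omega>_linear[OF d]] linear_neg[OF \<omega>_linear[OF d]])
    ultimately show "d\<omega> d ?p (a *\<^sub>R v t) (v t) + \<omega> d ?p (a *\<^sub>R - ?\<Gamma>) = - B d ?p (v t) (v t) * a"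
      using \<omega>_christoffel_gt[OF d, of "v t"] by (simp add: algebra_simps)
  qed
  ultimately have der: "((\<lambda>s. \<omega> d (\<gamma> s) (v s)) has_real_derivative - B d ?p (v t) (v t)) (at t)"
    by (simp only: has_field_derivative_def)
  have "\<forall>\<^sub>F s in nhds t. s \<in> ?J" using J by (rule eventually_nhds_in_open)
  with ev have fe: "\<forall>\<^sub>F s in nhds t. f s = \<omega> d (\<gamma> s) (v s)"
  proof eventually_elim
    case (elim s)
    then show ?case using f[of s "v s"] by simp
  qed
  then have "(f has_real_derivative - B d ?p (v t) (v t)) (at t)"
    using der DERIV_cong_ev[OF refl fe refl] by blast
  moreover have "f t = \<omega> d ?p (v t)" using f[OF d(2) xv] .
  ultimately show ?thesis using xv by blast
qed

end

section \<open>Definite null second fundamental form\<close>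

text \<open>Definiteness is assumed point by point and chart by chart, so the sign may a priori vary.\<close>
locale definite_null_normalization = closed_null_normalization Mbar U M A D g \<zeta>
  for Mbar U M :: "'m::{second_countable_topology,t2_space} set"
    and A :: "('m, 'e::euclidean_space) chart set"
    and D :: "('m, 'f::euclidean_space) chart set"
    and g :: "('m, 'e) two_tensor"
    and \<zeta> :: "('m, 'e) vec_field" +
  assumes simply_connected_U: "simply_connected U"
    and definite: "\<forall>d\<in>D. \<forall>p\<in>cdom d. definite_on (screen A g \<zeta> d p) (B d p)"
begin

text \<open>The screen part \<open>v - \<omega>(v) \<xi>\<close> carries the value of \<open>B\<close> at \<open>v\<close>, so definiteness on the screen
  gives the sign of \<open>B\<close> off the line spanned by \<open>\<xi>\<close>.\<close>
lemma B_definite: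
  assumes dp: "d \<in> D" "p \<in> cdom d"
  shows "(\<forall>v. v \<noteq> \<omega> d p v *\<^sub>R \<xi> d p \<longrightarrow> B d p v v > 0) \<or> (\<forall>v. v \<noteq> \<omega> d p v *\<^sub>R \<xi> d p \<longrightarrow> B d p v v < 0)"
proof -
  note s = B_screen_part[OF dp]
  have "definite_on (screen A g \<zeta> d p) (B d p)" using definite dp by blast
  then consider "\<forall>v\<in>screen A g \<zeta> d p - {0}. B d p v v > 0" | "\<forall>v\<in>screen A g \<zeta> d p - {0}. B d p v v < 0"
    unfolding definite_on_def by blast
  then show ?thesis
  proof cases
    case 1
    have "B d p v v > 0" if "v \<noteq> \<omega> d p v *\<^sub>R \<xi> d p" for v
    proof -
      have "v - \<omega> d p v *\<^sub>R \<xi> d p \<in> screen A g \<zeta> d p - {0}" using that s(2)[of v] by simp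
      then show ?thesis unfolding s(1)[of v] using 1 by blast
    qed
    then show ?thesis by blast
  next
    case 2
    have "B d p v v < 0" if "v \<noteq> \<omega> d p v *\<^sub>R \<xi> d p" for v
    proof -
      have "v - \<omega> d p v *\<^sub>R \<xi> d p \<in> screen A g \<zeta> d p - {0}" using that s(2)[of v] by simp
      then show ?thesis unfolding s(1)[of v] using 2 by blast
    qed
    then show ?thesis by blast
  qed
qed

lemma B_radial:
  assumes dp: "d \<in> D" "p \<in> cdom d" and v: "v = k *\<^sub>R \<xi> d p"
  shows "B d p v v = 0"
  using B_\<xi>[OF dp] unfolding v by (simp add: bilinear_rmul[OF B_bilinear[OF dp]])

lemma B_zero_imp:
  assumes dp: "d \<in> D" "p \<in> cdom d" and "B d p v v = 0"
  shows "v = \<omega> d p v *\<^sub>R \<xi> d p"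
  using B_definite[OF dp] assms(3) by (metis less_irrefl)

lemma B_semidefinite:
  assumes dp: "d \<in> D" "p \<in> cdom d"
  shows "(\<forall>v. B d p v v \<ge> 0) \<or> (\<forall>v. B d p v v \<le> 0)"
  using B_definite[OF dp] B_radial[OF dp] by (metis less_imp_le order_refl)

text \<open>Points at which \<open>B\<close> takes a positive, respectively a negative, value on the diagonal.\<close>
definition B_pos :: "'m \<Rightarrow> bool" where
  "B_pos p \<longleftrightarrow> (\<exists>d\<in>D. p \<in> cdom d \<and> (\<exists>v. B d p v v > 0))"

definition B_neg :: "'m \<Rightarrow> bool" where
  "B_neg p \<longleftrightarrow> (\<exists>d\<in>D. p \<in> cdom d \<and> (\<exists>v. B d p v v < 0))"

lemma not_B_pos_and_neg: "\<not> (B_pos p \<and> B_neg p)"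
proof
  assume "B_pos p \<and> B_neg p"
  then obtain d v d' v' where d: "d \<in> D" "p \<in> cdom d" "B d p v v > 0"
    and d': "d' \<in> D" "p \<in> cdom d'" "B d' p v' v' < 0"
    unfolding B_pos_def B_neg_def by blast
  have "B d' p (tmap d d' p v) (tmap d d' p v) > 0" using B_tensor[OF d(1,2) d'(1,2)] d(3) by simp
  then show False using B_semidefinite[OF d'(1,2)] d'(3) by (meson not_less)
qed

text \<open>If \<open>B\<close> vanishes at one point, the hypersurface is one-dimensional, the screen is zero, and
  \<open>B\<close> vanishes at every point.\<close>
lemma B_zero_everywhere:
  assumes d: "d \<in> D" "p \<in> cdom d" "\<And>v. B d p v v = 0" and d': "d' \<in> D" "q \<in> cdom d'"
  shows "B d' q v v = 0"
proof -
  have "UNIV \<subseteq> span {\<xi> d p}"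
  proof
    fix w :: 'f
    show "w \<in> span {\<xi> d p}"
      using B_zero_imp[OF d(1,2) d(3)[of w]] by (metis span_base span_mul singletonI)
  qed
  then have "DIM('f) \<le> 1" using dim_le_card[of UNIV "{\<xi> d p}"] by simp
  moreover have "\<xi> d' q \<noteq> 0" using \<omega>_\<xi>[OF d'] linear_0[OF \<omega>_linear[OF d']] by auto
  then have "dim {\<xi> d' q} = 1" using dim_eq_card_independent[of "{\<xi> d' q}"] by (simp add: dim_singleton)
  ultimately have "dim {\<xi> d' q} = DIM('f)" using dim_subset_UNIV[of "{\<xi> d' q}"] by linarith
  then have "span {\<xi> d' q} = UNIV" by (simp only: dim_eq_full)
  then have "v \<in> span {\<xi> d' q}" by simp
  then obtain k where "v = k *\<^sub>R \<xi> d' q" by (auto simp: span_singleton)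
  then show ?thesis by (rule B_radial[OF d'])
qed

text \<open>The factor \<open>\<sigma>\<close> serves to treat both signs at once.\<close>
lemma open_sign_along_curve:
  fixes \<gamma> :: "real \<Rightarrow> 'm" and \<sigma> :: real
  assumes \<gamma>: "continuous_on UNIV \<gamma>" "range \<gamma> \<subseteq> M"
  shows "open {t. \<exists>d\<in>D. \<gamma> t \<in> cdom d \<and> (\<exists>v. \<sigma> * B d (\<gamma> t) v v > 0)}" (is "open ?P")
proof (subst open_subopen, intro ballI)
  fix t assume "t \<in> ?P"
  then obtain d v where d: "d \<in> D" "\<gamma> t \<in> cdom d" and v: "\<sigma> * B d (\<gamma> t) v v > 0" by blast
  have cx: "cinv d (cmap d (\<gamma> s)) = \<gamma> s" if "\<gamma> s \<in> cdom d" for s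
    by (rule cinv_cmap[OF D_chart[OF d(1)] that])
  have "isCont (\<lambda>s. B d (cinv d (cmap d (\<gamma> s))) v v) t"
    using isCont_o2[OF isCont_curve_coordinates[OF \<gamma> d] isCont_B[OF d]] .
  then have "isCont (\<lambda>s. \<sigma> * B d (cinv d (cmap d (\<gamma> s))) v v) t" by (intro continuous_intros)
  then have "\<forall>\<^sub>F s in at t. \<sigma> * B d (cinv d (cmap d (\<gamma> s))) v v > 0"
    using v unfolding isCont_def cx[OF d(2)] by (rule order_tendstoD)
  then have "\<forall>\<^sub>F s in nhds t. \<sigma> * B d (cinv d (cmap d (\<gamma> s))) v v > 0"
    using v by (simp add: eventually_nhds_conv_at cx[OF d(2)])
  moreover have "\<forall>\<^sub>F s in nhds t. \<gamma> s \<in> cdom d"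
    using open_curve_domain[OF \<gamma> d(1)] d(2) eventually_nhds by blast
  ultimately have "\<forall>\<^sub>F s in nhds t. s \<in> ?P"
  proof eventually_elim
    case (elim s)
    then show ?case using d(1) cx by auto
  qed
  then show "\<exists>T. open T \<and> t \<in> T \<and> T \<subseteq> ?P" unfolding eventually_nhds by blast
qed

lemma sign_along_curve:
  fixes \<gamma> :: "real \<Rightarrow> 'm"
  assumes \<gamma>: "continuous_on UNIV \<gamma>" "range \<gamma> \<subseteq> M"
  shows "(\<forall>t. \<forall>d\<in>D. \<gamma> t \<in> cdom d \<longrightarrow> (\<forall>v. B d (\<gamma> t) v v \<ge> 0)) \<or>
         (\<forall>t. \<forall>d\<in>D. \<gamma> t \<in> cdom d \<longrightarrow> (\<forall>v. B d (\<gamma> t) v v \<le> 0))"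
proof (rule ccontr)
  assume contra: "\<not> ?thesis"
  let ?P = "{t. B_pos (\<gamma> t)}" and ?N = "{t. B_neg (\<gamma> t)}"
  have ne: "?P \<noteq> {}" "?N \<noteq> {}"
    using contra unfolding B_pos_def B_neg_def by (auto simp: not_le)
  have "open ?P" "open ?N"
    using open_sign_along_curve[OF \<gamma>, of 1] open_sign_along_curve[OF \<gamma>, of "-1"]
    unfolding B_pos_def B_neg_def by simp_all
  moreover have "?P \<inter> ?N = {}" using not_B_pos_and_neg by blast
  moreover have "?P \<union> ?N = UNIV"
  proof (rule ccontr)
    assume "?P \<union> ?N \<noteq> UNIV"
    then obtain t where t: "\<not> B_pos (\<gamma> t)" "\<not> B_neg (\<gamma> t)" by blast
    obtain d where d: "d \<in> D" "\<gamma> t \<in> cdom d" using D_cover \<gamma>(2) by blast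
    have zero: "B d (\<gamma> t) v v = 0" for v
    proof -
      have "\<not> B d (\<gamma> t) v v > 0" using t(1) d unfolding B_pos_def by blast
      moreover have "\<not> B d (\<gamma> t) v v < 0" using t(2) d unfolding B_neg_def by blast
      ultimately show ?thesis by linarith
    qed
    obtain s where "B_pos (\<gamma> s)" using ne(1) by blast
    then obtain d' v where "d' \<in> D" "\<gamma> s \<in> cdom d'" "B d' (\<gamma> s) v v > 0"
      unfolding B_pos_def by blast
    then show False using B_zero_everywhere[OF d zero, of d' "\<gamma> s" v] by simp
  qed
  ultimately show False
    using connectedD[OF connected_UNIV, of ?P ?N] ne by auto
qed

text \<open>Here \<open>f\<close> is the derivative along \<open>\<gamma>\<close> of all local potentials. The primitive of
  \<open>\<alpha>\<close> along the loop has equal values at its ends, so Rolle's theorem applies.\<close>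
lemma closed_curve_has_critical_potential:
  fixes \<gamma> :: "real \<Rightarrow> 'm"
  assumes \<gamma>: "continuous_on UNIV \<gamma>" "range \<gamma> \<subseteq> M" and T: "T > 0" "\<gamma> T = \<gamma> 0"
    and f: "\<And>t W F. \<lbrakk>potential W F; \<gamma> t \<in> W\<rbrakk> \<Longrightarrow> ((\<lambda>s. F (\<gamma> s)) has_real_derivative f t) (at t)"
  shows "\<exists>t. f t = 0"
proof -
  \<comment> \<open>the loop is reparametrized to the unit interval, which multiplies derivatives by \<open>T\<close>\<close>
  define \<delta> where "\<delta> s = \<gamma> (T * s)" for s
  have "\<exists>G. G 0 = G 1 \<and> (\<forall>t\<in>{0..1}. \<forall>W F. potential W F \<and> \<delta> t \<in> W \<longrightarrow>
           (\<forall>\<^sub>F s in at t within {0..1}. G s - G t = F (\<delta> s) - F (\<delta> t)))"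
  proof (rule loop_primitive_of_potentials[OF simply_connected_U _ potential_exists potential_diff])
    show "openin (top_of_set U) W" if "potential W F" for W F using that by (simp add: potential_def)
    show "continuous_on {0..1} \<delta>" unfolding \<delta>_def
      by (rule continuous_on_compose2[OF \<gamma>(1)]) (auto intro!: continuous_intros)
    show "\<delta> ` {0..1} \<subseteq> U" using \<gamma>(2) M_subset_U by (auto simp: \<delta>_def)
    show "\<delta> 1 = \<delta> 0" using T by (simp add: \<delta>_def)
  qed
  then obtain G where GG: "G 0 = G 1 \<and> (\<forall>t\<in>{0..1}. \<forall>W F. potential W F \<and> \<delta> t \<in> W \<longrightarrow>
           (\<forall>\<^sub>F s in at t within {0..1}. G s - G t = F (\<delta> s) - F (\<delta> t)))" ..
  have G01: "G 0 = G 1" by (rule conjunct1[OF GG])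
  have G: "\<forall>\<^sub>F s in at t within {0..1}. G s - G t = F (\<delta> s) - F (\<delta> t)"
    if "t \<in> {0..1}" "potential W F" "\<delta> t \<in> W" for t W F
    by (rule conjunct2[OF GG, rule_format, OF that(1) conjI[OF that(2,3)]])
  have G': "(G has_real_derivative f (T * t) * T) (at t within {0..1})" if t: "t \<in> {0..1}" for t
  proof -
    have "\<delta> t \<in> U" using \<gamma>(2) M_subset_U by (auto simp: \<delta>_def)
    then obtain W F where F: "potential W F" "\<delta> t \<in> W" using potential_exists by blast
    have "((\<lambda>s. F (\<gamma> s)) has_real_derivative f (T * t)) (at (T * t))"
      using f F by (simp add: \<delta>_def)
    moreover have "((\<lambda>s. T * s) has_real_derivative T) (at t)" by (auto intro!: derivative_eq_intros)
    ultimately have "((\<lambda>s. F (\<gamma> (T * s))) has_real_derivative f (T * t) * T) (at t)"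
      by (rule DERIV_chain2)
    then have "((\<lambda>s. F (\<delta> s)) has_real_derivative f (T * t) * T) (at t)" by (simp add: \<delta>_def)
    then have "((\<lambda>s. F (\<delta> s) + (G t - F (\<delta> t))) has_real_derivative f (T * t) * T) (at t)"
      by (auto intro!: derivative_eq_intros)
    then have 1: "((\<lambda>s. F (\<delta> s) + (G t - F (\<delta> t))) has_real_derivative f (T * t) * T) (at t within {0..1})"
      by (rule has_field_derivative_at_within)
    have "\<forall>\<^sub>F s in at t within {0..1}. G s = F (\<delta> s) + (G t - F (\<delta> t))"
      using G[OF t F] by eventually_elim simp
    then show ?thesis using has_field_derivative_cong_eventually[of G] 1 by simp
  qed
  have "\<exists>z. 0 < z \<and> z < 1 \<and> (*) (f (T * z) * T) = (\<lambda>v. 0)"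
  proof (rule Rolle_deriv[of 0 1 G])
    show "continuous_on {0..1} G"
      using G' by (meson DERIV_continuous continuous_on_eq_continuous_within)
    show "(G has_derivative (*) (f (T * z) * T)) (at z)" if z: "0 < z" "z < 1" for z
      using G'[of z] z by (simp add: has_field_derivative_def at_within_Icc_at)
  qed (use G01 in auto)
  then obtain z where "(*) (f (T * z) * T) = (\<lambda>v. 0)" by blast
  then have "f (T * z) * T * 1 = 0" by (rule fun_cong)
  then show ?thesis using T by auto
qed

lemma no_closed_geodesic: "\<not> closed_geodesic M D gt \<gamma>"
proof
  assume "closed_geodesic M D gt \<gamma>"
  then obtain T where geo: "geodesic_on M D gt UNIV \<gamma>" and T: "T > 0" "\<And>t. \<gamma> (t + T) = \<gamma> t"
    and nonconst: "\<exists>s t. \<gamma> s \<noteq> \<gamma> t" unfolding closed_geodesic_def by blast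
  have \<gamma>: "continuous_on UNIV \<gamma>" "range \<gamma> \<subseteq> M" using geo unfolding geodesic_on_def by auto
  have dom: "\<exists>d\<in>D. \<gamma> t \<in> cdom d" for t using D_cover \<gamma>(2) by blast
  have vel: "\<exists>w. ((\<lambda>r. cmap d (\<gamma> r)) has_vector_derivative w) (at t)" if d: "d \<in> D" "\<gamma> t \<in> cdom d" for d t
    by (rule geodesic_velocity[OF geo d]) (blast dest: eventually_nhds_x_imp_x)
  have pot: "\<exists>W F. potential W F \<and> \<gamma> t \<in> W" for t
    using potential_exists \<gamma>(2) M_subset_U by blast
  have "\<exists>r. \<forall>W F. potential W F \<and> \<gamma> t \<in> W \<longrightarrow> ((\<lambda>s. F (\<gamma> s)) has_real_derivative r) (at t)" for t
    using dom[of t] vel potential_along_curve[OF \<gamma>] by meson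
  then obtain f where f: "\<And>t W F. \<lbrakk>potential W F; \<gamma> t \<in> W\<rbrakk> \<Longrightarrow> ((\<lambda>s. F (\<gamma> s)) has_real_derivative f t) (at t)"
    by metis
  have f_eq: "f t = \<omega> d (\<gamma> t) w"
    if "d \<in> D" "\<gamma> t \<in> cdom d" "((\<lambda>r. cmap d (\<gamma> r)) has_vector_derivative w) (at t)" for d t w
  proof -
    obtain W F where F: "potential W F" "\<gamma> t \<in> W" using pot by blast
    show ?thesis by (rule DERIV_unique[OF f[OF F] potential_along_curve[OF \<gamma> F that]])
  qed
  have deriv: "\<exists>w. ((\<lambda>r. cmap d (\<gamma> r)) has_vector_derivative w) (at t) \<and> f t = \<omega> d (\<gamma> t) w \<and>
     (f has_real_derivative - B d (\<gamma> t) w w) (at t)" if d: "d \<in> D" "\<gamma> t \<in> cdom d" for d t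
    by (rule rigged_component_derivative[OF geo d f_eq[OF d(1)]])
  have per: "f (t + T) = f t" for t
  proof -
    obtain W F where F: "potential W F" "\<gamma> t \<in> W" using pot by blast
    have "((\<lambda>s. F (\<gamma> s)) has_real_derivative f (t + T)) (at (t + T))" using f F T(2) by simp
    then have "((\<lambda>s. F (\<gamma> (s + T))) has_real_derivative f (t + T)) (at t)" by (simp only: DERIV_shift)
    then have "((\<lambda>s. F (\<gamma> s)) has_real_derivative f (t + T)) (at t)" by (simp only: T(2))
    then show ?thesis using f[OF F] DERIV_unique by blast
  qed
  have "\<exists>r d w. d \<in> D \<and> \<gamma> t \<in> cdom d \<and> r = - B d (\<gamma> t) w w \<and> (f has_real_derivative r) (at t)" for t
    using dom[of t] deriv by blast
  then obtain f' where f': "\<And>t. \<exists>d w. d \<in> D \<and> \<gamma> t \<in> cdom d \<and> f' t = - B d (\<gamma> t) w w \<and> (f has_real_derivative f' t) (at t)"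
    by metis
  have fd: "(f has_real_derivative f' t) (at t)" for t using f'[of t] by blast
  have "(\<forall>t. f' t \<le> 0) \<or> (\<forall>t. f' t \<ge> 0)"
    using sign_along_curve[OF \<gamma>]
  proof
    assume *: "\<forall>t. \<forall>d\<in>D. \<gamma> t \<in> cdom d \<longrightarrow> (\<forall>v. B d (\<gamma> t) v v \<ge> 0)"
    have "f' t \<le> 0" for t using f'[of t] * by force
    then show ?thesis by blast
  next
    assume *: "\<forall>t. \<forall>d\<in>D. \<gamma> t \<in> cdom d \<longrightarrow> (\<forall>v. B d (\<gamma> t) v v \<le> 0)"
    have "f' t \<ge> 0" for t using f'[of t] * by force
    then show ?thesis by blast
  qed
  then have f'0: "f' t = 0" for t by (rule periodic_monotone_derivative_zero[OF fd T(1) per])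
  have "\<gamma> T = \<gamma> 0" using T(2)[of 0] by simp
  then have "\<exists>t. f t = 0"
    by (rule closed_curve_has_critical_potential[OF \<gamma> T(1) _ f])
  then obtain t0 where "f t0 = 0" by blast
  then have f0: "f t = 0" for t
    using DERIV_isconst_all[of f t t0] fd f'0 by simp
  \<comment> \<open>the velocity is \<open>f \<xi>\<close>, because \<open>B\<close> vanishes on it, and \<open>f = 0\<close>\<close>
  have v0: "((\<lambda>r. cmap d (\<gamma> r)) has_vector_derivative 0) (at t)" if d: "d \<in> D" "\<gamma> t \<in> cdom d" for d t
  proof -
    obtain w where w: "((\<lambda>r. cmap d (\<gamma> r)) has_vector_derivative w) (at t)" "f t = \<omega> d (\<gamma> t) w"
      "(f has_real_derivative - B d (\<gamma> t) w w) (at t)" using deriv[OF d] by blast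
    have "- B d (\<gamma> t) w w = f' t" by (rule DERIV_unique[OF w(3) fd])
    then have "w = \<omega> d (\<gamma> t) w *\<^sub>R \<xi> d (\<gamma> t)" using B_zero_imp[OF d] f'0 by simp
    then have "w = 0" using w(2) f0 by simp
    then show ?thesis using w(1) by simp
  qed
  have "\<gamma> s = \<gamma> t" for s t
  proof (rule locally_constant_imp_eq[OF connected_UNIV UNIV_I UNIV_I])
    fix t :: real
    obtain d where d: "d \<in> D" "\<gamma> t \<in> cdom d" using dom by blast
    let ?J = "{s. \<gamma> s \<in> cdom d}"
    obtain e where e: "e > 0" "ball t e \<subseteq> ?J" using open_curve_domain[OF \<gamma> d(1)] d(2) openE by blast
    have "\<exists>k. \<forall>s\<in>ball t e. cmap d (\<gamma> s) = k"
    proof (rule has_derivative_zero_constant[OF convex_ball])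
      fix s assume "s \<in> ball t e"
      then have "((\<lambda>r. cmap d (\<gamma> r)) has_vector_derivative 0) (at s)" using v0[OF d(1)] e by blast
      then show "((\<lambda>r. cmap d (\<gamma> r)) has_derivative (\<lambda>h. 0)) (at s within ball t e)"
        by (simp add: has_vector_derivative_def has_derivative_at_withinI)
    qed
    then obtain k where k: "\<And>s. s \<in> ball t e \<Longrightarrow> cmap d (\<gamma> s) = k" by blast
    have "\<gamma> s = \<gamma> t" if s: "s \<in> ball t e" for s
    proof -
      have "cmap d (\<gamma> s) = cmap d (\<gamma> t)" using k[OF s] k[of t] e(1) by simp
      moreover have "\<gamma> s \<in> cdom d" using s e by blast
      ultimately show ?thesis using cinv_cmap[OF D_chart[OF d(1)]] d(2) by metis
    qed
    then have "\<forall>s\<in>ball t e. \<gamma> s = \<gamma> t" by blast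
    moreover have "openin (top_of_set UNIV) (ball t e)" "t \<in> ball t e" using e(1) by simp_all
    ultimately show "\<exists>J. openin (top_of_set UNIV) J \<and> t \<in> J \<and> (\<forall>s\<in>J. \<gamma> s = \<gamma> t)"
      by blast
  qed
  then show False using nonconst by blast
qed

end

section \<open>Nonexistence of closed geodesics\<close>

theorem proposition5p10:
  fixes Mbar U M :: "'m::{second_countable_topology,t2_space} set"
    and A :: "('m, 'e::euclidean_space) chart set"
    and D :: "('m, 'f::euclidean_space) chart set"
    and g :: "('m, 'e) two_tensor"
    and \<zeta> :: "('m, 'e) vec_field"
  assumes "lorentzian_manifold Mbar A g"
    and "null_hypersurface Mbar A g M D"
    and "closed_normalization Mbar A g M D U \<zeta>"
    and "simply_connected U"
    and "geodesically_complete M D (rigged_metric A g \<zeta>)"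
    and "\<forall>d\<in>D. \<forall>p\<in>cdom d. definite_on (screen A g \<zeta> d p) (null_second_form A g \<zeta> d p)"
  shows "\<not> (\<exists>\<gamma>. closed_geodesic M D (rigged_metric A g \<zeta>) \<gamma>)"
proof -
  interpret definite_null_normalization Mbar U M A D g \<zeta>
    using assms(1-4,6) by unfold_locales
  show ?thesis using no_closed_geodesic by blast
qed

end
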